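(* The Clifford ZX-calculus together with the S4 rule is diagonally complete for Clifford+T ZX-diagrams. That is, for any $n$ and any matrices $M,N$ over $\mathbb F_2$ with $n$ columns, if the diagrams $D_M$ and $D_N$ denote the same linear map, $\llbracket D_M\rrbracket=\llbracket D_N\rrbracket$ (up to a nonzero scalar), then $D_M$ can be transformed into $D_N$ using only the rules of the Clifford ZX-calculus and the S4 rule.
   Context: ZX-diagrams are built by composition and tensor product from: Z-spiders with $m$ inputs, $n$ outputs and phase $\alpha\in\mathbb R$ (mod $2\pi$), denoting $|0\rangle^{\otimes n}\langle 0|^{\otimes m}+e^{i\alpha}|1\rangle^{\otimes n}\langle 1|^{\otimes m}$; X-spiders, denoting $|+\rangle^{\otimes n}\langle +|^{\otimes m}+e^{i\alpha}|-\rangle^{\otimes n}\langle -|^{\otimes m}$; the Hadamard box $H$; identity wires, swaps, cups $\sum_i|ii\rangle$ and caps $\sum_i\langle ii|$. An omitted phase is $0$. $\llbracket D\rrbracket$ is the linear map denoted by $D$. Only connectivity matters: diagrams with the same underlying labelled open graph are identified. All equations are taken up to nonzero scalar factors (so diagrams with no inputs and outputs denoting a nonzero number may be freely added or removed). A diagram can be transformed into another if this can be done by a finite sequence of applications, in either direction and to any subdiagram, of the rules. Clifford ZX-calculus rules (for all phases $\alpha,\beta$ and all numbers of legs; each also holds with colours Z/X exchanged): - spider fusion: two Z-spiders with phases $\alpha,\beta$ joined by one or more wires equal one Z-spider with phase $\alpha+\beta$ carrying the remaining legs; - colour change: a Z-spider of phase $\alpha$ with an $H$ on every leg equals the X-spider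 of phase $\alpha$ with the same legs; - $\pi$-copy: a Z-spider of phase $\alpha$ with a 2-legged X-spider of phase $\pi$ on every input equals the Z-spider of phase $-\alpha$ with a 2-legged X-spider of phase $\pi$ on every output; - strong complementarity: an X-spider of phase 0 with $m$ inputs, connected by one wire to a Z-spider of phase 0 with $n$ outputs, equals the diagram with one phase-0 Z-spider on each of the $m$ inputs and one phase-0 X-spider on each of the $n$ outputs, each Z-spider being connected to each X-spider by one wire; - identity: a 2-legged spider of phase 0 is a wire; - $H$-cancellation: $H$ followed by $H$ is a wire; - Euler decomposition: $H$ equals the composite of 2-legged spiders Z$(\frac\pi2)$, X$(\frac\pi2)$, Z$(\frac\pi2)$. Spider-nest maps: $s_n$ is a ZX-diagram with 1 input and $n$ outputs, defined inductively. $s_0$ is the Z-spider of phase $\frac\pi4$ with one input and no outputs. $s_n$ ($n\ge1$) is: the input goes into a phase-0 Z-spider with two outputs; the first output is the input of a copy of $s_{n-1}$; the second goes into a phase-0 3-legged X-spider, whose other two legs are the input of a second copy of $s_{n-1}$ and the $n$-th output wire of $s_n$; for each $1\le j\le n-1$, the $j$-th outputs of the two copies of $s_{n-1}$ are merged by a phase-0 3-legged Z-spider whose remaining leg is the $j$-th output of $s_n$. S4 rule: $s_4$ equals the disconnected diagram consisting of a phase-0 Z-spider with one leg on the input wire and a phase-0 Z-spider with one leg on each of the four output wires. For a matrix $M$ over $\mathbb F_2$ with $n$ columns and $k$ rows, $D_M$ is the ZX-diagram with $n$ inputs and $n$ outputs consisting of a phase-0 Z-spider on each of the $n$ qubit wires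 and, for each row $l$, a phase-0 X-spider connected to the Z-spider on wire $i$ exactly when $M$ has a 1 in row $l$, column $i$, and also connected to a one-legged Z-spider of phase $\frac\pi4$. Up to a nonzero scalar, it denotes the unitary $|\vec x\rangle\mapsto\exp\big(i\frac\pi4\sum_{l}(M\vec x)_l\big)|\vec x\rangle$, where $M\vec x$ is computed over $\mathbb F_2$ and its entries are regarded as integers $0,1$. *)

theory Defs
  imports Complex_Main "HOL-Library.FuncSet" "HOL-Library.Multiset" "HOL-Library.Z2"
    "Jordan_Normal_Form.Matrix"
begin

quotient_type phase = real / "\<lambda>a b. \<exists>k::int. a = b + 2 * pi * of_int k"
proof (rule equivpI)
  show "reflp (\<lambda>a b. \<exists>k::int. a = b + 2 * pi * of_int k)"
    by (rule reflpI) (rule exI[of _ 0], simp)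
  show "symp (\<lambda>a b. \<exists>k::int. a = b + 2 * pi * of_int k)"
  proof (rule sympI)
    fix a b :: real
    assume "\<exists>k::int. a = b + 2 * pi * of_int k"
    then obtain k :: int where "a = b + 2 * pi * of_int k" by blast
    then show "\<exists>k::int. b = a + 2 * pi * of_int k"
      by (intro exI[of _ "- k"]) simp
  qed
  show "transp (\<lambda>a b. \<exists>k::int. a = b + 2 * pi * of_int k)"
  proof (rule transpI)
    fix a b c :: real
    assume "\<exists>k::int. a = b + 2 * pi * of_int k" "\<exists>k::int. b = c + 2 * pi * of_int k"
    then obtain k j :: int where "a = b + 2 * pi * of_int k" "b = c + 2 * pi * of_int j" by blast
    then show "\<exists>k::int. a = c + 2 * pi * of_int k"
      by (intro exI[of _ "k + j"]) (simp add: algebra_simps)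
  qed
qed

instantiation phase :: ab_group_add
begin

lift_definition zero_phase :: phase is 0 .

lift_definition plus_phase :: "phase \<Rightarrow> phase \<Rightarrow> phase" is "(+)"
proof -
  fix a b c d :: real
  assume "\<exists>k::int. a = b + 2 * pi * of_int k" "\<exists>k::int. c = d + 2 * pi * of_int k"
  then obtain k j :: int where "a = b + 2 * pi * of_int k" "c = d + 2 * pi * of_int j" by blast
  then show "\<exists>k::int. a + c = b + d + 2 * pi * of_int k"
    by (intro exI[of _ "k + j"]) (simp add: algebra_simps)
qed

lift_definition uminus_phase :: "phase \<Rightarrow> phase" is uminus
proof -
  fix a b :: real
  assume "\<exists>k::int. a = b + 2 * pi * of_int k"
  then obtain k :: int where "a = b + 2 * pi * of_int k" by blast
  then show "\<exists>k::int. - a = - b + 2 * pi * of_int k"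
    by (intro exI[of _ "- k"]) simp
qed

definition minus_phase :: "phase \<Rightarrow> phase \<Rightarrow> phase"
  where "minus_phase a b = a + - b"

instance
proof
  fix a b c :: phase
  show "a + b + c = a + (b + c)" by transfer (rule exI[of _ 0], simp)
  show "a + b = b + a" by transfer (rule exI[of _ 0], simp)
  show "0 + a = a" by transfer (rule exI[of _ 0], simp)
  show "- a + a = 0" by transfer (rule exI[of _ 0], simp)
  show "a - b = a + - b" by (rule minus_phase_def)
qed

end

lift_definition angle :: "real \<Rightarrow> phase" is "\<lambda>a. a" .

lift_definition expi :: "phase \<Rightarrow> complex" is cis
proof -
  fix a b :: real
  assume "\<exists>k::int. a = b + 2 * pi * of_int k"
  then obtain k :: int where "a = b + 2 * pi * of_int k" by blast
  then show "cis a = cis b"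
    by (simp add: complex_eq_iff sin_add cos_add)
qed

text \<open>Only connectivity matters, so a diagram is the labelled open graph underlying it. Its
  vertices are the spiders and Hadamard boxes. Wires carry names, a vertex is its label together
  with the multiset of names of the wires at its legs, and inputs and outputs are lists of wire
  names. In a well-formed diagram every wire that occurs has exactly two ends, each of them a leg of
  a vertex, an input or an output. Hence a self-loop is a name occurring twice at one vertex, an
  identity wire is \<open>Diagram {#} [a] [a]\<close>, a swap is \<open>Diagram {#} [a, b] [b, a]\<close>, a cup is
  \<open>Diagram {#} [] [a, a]\<close> and a cap is \<open>Diagram {#} [a, a] []\<close>. The well-formed diagrams are, up
  to renaming of wires, those built from these and the single vertices by \<open>tensor\<close> and \<open>compose\<close>.\<close>

datatype colour = Z | X

fun opp :: "colour \<Rightarrow> colour"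
  where "opp Z = X" | "opp X = Z"

datatype label = Spider colour phase | Hadamard

type_synonym vertex = "label \<times> nat multiset"

datatype diagram =
  Diagram (vertices: "vertex multiset") (ins: "nat list") (outs: "nat list")

definition wire_ends :: "diagram \<Rightarrow> nat multiset"
  where "wire_ends D = \<Sum>\<^sub># (image_mset snd (vertices D)) + mset (ins D) + mset (outs D)"

definition wires :: "diagram \<Rightarrow> nat set"
  where "wires D = set_mset (wire_ends D)"

definition well_formed :: "diagram \<Rightarrow> bool"
  where "well_formed D \<longleftrightarrow>
    (\<forall>w \<in> wires D. count (wire_ends D) w = 2) \<and>
    (\<forall>legs. (Hadamard, legs) \<in># vertices D \<longrightarrow> size legs = 2)"

definition rename :: "(nat \<Rightarrow> nat) \<Rightarrow> diagram \<Rightarrow> diagram"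
  where "rename f D =
    Diagram (image_mset (map_prod id (image_mset f)) (vertices D)) (map f (ins D)) (map f (outs D))"

definition same_graph :: "diagram \<Rightarrow> diagram \<Rightarrow> bool"
  where "same_graph D E \<longleftrightarrow> (\<exists>f. inj_on f (wires D) \<and> E = rename f D)"

definition tensor :: "diagram \<Rightarrow> diagram \<Rightarrow> diagram"
  where "tensor D E =
    (let D' = rename (\<lambda>w. 2 * w) D; E' = rename (\<lambda>w. 2 * w + 1) E
     in Diagram (vertices D' + vertices E') (ins D' @ ins E') (outs D' @ outs E'))"

text \<open>\<open>join ps\<close> sends each wire to a representative of its class in the least equivalence relation
  identifying the two wires of every pair in \<open>ps\<close>.\<close>

definition join :: "(nat \<times> nat) list \<Rightarrow> nat \<Rightarrow> nat"
  where "join ps = fold (\<lambda>(a, b) \<sigma>. (\<lambda>w. if \<sigma> w = \<sigma> b then \<sigma> a else \<sigma> w)) ps id"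

text \<open>In \<open>compose D E\<close> the outputs of \<open>D\<close> are plugged into the inputs of \<open>E\<close>. A closed loop
  without vertices (a cap after a cup) leaves no trace; it would only contribute the nonzero
  scalar 2, and all equations below are up to nonzero scalars.\<close>

definition compose :: "diagram \<Rightarrow> diagram \<Rightarrow> diagram"
  where "compose D E =
    (let D' = rename (\<lambda>w. 2 * w) D; E' = rename (\<lambda>w. 2 * w + 1) E;
         \<sigma> = join (zip (outs D') (ins E'))
     in rename \<sigma> (Diagram (vertices D' + vertices E') (ins D') (outs E')))"

text \<open>\<open>label_tensor a B\<close> is the entry, at the computational basis state given by the bits \<open>B\<close> on
  the legs, of the tensor with label \<open>a\<close>. All these tensors are symmetric in their legs and
  invariant under exchanging input and output legs.\<close>

fun label_tensor :: "label \<Rightarrow> bit multiset \<Rightarrow> complex"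
  where
    "label_tensor (Spider Z \<alpha>) B =
      (\<Prod>b\<in>#B. if b = 0 then 1 else 0) + expi \<alpha> * (\<Prod>b\<in>#B. if b = 0 then 0 else 1)"
  | "label_tensor (Spider X \<alpha>) B =
      (\<Prod>b\<in>#B. 1 / sqrt 2) + expi \<alpha> * (\<Prod>b\<in>#B. if b = 0 then 1 / sqrt 2 else - 1 / sqrt 2)"
  | "label_tensor Hadamard B = (if B = {#1, 1#} then - 1 / sqrt 2 else 1 / sqrt 2)"

text \<open>\<open>denote D x y\<close> is the matrix entry \<open>\<langle>y|D|x\<rangle>\<close>, obtained by contracting the tensors of the
  vertices along the wires.\<close>

definition denote :: "diagram \<Rightarrow> bit list \<Rightarrow> bit list \<Rightarrow> complex"
  where "denote D x y =
    (\<Sum>v \<in> {v \<in> wires D \<rightarrow>\<^sub>E UNIV. map v (ins D) = x \<and> map v (outs D) = y}.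
      \<Prod>(a, legs)\<in>#vertices D. label_tensor a (image_mset v legs))"

definition denote_same_map :: "diagram \<Rightarrow> diagram \<Rightarrow> bool"
  where "denote_same_map D E \<longleftrightarrow>
    length (ins D) = length (ins E) \<and> length (outs D) = length (outs E) \<and>
    (\<exists>c. c \<noteq> 0 \<and> (\<forall>x y. denote D x y = c * denote E x y))"

inductive clifford_rule :: "diagram \<Rightarrow> diagram \<Rightarrow> bool"
  where
    spider_fusion: "clifford_rule
      (Diagram {#(Spider c \<alpha>, mset (a @ b @ e)), (Spider c \<beta>, mset (a' @ b' @ e))#} (a @ a') (b @ b'))
      (Diagram {#(Spider c (\<alpha> + \<beta>), mset (a @ a' @ b @ b'))#} (a @ a') (b @ b'))"
    if "distinct (a @ a' @ b @ b' @ e)" "e \<noteq> []"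
  | colour_change: "clifford_rule
      (Diagram (add_mset (Spider c \<alpha>, mset (a' @ b'))
         (mset (map2 (\<lambda>u w. (Hadamard, {#u, w#})) (a @ b) (a' @ b')))) a b)
      (Diagram {#(Spider (opp c) \<alpha>, mset (a @ b))#} a b)"
    if "distinct (a @ b @ a' @ b')" "length a' = length a" "length b' = length b"
  | pi_copy: "clifford_rule
      (Diagram (add_mset (Spider c \<alpha>, mset (a' @ b))
         (mset (map2 (\<lambda>u w. (Spider (opp c) (angle pi), {#u, w#})) a a'))) a b)
      (Diagram (add_mset (Spider c (- \<alpha>), mset (a @ b'))
         (mset (map2 (\<lambda>u w. (Spider (opp c) (angle pi), {#u, w#})) b b'))) a b)"
    if "distinct (a @ b @ a' @ b')" "length a' = length a" "length b' = length b"
  | strong_complementarity: "clifford_rule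
      (Diagram {#(Spider (opp c) 0, mset (e # a)), (Spider c 0, mset (e # b))#} a b)
      (Diagram
         (mset (map (\<lambda>i. (Spider c 0, mset (a ! i # map (\<lambda>j. w i j) [0..<length b]))) [0..<length a]) +
          mset (map (\<lambda>j. (Spider (opp c) 0, mset (b ! j # map (\<lambda>i. w i j) [0..<length a]))) [0..<length b]))
         a b)"
    if "distinct (e # a @ b)"
      "distinct (a @ b @ concat (map (\<lambda>i. map (\<lambda>j. w i j) [0..<length b]) [0..<length a]))"
  | identity: "clifford_rule
      (Diagram {#(Spider c 0, {#a, b#})#} [a] [b])
      (Diagram {#} [a] [a])"
    if "a \<noteq> b"
  | hadamard_cancellation: "clifford_rule
      (Diagram {#(Hadamard, {#a, e#}), (Hadamard, {#e, b#})#} [a] [b])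
      (Diagram {#} [a] [a])"
    if "distinct [a, e, b]"
  | euler_decomposition: "clifford_rule
      (Diagram {#(Hadamard, {#a, b#})#} [a] [b])
      (Diagram {#(Spider c (angle (pi / 2)), {#a, e#}), (Spider (opp c) (angle (pi / 2)), {#e, f#}),
         (Spider c (angle (pi / 2)), {#f, b#})#} [a] [b])"
    if "distinct [a, e, f, b]"

text \<open>In \<open>nest (Suc n)\<close> the wires of the two copies of \<open>nest n\<close> are renamed to the residue classes 0
  and 1 modulo 4, the first \<open>n\<close> outputs lie in the residue class 2, and 3, 7, 11 are the input,
  the last output and the wire between the Z-spider at the input and the X-spider.\<close>

primrec nest :: "nat \<Rightarrow> diagram"
  where
    "nest 0 = Diagram {#(Spider Z (angle (pi / 4)), {#0#})#} [0] []"
  | "nest (Suc n) =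
      (let A = rename (\<lambda>w. 4 * w) (nest n); B = rename (\<lambda>w. 4 * w + 1) (nest n)
       in Diagram
         (vertices A + vertices B +
          {#(Spider Z 0, {#3, hd (ins A), 11#}), (Spider X 0, {#11, hd (ins B), 7#})#} +
          mset (map (\<lambda>j. (Spider Z 0, {#outs A ! j, outs B ! j, 4 * j + 2#})) [0..<n]))
         [3] (map (\<lambda>j. 4 * j + 2) [0..<n] @ [7]))"

inductive S4_rule :: "diagram \<Rightarrow> diagram \<Rightarrow> bool"
  where
    S4: "S4_rule (nest 4)
      (Diagram {#(Spider Z 0, {#0#}), (Spider Z 0, {#1#}), (Spider Z 0, {#2#}),
         (Spider Z 0, {#3#}), (Spider Z 0, {#4#})#} [0] [1, 2, 3, 4])"

text \<open>Closure under composition and tensor product, together with identification of diagrams with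
  the same graph, amounts to applying rules to arbitrary subdiagrams.\<close>

inductive transformable :: "(diagram \<Rightarrow> diagram \<Rightarrow> bool) \<Rightarrow> diagram \<Rightarrow> diagram \<Rightarrow> bool" for R
  where
    apply_rule: "R D E \<Longrightarrow> transformable R D E"
  | same_graph: "well_formed D \<Longrightarrow> same_graph D E \<Longrightarrow> transformable R D E"
  | scalar: "well_formed D \<Longrightarrow> well_formed S \<Longrightarrow> ins S = [] \<Longrightarrow> outs S = [] \<Longrightarrow>
      denote S [] [] \<noteq> 0 \<Longrightarrow> transformable R D (tensor D S)"
  | reverse: "transformable R D E \<Longrightarrow> transformable R E D"
  | sequence: "transformable R D E \<Longrightarrow> transformable R E F \<Longrightarrow> transformable R D F"
  | in_composite: "transformable R D D' \<Longrightarrow> transformable R E E' \<Longrightarrow>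
      length (outs D) = length (ins E) \<Longrightarrow> transformable R (compose D E) (compose D' E')"
  | in_tensor: "transformable R D D' \<Longrightarrow> transformable R E E' \<Longrightarrow>
      transformable R (tensor D E) (tensor D' E')"

text \<open>Wires, for \<open>k\<close> rows and \<open>n\<close> columns: \<open>i\<close> and \<open>n + i\<close> are the input and output of qubit \<open>i\<close>,
  \<open>2 * n + l\<close> joins the X-spider of row \<open>l\<close> to its one-legged Z-spider, and
  \<open>2 * n + k + l * n + i\<close> joins the Z-spider of qubit \<open>i\<close> to the X-spider of row \<open>l\<close>.\<close>

definition matrix_diagram :: "bit mat \<Rightarrow> diagram"
  where "matrix_diagram M =
    (let n = dim_col M; k = dim_row M; g = (\<lambda>l i. 2 * n + k + l * n + i) in
     Diagram
       (mset (map (\<lambda>i. (Spider Z 0,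
            mset (i # (n + i) # map (\<lambda>l. g l i) (filter (\<lambda>l. M $$ (l, i) = 1) [0..<k])))) [0..<n]) +
        mset (map (\<lambda>l. (Spider X 0,
            mset ((2 * n + l) # map (\<lambda>i. g l i) (filter (\<lambda>i. M $$ (l, i) = 1) [0..<n])))) [0..<k]) +
        mset (map (\<lambda>l. (Spider Z (angle (pi / 4)), {#2 * n + l#})) [0..<k]))
       [0..<n] [n..<2 * n])"

end

theory Submission
  imports Defs "HOL-Library.Countable" "HOL-Combinatorics.List_Permutation"
begin

text \<open>A diagram \<open>D\<^sub>M\<close> is a collection of \<open>\<pi>/4\<close> phase gadgets, one for each row of \<open>M\<close>. Copying
  and adding the parities that feed a spider nest, by strong complementarity and the Hopf law, turns
  a nest attached to the parities \<open>v\<^sub>0, \<dots>, v\<^sub>4\<close> into gadgets on all sixteen vectors of the affine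
  cube \<open>v\<^sub>0 + \<langle>v\<^sub>1, \<dots>, v\<^sub>4\<rangle>\<close>, so by S4 these gadgets may be created and removed together. Degenerate
  cubes show that a gadget on a vector of weight \<open>d\<close>, taken \<open>2\<^sup>4\<^sup>-\<^sup>d\<close> times (once if \<open>d \<ge> 4\<close>), can be
  replaced by gadgets on vectors of smaller weight. If the total phase vanishes modulo \<open>2\<pi>\<close> then
  the multiplicities of the gadgets of maximal weight \<open>d\<close> are divisible by \<open>2\<^sup>4\<^sup>-\<^sup>d\<close>, by
  inclusion-exclusion over the inputs supported in the vector, and so all gadgets can be removed
  by descending weight.\<close>

section \<open>Renaming, composition and tensor product\<close>

text \<open>The exponent \<open>4 - d\<close>: a cube with \<open>d\<close> disjoint directions must
  be padded to four by zero directions, and each of these doubles every multiplicity. Heavier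
  vectors fit as well, since four directions can partition a support of any size at least 4.
  Multisets of gadgets have no subtraction, but padding the line {0, v} yields eight copies of both
  points, and the gadget on 0 is free; hence eight copies of any gadget vanish and seven copies act
  as its negative. The divisibility argument needs the total phase to vanish again after each
  descent, which holds because a cube contributes a multiple of 8 units of pi/4. The unknown global
  scalar is fixed by the all-zero input, where every parity is 0. Two obstacles shape the
  diagrammatic half: the rules are closed only under composition and tensor product, so rewriting
  inside a larger graph has to be derived; and graphs carry named wires, so every step must show
  that the names it introduces are fresh and that each wire keeps exactly two ends.\<close>

lemma wire_ends_Diagram [simp]:
  "wire_ends (Diagram V I O') = \<Sum>\<^sub># (image_mset snd V) + mset I + mset O'"
  by (simp add: wire_ends_def)

lemma wires_Diagram: "wires (Diagram V I O') = (\<Union>p\<in>set_mset V. set_mset (snd p)) \<union> set I \<union> set O'"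
  by (auto simp: wires_def)

text \<open>Ranging over all names rather than over \<open>wires D\<close> turns well-formedness
  into arithmetic on counts.\<close>

lemma well_formed_count:
  "well_formed D \<longleftrightarrow> (\<forall>w. count (wire_ends D) w = 0 \<or> count (wire_ends D) w = 2) \<and>
    (\<forall>legs. (Hadamard, legs) \<in># vertices D \<longrightarrow> size legs = 2)"
  unfolding well_formed_def wires_def by (metis count_eq_zero_iff)

lemma wire_ends_rename: "wire_ends (rename f D) = image_mset f (wire_ends D)"
proof -
  have "\<Sum>\<^sub># (image_mset snd (image_mset (map_prod id (image_mset f)) V)) =
      image_mset f (\<Sum>\<^sub># (image_mset snd V))" for V :: "vertex multiset"
    by (induction V) auto
  then show ?thesis by (simp add: rename_def wire_ends_def)
qed

lemma wires_rename: "wires (rename f D) = f ` wires D"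
  by (simp add: wires_def wire_ends_rename)

lemma rename_rename: "rename f (rename g D) = rename (f \<circ> g) D"
  by (simp add: rename_def multiset.map_comp comp_def map_prod_def case_prod_unfold)

lemma rename_id: "rename id D = D"
  by (simp add: rename_def map_prod.id map_prod_def)

lemma rename_cong:
  assumes "\<And>w. w \<in> wires D \<Longrightarrow> f w = g w"
  shows "rename f D = rename g D"
proof -
  obtain V I O' where D: "D = Diagram V I O'" by (cases D)
  have "image_mset (map_prod id (image_mset f)) V = image_mset (map_prod id (image_mset g)) V"
    using assms by (intro image_mset_cong) (force simp: D wires_Diagram intro!: image_mset_cong)
  then show ?thesis
    using assms by (auto simp: rename_def D wires_Diagram)
qed

lemma rename_Diagram [simp]:
  "rename f (Diagram V I O') = Diagram (image_mset (map_prod id (image_mset f)) V) (map f I) (map f O')"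
  by (simp add: rename_def)

lemma same_graph_sym:
  assumes "same_graph D E"
  shows "same_graph E D"
proof -
  obtain f where f: "inj_on f (wires D)" "E = rename f D" using assms by (auto simp: same_graph_def)
  have "rename (inv_into (wires D) f) E = rename id D"
    unfolding f(2) rename_rename by (rule rename_cong) (simp add: f)
  moreover have "inj_on (inv_into (wires D) f) (wires E)"
    unfolding f(2) wires_rename by (rule inj_on_inv_into) simp
  ultimately show ?thesis unfolding same_graph_def rename_id by metis
qed

lemma count_image_mset_inj_on:
  assumes "inj_on f S" "set_mset M \<subseteq> S" "x \<in> S"
  shows "count (image_mset f M) (f x) = count M x"
proof -
  have "f -` {f x} \<inter> set_mset M = {x} \<inter> set_mset M"
    using assms by (auto dest: inj_onD)
  then show ?thesis
    by (cases "x \<in># M") (auto simp: count_image_mset count_eq_zero_iff)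
qed

lemma well_formed_rename:
  assumes "well_formed D" "inj_on f (wires D)"
  shows "well_formed (rename f D)"
proof -
  have "count (wire_ends (rename f D)) w = 2" if w: "w \<in> wires (rename f D)" for w
  proof -
    obtain u where u: "u \<in> wires D" "w = f u" using w by (auto simp: wires_rename)
    have "count (wire_ends (rename f D)) w = count (wire_ends D) u"
      unfolding u(2) wire_ends_rename
      by (rule count_image_mset_inj_on[OF assms(2) _ u(1)]) (simp add: wires_def)
    then show ?thesis using assms(1) u(1) by (simp add: well_formed_def)
  qed
  then show ?thesis
    using assms(1) by (auto simp: well_formed_def rename_def)
qed

lemma transformable_refl: "well_formed D \<Longrightarrow> transformable R D D"
  by (rule transformable.same_graph) (auto simp: same_graph_def intro!: exI[of _ id] simp: rename_id)

lemma transformable_rename: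
  "well_formed D \<Longrightarrow> inj_on f (wires D) \<Longrightarrow> transformable R D (rename f D)"
  by (rule transformable.same_graph) (auto simp: same_graph_def)

section \<open>Gluing wires along \<open>join\<close>\<close>

lemma join_snoc: "join (ps @ [(a, b)]) w =
    (if join ps w = join ps b then join ps a else join ps w)"
  by (simp add: join_def)

text \<open>Minimality of the generated equivalence: a function constant on every glued pair is
  constant on the classes. The induction runs from the end of the list because \<open>fold\<close>
  treats the last pair last.\<close>

lemma join_respects:
  assumes "\<And>a b. (a, b) \<in> set ps \<Longrightarrow> \<phi> a = \<phi> b" "join ps x = join ps y"
  shows "\<phi> x = \<phi> y"
  using assms
proof (induction ps arbitrary: x y rule: rev_induct)
  case Nil
  then show ?case by (simp add: join_def)
next
  case (snoc p ps)
  obtain a b where p: "p = (a, b)" by (cases p)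
  have IH: "join ps x = join ps y \<Longrightarrow> \<phi> x = \<phi> y" for x y
    using snoc.IH[of x y] snoc.prems(1) by auto
  have "\<phi> a = \<phi> b" using snoc.prems(1) p by auto
  then show ?case using snoc.prems(2) IH unfolding p join_snoc by (metis)
qed

lemma join_pair:
  assumes "(a, b) \<in> set ps"
  shows "join ps a = join ps b"
  using assms
proof (induction ps rule: rev_induct)
  case (snoc p ps)
  obtain c d where p: "p = (c, d)" by (cases p)
  show ?case using snoc unfolding p join_snoc by auto
qed simp

text \<open>Identifying the outputs of \<open>D\<close> with the inputs of \<open>E\<close> via the naming functions \<open>p\<close> and \<open>q\<close>
  describes the composite as soon as \<open>p\<close> and \<open>q\<close> identify no more wires than \<open>join\<close> does.\<close>

lemma same_graph_compose:
  fixes p q :: "nat \<Rightarrow> nat" and D E :: diagram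
  defines "\<sigma> \<equiv> join (zip (map (\<lambda>w. 2 * w) (outs D)) (map (\<lambda>w. 2 * w + 1) (ins E)))"
  assumes eq: "map p (outs D) = map q (ins E)"
    and DD: "\<And>x y. x \<in> wires D \<Longrightarrow> y \<in> wires D \<Longrightarrow> p x = p y \<Longrightarrow> \<sigma> (2 * x) = \<sigma> (2 * y)"
    and DE: "\<And>x y. x \<in> wires D \<Longrightarrow> y \<in> wires E \<Longrightarrow> p x = q y \<Longrightarrow> \<sigma> (2 * x) = \<sigma> (2 * y + 1)"
    and EE: "\<And>x y. x \<in> wires E \<Longrightarrow> y \<in> wires E \<Longrightarrow> q x = q y \<Longrightarrow> \<sigma> (2 * x + 1) = \<sigma> (2 * y + 1)"
  shows "same_graph (compose D E)
    (Diagram (vertices (rename p D) + vertices (rename q E)) (map p (ins D)) (map q (outs E)))"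
proof -
  \<comment> \<open>\<open>compose\<close> tags the wires of \<open>D\<close> by even and those of
    \<open>E\<close> by odd numbers; \<open>\<phi>\<close> removes the tag and applies the matching
    naming function.\<close>
  define \<phi> where "\<phi> w = (if even w then p (w div 2) else q (w div 2))" for w :: nat
  have \<phi>0: "\<phi> (2 * w) = p w" and \<phi>1: "\<phi> (2 * w + 1) = q w" for w
    by (simp_all add: \<phi>_def)
  define G where "G = Diagram (vertices (rename (\<lambda>w. 2 * w) D) + vertices (rename (\<lambda>w. 2 * w + 1) E))
    (map (\<lambda>w. 2 * w) (ins D)) (map (\<lambda>w. 2 * w + 1) (outs E))"
  have wG: "\<exists>u. (u \<in> wires D \<and> w = 2 * u) \<or> (u \<in> wires E \<and> w = 2 * u + 1)" if "w \<in> wires G" for w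
    using that unfolding G_def by (cases D; cases E) (auto simp: wires_Diagram)
  have comp: "compose D E = rename \<sigma> G"
    by (simp add: compose_def Let_def \<sigma>_def G_def rename_def)
  define ps where "ps = zip (map (\<lambda>w. 2 * w) (outs D)) (map (\<lambda>w. 2 * w + 1) (ins E))"
  have pair: "\<phi> a = \<phi> b" if "(a, b) \<in> set ps" for a b
  proof -
    obtain i where i: "i < length (outs D)" "i < length (ins E)"
      "a = 2 * (outs D ! i)" "b = 2 * (ins E ! i) + 1"
      using \<open>(a, b) \<in> set ps\<close> by (auto simp: set_zip ps_def)
    have "p (outs D ! i) = q (ins E ! i)" using arg_cong[OF eq, of "\<lambda>l. l ! i"] i(1,2) by simp
    then show ?thesis unfolding i(3,4) \<phi>0 \<phi>1 .
  qed
  have resp: "\<phi> x = \<phi> y" if "\<sigma> x = \<sigma> y" for x y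
    using that join_respects[of ps \<phi> x y] pair unfolding \<sigma>_def ps_def by blast
  have inj: "\<sigma> x = \<sigma> y" if xy: "x \<in> wires G" "y \<in> wires G" "\<phi> x = \<phi> y" for x y
  proof -
    from wG[OF xy(1)] obtain u where u: "u \<in> wires D \<and> x = 2 * u \<or> u \<in> wires E \<and> x = 2 * u + 1" ..
    from wG[OF xy(2)] obtain t where t: "t \<in> wires D \<and> y = 2 * t \<or> t \<in> wires E \<and> y = 2 * t + 1" ..
    from u t xy(3) show ?thesis
      by (elim disjE conjE; simp only: \<phi>0 \<phi>1)
        (rule DD DE EE DE[symmetric]; (assumption | rule sym, assumption))+
  qed
  \<comment> \<open>\<open>\<phi>\<close> is constant on the classes of \<open>\<sigma>\<close> by
    \<open>resp\<close>, so any representative may be chosen and \<open>\<phi>\<close> factors as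
    \<open>f\<close> after \<open>\<sigma>\<close>.\<close>
  define f where "f w = \<phi> (SOME x. \<sigma> x = w)" for w
  have f: "f (\<sigma> x) = \<phi> x" for x
    unfolding f_def by (rule resp) (rule someI[of "\<lambda>y. \<sigma> y = \<sigma> x" x], rule refl)
  have "inj_on f (wires (compose D E))"
    unfolding comp wires_rename by (rule inj_onI) (auto simp: f intro: inj)
  moreover have "rename f (compose D E) = rename \<phi> G"
    unfolding comp rename_rename by (rule rename_cong) (simp add: f)
  moreover have "rename \<phi> G = Diagram (vertices (rename p D) + vertices (rename q E)) (map p (ins D)) (map q (outs E))"
    unfolding G_def by (simp add: rename_def multiset.map_comp comp_def map_prod_def case_prod_unfold \<phi>0 \<phi>1[simplified])
  ultimately show ?thesis unfolding same_graph_def by metis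
qed

text \<open>Every output of \<open>D\<close> is glued to its partner among the inputs of
  \<open>E\<close>. As \<open>q\<close> is injective, outputs with equal names have the same
  partner, so \<open>p\<close> identifies nothing that \<open>join\<close> keeps apart.\<close>

lemma same_graph_compose_left:
  assumes eq: "map p (outs D) = map q (ins E)"
    and DD: "\<And>x y. x \<in> wires D \<Longrightarrow> y \<in> wires D \<Longrightarrow> p x = p y \<Longrightarrow> x = y \<or> x \<in> set (outs D) \<and> y \<in> set (outs D)"
    and DE: "\<And>x y. x \<in> wires D \<Longrightarrow> y \<in> wires E \<Longrightarrow> p x = q y \<Longrightarrow> x \<in> set (outs D)"
    and EE: "inj_on q (wires E)"
  shows "same_graph (compose D E)
    (Diagram (vertices (rename p D) + vertices (rename q E)) (map p (ins D)) (map q (outs E)))"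
proof (rule same_graph_compose[OF eq])
  let ?\<sigma> = "join (zip (map (\<lambda>w. 2 * w) (outs D)) (map (\<lambda>w. 2 * w + 1) (ins E)))"
  have len: "length (outs D) = length (ins E)" using arg_cong[OF eq, of length] by simp
  have ex: "\<exists>y \<in> wires E. q y = p x \<and> ?\<sigma> (2 * x) = ?\<sigma> (2 * y + 1)" if out: "x \<in> set (outs D)" for x
  proof -
    obtain i where i: "i < length (outs D)" "x = outs D ! i" using out by (auto simp: in_set_conv_nth)
    have "ins E ! i \<in> wires E" using i len by (simp add: wires_def wire_ends_def)
    moreover have "q (ins E ! i) = p x" using arg_cong[OF eq, of "\<lambda>l. l ! i"] i len by simp
    moreover have "?\<sigma> (2 * x) = ?\<sigma> (2 * (ins E ! i) + 1)"
      by (rule join_pair) (use i len in \<open>auto simp: set_zip intro!: exI[of _ i]\<close>)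
    ultimately show ?thesis by blast
  qed
  show "?\<sigma> (2 * x + 1) = ?\<sigma> (2 * y + 1)" if xy: "x \<in> wires E" "y \<in> wires E" "q x = q y" for x y
    using xy EE by (auto dest: inj_onD)
  show "?\<sigma> (2 * x) = ?\<sigma> (2 * y + 1)" if "x \<in> wires D" "y \<in> wires E" "p x = q y" for x y
    using ex[OF DE[OF that]] that EE by (metis inj_onD)
  show "?\<sigma> (2 * x) = ?\<sigma> (2 * y)" if xy: "x \<in> wires D" "y \<in> wires D" "p x = p y" for x y
  proof (cases "x = y")
    case False
    then obtain u t where "u \<in> wires E" "q u = p x" "?\<sigma> (2 * x) = ?\<sigma> (2 * u + 1)"
      "t \<in> wires E" "q t = p y" "?\<sigma> (2 * y) = ?\<sigma> (2 * t + 1)"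
      using DD[OF xy] ex[of x] ex[of y] by blast
    moreover from this have "u = t" using EE xy(3) by (simp add: inj_on_def)
    ultimately show ?thesis by simp
  qed simp
qed

lemma same_graph_compose_right:
  assumes eq: "map p (outs D) = map q (ins E)"
    and EE: "\<And>x y. x \<in> wires E \<Longrightarrow> y \<in> wires E \<Longrightarrow> q x = q y \<Longrightarrow> x = y \<or> x \<in> set (ins E) \<and> y \<in> set (ins E)"
    and DE: "\<And>x y. x \<in> wires D \<Longrightarrow> y \<in> wires E \<Longrightarrow> p x = q y \<Longrightarrow> y \<in> set (ins E)"
    and DD: "inj_on p (wires D)"
  shows "same_graph (compose D E)
    (Diagram (vertices (rename p D) + vertices (rename q E)) (map p (ins D)) (map q (outs E)))"
proof (rule same_graph_compose[OF eq])
  let ?\<sigma> = "join (zip (map (\<lambda>w. 2 * w) (outs D)) (map (\<lambda>w. 2 * w + 1) (ins E)))"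
  have len: "length (outs D) = length (ins E)" using arg_cong[OF eq, of length] by simp
  have ex: "\<exists>x \<in> wires D. p x = q y \<and> ?\<sigma> (2 * x) = ?\<sigma> (2 * y + 1)" if out: "y \<in> set (ins E)" for y
  proof -
    obtain i where i: "i < length (ins E)" "y = ins E ! i" using out by (auto simp: in_set_conv_nth)
    have "outs D ! i \<in> wires D" using i len by (simp add: wires_def wire_ends_def)
    moreover have "p (outs D ! i) = q y" using arg_cong[OF eq, of "\<lambda>l. l ! i"] i len by simp
    moreover have "?\<sigma> (2 * (outs D ! i)) = ?\<sigma> (2 * y + 1)"
      by (rule join_pair) (use i len in \<open>auto simp: set_zip intro!: exI[of _ i]\<close>)
    ultimately show ?thesis by blast
  qed
  show "?\<sigma> (2 * x) = ?\<sigma> (2 * y)" if xy: "x \<in> wires D" "y \<in> wires D" "p x = p y" for x y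
    using xy DD by (auto dest: inj_onD)
  show "?\<sigma> (2 * x) = ?\<sigma> (2 * y + 1)" if "x \<in> wires D" "y \<in> wires E" "p x = q y" for x y
    using ex[OF DE[OF that]] that DD by (metis inj_onD)
  show "?\<sigma> (2 * x + 1) = ?\<sigma> (2 * y + 1)" if xy: "x \<in> wires E" "y \<in> wires E" "q x = q y" for x y
  proof (cases "x = y")
    case False
    then obtain u t where "u \<in> wires D" "p u = q x" "?\<sigma> (2 * u) = ?\<sigma> (2 * x + 1)"
      "t \<in> wires D" "p t = q y" "?\<sigma> (2 * t) = ?\<sigma> (2 * y + 1)"
      using EE[OF xy] ex[of x] ex[of y] by blast
    moreover from this have "u = t" using DD xy(3) by (simp add: inj_on_def)
    ultimately show ?thesis by simp
  qed simp
qed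

lemma same_graph_tensor:
  assumes "inj_on p (wires D)" "inj_on q (wires E)" "p ` wires D \<inter> q ` wires E = {}"
  shows "same_graph (tensor D E) (Diagram (vertices (rename p D) + vertices (rename q E))
    (map p (ins D) @ map q (ins E)) (map p (outs D) @ map q (outs E)))"
proof -
  define \<phi> where "\<phi> w = (if even w then p (w div 2) else q (w div 2))" for w :: nat
  have \<phi>0: "\<phi> (2 * w) = p w" and \<phi>1: "\<phi> (2 * w + 1) = q w" for w
    by (simp_all add: \<phi>_def)
  have w: "wires (tensor D E) = (\<lambda>w. 2 * w) ` wires D \<union> (\<lambda>w. 2 * w + 1) ` wires E"
    by (cases D; cases E) (auto simp: tensor_def wires_Diagram)
  have "inj_on \<phi> (wires (tensor D E))"
    unfolding w inj_on_Un
  proof (intro conjI ballI)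
    show "inj_on \<phi> ((\<lambda>w. 2 * w) ` wires D)"
      by (rule inj_on_imageI) (use assms(1) in \<open>simp add: inj_on_def \<phi>0\<close>)
    show "inj_on \<phi> ((\<lambda>w. 2 * w + 1) ` wires E)"
      by (rule inj_on_imageI) (use assms(2) in \<open>simp add: inj_on_def \<phi>1[simplified]\<close>)
    show "\<phi> ` ((\<lambda>w. 2 * w) ` wires D - (\<lambda>w. 2 * w + 1) ` wires E) \<inter>
      \<phi> ` ((\<lambda>w. 2 * w + 1) ` wires E - (\<lambda>w. 2 * w) ` wires D) = {}"
      using assms(3) by (auto simp: \<phi>0 \<phi>1[simplified])
  qed
  moreover have "rename \<phi> (tensor D E) = Diagram (vertices (rename p D) + vertices (rename q E))
    (map p (ins D) @ map q (ins E)) (map p (outs D) @ map q (outs E))"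
    by (simp add: tensor_def rename_def multiset.map_comp comp_def map_prod_def case_prod_unfold \<phi>0 \<phi>1[simplified])
  ultimately show ?thesis unfolding same_graph_def by metis
qed

section \<open>Rewriting inside a context\<close>

text \<open>Cups turn inputs into outputs. The closure rules only offer composition and tensor
  product, so the cups and the wires running beside the diagram are supplied explicitly.\<close>

lemma transformable_bend:
  assumes tr: "transformable R (Diagram V a b) (Diagram V' a b)"
    and wf: "well_formed (Diagram V a b)" "well_formed (Diagram V' a b)"
    and d: "distinct a"
  shows "transformable R (Diagram V [] (a @ b)) (Diagram V' [] (a @ b))"
proof -
  \<comment> \<open>\<open>?D\<close> has one cup per input; \<open>?I\<close> leads one end of each
    cup to the outputs while the other end feeds the diagram.\<close>
  let ?D = "Diagram {#} [] (a @ a)" and ?I = "Diagram {#} a a"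
  have wD: "well_formed ?D" "well_formed ?I"
    using d by (auto simp: well_formed_count distinct_count_atmost_1)
  have sg: "same_graph (compose ?D (tensor ?I (Diagram V a b))) (Diagram V [] (a @ b))"
    if wf: "well_formed (Diagram V a b)" for V
  proof -
    let ?E = "tensor ?I (Diagram V a b)"
    have E: "?E = Diagram (image_mset (map_prod id (image_mset (\<lambda>w. 2 * w + 1))) V)
      (map (\<lambda>w. 2 * w) a @ map (\<lambda>w. 2 * w + 1) a) (map (\<lambda>w. 2 * w) a @ map (\<lambda>w. 2 * w + 1) b)"
      by (simp add: tensor_def)
    have wE: "\<exists>u. (w = 2 * u \<and> u \<in> set a) \<or> w = 2 * u + 1" if "w \<in> wires ?E" for w
      using that unfolding E by (auto simp: wires_Diagram)
    \<comment> \<open>\<open>tensor\<close> tags wires as \<open>2 * w\<close> and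
      \<open>2 * w + 1\<close>. Dropping the tag by \<open>div 2\<close> identifies only the two
      wires that meet at the same cup.\<close>
    have "same_graph (compose ?D ?E) (Diagram (vertices (rename id ?D) + vertices (rename (\<lambda>w. w div 2) ?E))
      (map id (ins ?D)) (map (\<lambda>w. w div 2) (outs ?E)))"
    proof (rule same_graph_compose_right)
      show "map id (outs ?D) = map (\<lambda>w. w div 2) (ins ?E)" by (simp add: E comp_def)
      show "inj_on id (wires ?D)" by simp
      show "y \<in> set (ins ?E)" if "x \<in> wires ?D" "y \<in> wires ?E" "id x = y div 2" for x y
        using that wE[OF that(2)] by (auto simp: E wires_Diagram)
      show "x = y \<or> x \<in> set (ins ?E) \<and> y \<in> set (ins ?E)"
        if "x \<in> wires ?E" "y \<in> wires ?E" "x div 2 = y div 2" for x y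
        using wE[OF that(1)] wE[OF that(2)] that(3) by (auto simp: E)
    qed
    then show ?thesis
      by (simp add: E multiset.map_comp comp_def map_prod_def case_prod_unfold)
  qed
  have wf': "well_formed (Diagram V [] (a @ b))" "well_formed (Diagram V' [] (a @ b))"
    using wf by (simp_all add: well_formed_count add.assoc)
  have "transformable R (compose ?D (tensor ?I (Diagram V a b))) (compose ?D (tensor ?I (Diagram V' a b)))"
    by (intro transformable.in_composite transformable.in_tensor transformable_refl wD tr)
      (simp add: tensor_def)
  moreover have "transformable R (Diagram V [] (a @ b)) (compose ?D (tensor ?I (Diagram V a b)))"
    by (intro transformable.same_graph same_graph_sym[OF sg] wf wf')
  moreover have "transformable R (Diagram V' [] (a @ b)) (compose ?D (tensor ?I (Diagram V' a b)))"
    by (intro transformable.same_graph same_graph_sym[OF sg] wf wf')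
  ultimately show ?thesis
    by (meson transformable.reverse transformable.sequence)
qed

text \<open>The context becomes a diagram that takes the boundary \<open>h\<close> as additional
  inputs; the outer inputs \<open>I\<close> bypass the rewritten part on identity wires.\<close>

lemma transformable_in_context:
  assumes tr: "transformable R (Diagram V [] h) (Diagram V' [] h)"
    and wf: "well_formed (Diagram V [] h)" "well_formed (Diagram V' [] h)"
    and wF: "well_formed (Diagram (V + C) I O')" "well_formed (Diagram (V' + C) I O')"
    and d: "distinct h"
  shows "transformable R (Diagram (V + C) I O') (Diagram (V' + C) I O')"
proof -
  define m where "m = length I"
  let ?J = "Diagram {#} [0..<m] [0..<m]"
  let ?E = "Diagram C (h @ I) O'"
  have wJ: "well_formed ?J"
    by (auto simp: well_formed_count count_mset_set')
  \<comment> \<open>An inner wire of \<open>V\<close> has both ends there already, so its name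
    cannot be captured by the context.\<close>
  have key: "count (wire_ends (Diagram C I O')) w = 0"
    if wf: "well_formed (Diagram V [] h)" and wF: "well_formed (Diagram (V + C) I O')"
      and w: "w \<in> wires (Diagram V [] h)" "w \<notin> set h" for V w
  proof -
    have "count (wire_ends (Diagram V [] h)) w = 2" using wf w(1) by (simp add: well_formed_def)
    then have "count (\<Sum>\<^sub># (image_mset snd V)) w = 2" using w(2) by (simp add: count_mset)
    moreover have "count (wire_ends (Diagram (V + C) I O')) w \<le> 2"
      using wF unfolding well_formed_count by (metis le_refl zero_le)
    ultimately show ?thesis by simp
  qed
  have wE: "well_formed ?E" unfolding well_formed_count
  proof (intro conjI allI impI)
    fix w
    let ?v = "count (\<Sum>\<^sub># (image_mset snd V)) w" and ?c = "count (\<Sum>\<^sub># (image_mset snd C)) w"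
    have *: "c + (h + i) + j = 0 \<or> c + (h + i) + j = 2"
      if "h \<le> 1" "v + c + i + j = 0 \<or> v + c + i + j = 2" "v + h = 0 \<or> v + h = 2" for c h i j v :: nat
    proof -
      have "h = 0 \<or> h = 1" using that(1) by (cases h) auto
      then show ?thesis using that(2,3) by (elim disjE) simp_all
    qed
    have "count (mset h) w \<le> 1" using d by (simp add: distinct_count_atmost_1)
    moreover have "?v + ?c + count (mset I) w + count (mset O') w = 0 \<or> ?v + ?c + count (mset I) w + count (mset O') w = 2"
      using wF(1)[unfolded well_formed_count, THEN conjunct1, rule_format, of w] by simp
    moreover have "?v + count (mset h) w = 0 \<or> ?v + count (mset h) w = 2"
      using wf(1)[unfolded well_formed_count, THEN conjunct1, rule_format, of w] by simp
    ultimately have "?c + (count (mset h) w + count (mset I) w) + count (mset O') w = 0 \<or>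
      ?c + (count (mset h) w + count (mset I) w) + count (mset O') w = 2"
      by (rule *)
    then show "count (wire_ends ?E) w = 0 \<or> count (wire_ends ?E) w = 2"
      by (simp only: wire_ends_Diagram mset_append count_union)
  next
    fix legs assume "(Hadamard, legs) \<in># vertices ?E"
    then show "size legs = 2" using wF(1) by (auto simp: well_formed_count)
  qed
  have sg: "same_graph (compose (tensor (Diagram V [] h) ?J) ?E) (Diagram (V + C) I O')"
    if wf: "well_formed (Diagram V [] h)" and wF: "well_formed (Diagram (V + C) I O')" for V
  proof -
    let ?D = "tensor (Diagram V [] h) ?J"
    \<comment> \<open>Even tags are wires of \<open>V\<close>, odd tags are positions in
      \<open>I\<close>. An outer input may be plugged straight into \<open>V\<close>; then its name
      occurs in \<open>h\<close> too, and the two tags are glued by a cap of the context.\<close>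
    define p where "p w = (if even w then w div 2 else I ! (w div 2))" for w :: nat
    have p0: "p (2 * w) = w" and p1: "p (2 * w + 1) = I ! w" for w by (simp_all add: p_def)
    have pI: "map (\<lambda>w. p (Suc (2 * w))) [0..<m] = I"
      by (simp add: p1[simplified] m_def map_nth)
    have D: "?D = Diagram (image_mset (map_prod id (image_mset (\<lambda>w. 2 * w))) V)
      (map (\<lambda>w. 2 * w + 1) [0..<m]) (map (\<lambda>w. 2 * w) h @ map (\<lambda>w. 2 * w + 1) [0..<m])"
      by (simp add: tensor_def)
    have wD: "\<exists>u. (w = 2 * u \<and> u \<in> wires (Diagram V [] h)) \<or> (w = 2 * u + 1 \<and> u < m)" if "w \<in> wires ?D" for w
      using that unfolding D by (auto simp: wires_Diagram)
    have out: "2 * u \<in> set (outs ?D)"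
      if "u \<in> wires (Diagram V [] h)" "u \<in> wires ?E" for u
    proof -
      have "u \<in> set h"
      proof (rule ccontr)
        assume "u \<notin> set h"
        have "u \<notin> wires (Diagram C I O')"
          using key[OF wf wF that(1) \<open>u \<notin> set h\<close>] unfolding wires_def by (simp del: wire_ends_Diagram add: count_eq_zero_iff)
        then have "u \<notin> wires ?E" using \<open>u \<notin> set h\<close> by (simp add: wires_Diagram)
        then show False using that(2) by simp
      qed
      then show ?thesis by (simp add: D)
    qed
    have out1: "2 * u + 1 \<in> set (outs ?D)" if "u < m" for u
      using that by (simp add: D)
    have II: "u < m \<Longrightarrow> I ! u \<in> wires ?E" for u by (simp add: wires_Diagram m_def)
    have "same_graph (compose ?D ?E) (Diagram (vertices (rename p ?D) + vertices (rename id ?E))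
      (map p (ins ?D)) (map id (outs ?E)))"
    proof (rule same_graph_compose_left)
      show "map p (outs ?D) = map id (ins ?E)"
        by (simp add: D comp_def p0 pI)
      show "inj_on id (wires ?E)" by simp
      show "x \<in> set (outs ?D)" if xy: "x \<in> wires ?D" "y \<in> wires ?E" "p x = id y" for x y
      proof -
        obtain u where "(x = 2 * u \<and> u \<in> wires (Diagram V [] h)) \<or> (x = 2 * u + 1 \<and> u < m)"
          using wD[OF xy(1)] by blast
        then show ?thesis
        proof (elim disjE conjE)
          assume a: "x = 2 * u" "u \<in> wires (Diagram V [] h)"
          have "y = u" using xy(3) unfolding a p0 by simp
          then show ?thesis using out[OF a(2)] xy(2) unfolding a by blast
        next
          assume a: "x = 2 * u + 1" "u < m"
          show ?thesis unfolding a by (rule out1[OF a(2)])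
        qed
      qed
      show "x = y \<or> x \<in> set (outs ?D) \<and> y \<in> set (outs ?D)"
        if xy: "x \<in> wires ?D" "y \<in> wires ?D" "p x = p y" for x y
      proof -
        obtain u where "(x = 2 * u \<and> u \<in> wires (Diagram V [] h)) \<or> (x = 2 * u + 1 \<and> u < m)"
          using wD[OF xy(1)] by blast
        moreover obtain t where "(y = 2 * t \<and> t \<in> wires (Diagram V [] h)) \<or> (y = 2 * t + 1 \<and> t < m)"
          using wD[OF xy(2)] by blast
        ultimately show ?thesis
        proof (elim disjE conjE)
          assume a: "x = 2 * u" "y = 2 * t"
          show ?thesis using xy(3) unfolding a p0 by simp
        next
          assume a: "x = 2 * u" "u \<in> wires (Diagram V [] h)" "y = 2 * t + 1" "t < m"
          have "u = I ! t" using xy(3) unfolding a p0 p1 .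
          then show ?thesis using out[OF a(2)] out1[OF a(4)] II[OF a(4)] unfolding a by simp
        next
          assume a: "y = 2 * t" "t \<in> wires (Diagram V [] h)" "x = 2 * u + 1" "u < m"
          have "t = I ! u" using xy(3) unfolding a p0 p1 by simp
          then show ?thesis using out[OF a(2)] out1[OF a(4)] II[OF a(4)] unfolding a by simp
        next
          assume a: "x = 2 * u + 1" "u < m" "y = 2 * t + 1" "t < m"
          show ?thesis using out1[OF a(2)] out1[OF a(4)] unfolding a by blast
        qed
      qed
    qed
    then show ?thesis
      by (simp add: D multiset.map_comp comp_def map_prod_def case_prod_unfold p0 pI)
  qed
  have "transformable R (compose (tensor (Diagram V [] h) ?J) ?E) (compose (tensor (Diagram V' [] h) ?J) ?E)"
    by (intro transformable.in_composite transformable.in_tensor transformable_refl wE wJ tr)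
      (simp add: tensor_def m_def)
  moreover have "transformable R (Diagram (V + C) I O') (compose (tensor (Diagram V [] h) ?J) ?E)"
    by (intro transformable.same_graph same_graph_sym[OF sg] wf wF)
  moreover have "transformable R (Diagram (V' + C) I O') (compose (tensor (Diagram V' [] h) ?J) ?E)"
    by (intro transformable.same_graph same_graph_sym[OF sg] wf wF)
  ultimately show ?thesis
    by (meson transformable.reverse transformable.sequence)
qed

lemma transformable_rewrite:
  assumes "transformable R (Diagram V a b) (Diagram V' a b)"
    and "well_formed (Diagram V a b)" "well_formed (Diagram V' a b)"
    and "well_formed (Diagram (V + C) I O')" "well_formed (Diagram (V' + C) I O')"
    and "distinct (a @ b)"
  shows "transformable R (Diagram (V + C) I O') (Diagram (V' + C) I O')"
proof (rule transformable_in_context[where h = "a @ b"])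
  show "transformable R (Diagram V [] (a @ b)) (Diagram V' [] (a @ b))"
    using assms by (intro transformable_bend) auto
  show "well_formed (Diagram V [] (a @ b))" "well_formed (Diagram V' [] (a @ b))"
    using assms(2,3) by (simp_all add: well_formed_count add.assoc)
  show "distinct (a @ b)" by (rule assms(6))
qed (rule assms(4), rule assms(5))

text \<open>A closed well-formed part uses up both ends of each of its wires, so it shares no wire
  with the rest and the diagram is a tensor product.\<close>

lemma transformable_drop_scalar:
  assumes "well_formed (Diagram (V + C) I O')" "well_formed (Diagram V [] [])"
    and "denote (Diagram V [] []) [] [] \<noteq> 0"
  shows "well_formed (Diagram C I O')" "transformable R (Diagram (V + C) I O') (Diagram C I O')"
proof -
  have c: "count (\<Sum>\<^sub># (image_mset snd V)) w = 0 \<or> count (wire_ends (Diagram C I O')) w = 0 \<and> count (\<Sum>\<^sub># (image_mset snd V)) w = 2"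
    for w
  proof -
    have "count (wire_ends (Diagram (V + C) I O')) w = 0 \<or> count (wire_ends (Diagram (V + C) I O')) w = 2"
      using assms(1) unfolding well_formed_count by blast
    moreover have "count (wire_ends (Diagram V [] [])) w = 0 \<or> count (wire_ends (Diagram V [] [])) w = 2"
      using assms(2) unfolding well_formed_count by blast
    ultimately show ?thesis by auto
  qed
  show wC: "well_formed (Diagram C I O')" unfolding well_formed_count
  proof (intro conjI allI impI)
    fix w
    have "count (wire_ends (Diagram (V + C) I O')) w = 0 \<or> count (wire_ends (Diagram (V + C) I O')) w = 2"
      using assms(1) unfolding well_formed_count by blast
    then show "count (wire_ends (Diagram C I O')) w = 0 \<or> count (wire_ends (Diagram C I O')) w = 2"
      using c[of w] by auto
  next
    fix legs assume "(Hadamard, legs) \<in># vertices (Diagram C I O')"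
    then show "size legs = 2" using assms(1) by (auto simp: well_formed_count)
  qed
  have disj: "wires (Diagram C I O') \<inter> wires (Diagram V [] []) = {}"
  proof -
    have "\<not> (w \<in> wires (Diagram C I O') \<and> w \<in> wires (Diagram V [] []))" for w
    proof -
      have "count (wire_ends (Diagram C I O')) w = 0 \<or> count (wire_ends (Diagram V [] [])) w = 0"
        using c[of w] by auto
      then show ?thesis unfolding wires_def by (simp del: wire_ends_Diagram add: count_eq_zero_iff)
    qed
    then show ?thesis by blast
  qed
  have "same_graph (tensor (Diagram C I O') (Diagram V [] [])) (Diagram (V + C) I O')"
    using same_graph_tensor[of id "Diagram C I O'" id "Diagram V [] []"] disj
    by (simp add: map_prod.id multiset.map_id add.commute rename_id[unfolded rename_def])
  then have "transformable R (Diagram (V + C) I O') (tensor (Diagram C I O') (Diagram V [] []))"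
    by (rule transformable.same_graph[OF assms(1) same_graph_sym])
  moreover have "transformable R (Diagram C I O') (tensor (Diagram C I O') (Diagram V [] []))"
    by (rule transformable.scalar) (use assms wC in auto)
  ultimately show "transformable R (Diagram (V + C) I O') (Diagram C I O')"
    by (meson transformable.reverse transformable.sequence)
qed

section \<open>Fusion, strong complementarity and the Hopf law\<close>

text \<open>Well-formedness of both sides is carried along because renaming and rewriting in a
  context are available only for well-formed diagrams.\<close>

definition zx_eq :: "diagram \<Rightarrow> diagram \<Rightarrow> bool" (infix \<open>\<approx>\<close> 50)
  where "D \<approx> E \<longleftrightarrow> well_formed D \<and> well_formed E \<and> transformable (sup clifford_rule S4_rule) D E"

lemma zx_eq_wf: "D \<approx> E \<Longrightarrow> well_formed D" "D \<approx> E \<Longrightarrow> well_formed E"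
  by (simp_all add: zx_eq_def)

lemma zx_eq_refl: "well_formed D \<Longrightarrow> D \<approx> D"
  by (simp add: zx_eq_def transformable_refl)

lemma zx_eq_sym: "D \<approx> E \<Longrightarrow> E \<approx> D"
  by (auto simp: zx_eq_def intro: transformable.reverse)

lemma zx_eq_trans [trans]: "D \<approx> E \<Longrightarrow> E \<approx> F \<Longrightarrow> D \<approx> F"
  by (auto simp: zx_eq_def intro: transformable.sequence)

lemma zx_eq_rename: "well_formed D \<Longrightarrow> inj_on f (wires D) \<Longrightarrow> D \<approx> rename f D"
  by (simp add: zx_eq_def well_formed_rename transformable_rename)

lemma zx_eq_rename_both:
  "D \<approx> E \<Longrightarrow> inj_on f (wires D) \<Longrightarrow> inj_on f (wires E) \<Longrightarrow> rename f D \<approx> rename f E"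
  by (meson zx_eq_def zx_eq_rename zx_eq_sym zx_eq_trans)

lemma clifford_zx_eq: "clifford_rule D E \<Longrightarrow> well_formed D \<Longrightarrow> well_formed E \<Longrightarrow> D \<approx> E"
  by (auto simp: zx_eq_def intro!: transformable.apply_rule)

lemma zx_eq_context:
  assumes "Diagram V a b \<approx> Diagram V' a b" "distinct (a @ b)"
    and "well_formed (Diagram (V + C) I O')" "well_formed (Diagram (V' + C) I O')"
  shows "Diagram (V + C) I O' \<approx> Diagram (V' + C) I O'"
  unfolding zx_eq_def
proof (intro conjI)
  show "transformable (sup clifford_rule S4_rule) (Diagram (V + C) I O') (Diagram (V' + C) I O')"
    by (rule transformable_rewrite) (use assms in \<open>simp_all add: zx_eq_def\<close>)
qed (use assms in simp_all)

section \<open>Preservation of well-formedness\<close>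

lemma well_formed_double:
  assumes "wire_ends D = M + M" "\<And>w. count M w \<le> 1"
    and "\<And>legs. (Hadamard, legs) \<notin># vertices D"
  shows "well_formed D"
  unfolding well_formed_count
proof (intro conjI allI impI)
  fix w
  have "count M w = 0 \<or> count M w = 1" using assms(2)[of w] by (cases "count M w") auto
  then show "count (wire_ends D) w = 0 \<or> count (wire_ends D) w = 2"
    unfolding assms(1) by auto
qed (use assms(3) in auto)

text \<open>\<open>E\<close> collects the inner wires deleted by a rewriting step; each of them
  loses both of its ends.\<close>

lemma well_formed_remove:
  assumes "well_formed (Diagram V I O')"
    and "\<Sum>\<^sub># (image_mset snd V) = \<Sum>\<^sub># (image_mset snd V') + E + E"
    and "\<And>legs. (Hadamard, legs) \<in># V' \<Longrightarrow> (Hadamard, legs) \<in># V"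
  shows "well_formed (Diagram V' I O')"
  unfolding well_formed_count
proof (intro conjI allI impI)
  fix w
  let ?c = "count (\<Sum>\<^sub># (image_mset snd V')) w + count (mset I) w + count (mset O') w"
  have "?c + 2 * count E w = 0 \<or> ?c + 2 * count E w = 2"
    using assms(1)[unfolded well_formed_count, THEN conjunct1, rule_format, of w]
    by (auto simp: assms(2) mult_2)
  then show "count (wire_ends (Diagram V' I O')) w = 0 \<or> count (wire_ends (Diagram V' I O')) w = 2"
    by (cases "count E w") auto
next
  fix legs assume "(Hadamard, legs) \<in># vertices (Diagram V' I O')"
  then show "size legs = 2" using assms(1,3) by (auto simp: well_formed_def)
qed

text \<open>The converse situation, where the new inner wires \<open>E\<close> have to be fresh and
  pairwise distinct.\<close>

lemma well_formed_insert:
  assumes "well_formed (Diagram V I O')"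
    and "\<And>w. w \<in># E \<Longrightarrow> w \<notin> wires (Diagram V I O')" "\<And>w. count E w \<le> 1"
    and "\<Sum>\<^sub># (image_mset snd V') = \<Sum>\<^sub># (image_mset snd V) + E + E"
    and "\<And>legs. (Hadamard, legs) \<in># V' \<Longrightarrow> (Hadamard, legs) \<in># V"
  shows "well_formed (Diagram V' I O')"
  unfolding well_formed_count
proof (intro conjI allI impI)
  fix u
  have c: "count (wire_ends (Diagram V' I O')) u = count (wire_ends (Diagram V I O')) u + (count E u + count E u)"
    by (simp add: assms(4))
  have "count (wire_ends (Diagram V I O')) u = 0 \<or> count (wire_ends (Diagram V I O')) u = 2"
    using assms(1) unfolding well_formed_count by blast
  moreover have "count (wire_ends (Diagram V I O')) u = 0" if "count E u \<noteq> 0"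
    using assms(2)[of u] that unfolding wires_def by (simp del: wire_ends_Diagram add: count_eq_zero_iff)
  moreover have "count E u = 0 \<or> count E u = 1" using assms(3)[of u] by (cases "count E u") auto
  ultimately show "count (wire_ends (Diagram V' I O')) u = 0 \<or> count (wire_ends (Diagram V' I O')) u = 2"
    unfolding c by (elim disjE) (simp_all del: wire_ends_Diagram)
next
  fix legs assume "(Hadamard, legs) \<in># vertices (Diagram V' I O')"
  then show "size legs = 2" using assms(1,5) by (auto simp: well_formed_def)
qed

lemma distinct_count: "distinct xs \<longleftrightarrow> (\<forall>w. count (mset xs) w \<le> 1)"
proof -
  have "m \<le> 1 \<longleftrightarrow> m = (if P then 1 else 0)" if "m = 0 \<longleftrightarrow> \<not> P" for m :: nat and P
    using that by (cases m) auto
  note * = this[OF count_mset_0_iff]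
  show ?thesis unfolding distinct_count_atmost_1
    by (intro arg_cong[where f = All] ext) (rule *[symmetric])
qed

lemma zx_eq_fusion:
  assumes wf: "well_formed (Diagram (add_mset (Spider c \<alpha>, A + E) (add_mset (Spider c \<beta>, B + E) C)) I O')"
    and d: "\<And>w. count (A + B + E) w \<le> 1" and E: "E \<noteq> {#}"
  shows "Diagram (add_mset (Spider c \<alpha>, A + E) (add_mset (Spider c \<beta>, B + E) C)) I O' \<approx>
    Diagram (add_mset (Spider c (\<alpha> + \<beta>), A + B) C) I O'"
proof -
  obtain a b e where l: "A = mset a" "B = mset b" "E = mset e" by (metis ex_mset)
  have di: "distinct (a @ b @ e)" unfolding distinct_count using d by (simp add: l add.assoc)
  have "Diagram {#(Spider c \<alpha>, A + E), (Spider c \<beta>, B + E)#} (a @ b) [] \<approx>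
    Diagram {#(Spider c (\<alpha> + \<beta>), A + B)#} (a @ b) []"
  proof (rule clifford_zx_eq)
    show "clifford_rule (Diagram {#(Spider c \<alpha>, A + E), (Spider c \<beta>, B + E)#} (a @ b) [])
      (Diagram {#(Spider c (\<alpha> + \<beta>), A + B)#} (a @ b) [])"
      using clifford_rule.spider_fusion[of a b "[]" "[]" e c \<alpha> \<beta>] di E by (simp add: l)
    show "well_formed (Diagram {#(Spider c \<alpha>, A + E), (Spider c \<beta>, B + E)#} (a @ b) [])"
      by (rule well_formed_double[of _ "A + B + E"]) (use d in \<open>auto simp: l\<close>)
    have "count (A + B) w \<le> 1" for w using d[of w] by simp
    then show "well_formed (Diagram {#(Spider c (\<alpha> + \<beta>), A + B)#} (a @ b) [])"
      by (intro well_formed_double[of _ "A + B"]) (auto simp: l)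
  qed
  moreover have "well_formed (Diagram (add_mset (Spider c (\<alpha> + \<beta>), A + B) C) I O')"
    by (rule well_formed_remove[OF wf, of _ E]) auto
  moreover have "distinct (a @ b @ [])" using di by auto
  ultimately show ?thesis
    using zx_eq_context[of "{#(Spider c \<alpha>, A + E), (Spider c \<beta>, B + E)#}" "a @ b" "[]"
        "{#(Spider c (\<alpha> + \<beta>), A + B)#}" C I O'] wf di by simp
qed

text \<open>Both spiders equal the same plain wire. The detour through that wire is made before
  embedding, since the wire does not have the boundary \<open>[a]\<close>, \<open>[b]\<close> and
  cannot be put into the context under these names.\<close>

lemma zx_eq_swap_identity:
  assumes wf: "well_formed (Diagram (add_mset (Spider c 0, {#a, b#}) C) I O')" and ab: "a \<noteq> b"
  shows "Diagram (add_mset (Spider c 0, {#a, b#}) C) I O' \<approx>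
    Diagram (add_mset (Spider (opp c) 0, {#a, b#}) C) I O'"
proof -
  have w: "well_formed (Diagram {#(Spider c 0, {#a, b#})#} [a] [b])" for c
    by (rule well_formed_double[of _ "{#a, b#}"]) (use ab in auto)
  have i: "well_formed (Diagram {#} [a] [a])"
    by (rule well_formed_double[of _ "{#a#}"]) auto
  have "Diagram {#(Spider c 0, {#a, b#})#} [a] [b] \<approx> Diagram {#(Spider (opp c) 0, {#a, b#})#} [a] [b]"
    by (meson zx_eq_sym zx_eq_trans clifford_zx_eq clifford_rule.identity ab w i)
  moreover have "well_formed (Diagram (add_mset (Spider (opp c) 0, {#a, b#}) C) I O')"
    by (rule well_formed_remove[OF wf, of _ "{#}"]) auto
  ultimately show ?thesis
    using zx_eq_context[of "{#(Spider c 0, {#a, b#})#}" "[a]" "[b]"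
        "{#(Spider (opp c) 0, {#a, b#})#}" C I O'] wf ab by simp
qed

lemma sum_ends_map:
  "\<Sum>\<^sub># (image_mset snd (mset (map (\<lambda>i. (L i, mset (x i # f i))) is))) =
    mset (map x is) + mset (concat (map f is))"
  by (induction "is") auto

lemma mset_concat_swap:
  "mset (concat (map (\<lambda>j. map (\<lambda>i. w i j) is) js)) = mset (concat (map (\<lambda>i. map (\<lambda>j. w i j) js) is))"
proof (induction "is")
  case Nil
  then show ?case by (induction js) auto
next
  case (Cons i "is")
  have "mset (concat (map (\<lambda>j. w i j # map (\<lambda>i. w i j) is) js)) =
    mset (map (w i) js) + mset (concat (map (\<lambda>j. map (\<lambda>i. w i j) is) js))"
    by (induction js) auto
  then show ?case using Cons by simp
qed

lemma zx_eq_strong_complementarity: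
  fixes a b :: "nat list" and w :: "nat \<Rightarrow> nat \<Rightarrow> nat" and c :: colour
  defines "R \<equiv> mset (map (\<lambda>i. (Spider c 0, mset (a ! i # map (\<lambda>j. w i j) [0..<length b]))) [0..<length a]) +
    mset (map (\<lambda>j. (Spider (opp c) 0, mset (b ! j # map (\<lambda>i. w i j) [0..<length a]))) [0..<length b])"
  assumes wf: "well_formed (Diagram (add_mset (Spider (opp c) 0, mset (e # a)) (add_mset (Spider c 0, mset (e # b)) C)) I O')"
    and wf': "well_formed (Diagram (R + C) I O')"
    and d: "distinct (e # a @ b)"
    and d': "distinct (a @ b @ concat (map (\<lambda>i. map (\<lambda>j. w i j) [0..<length b]) [0..<length a]))"
  shows "Diagram (add_mset (Spider (opp c) 0, mset (e # a)) (add_mset (Spider c 0, mset (e # b)) C)) I O' \<approx>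
    Diagram (R + C) I O'"
proof -
  let ?L = "{#(Spider (opp c) 0, mset (e # a)), (Spider c 0, mset (e # b))#}"
  have "Diagram ?L a b \<approx> Diagram R a b"
  proof (rule clifford_zx_eq)
    show "clifford_rule (Diagram ?L a b) (Diagram R a b)"
      unfolding R_def by (rule clifford_rule.strong_complementarity[OF d d'])
    show "well_formed (Diagram ?L a b)"
      by (rule well_formed_double[of _ "mset (e # a @ b)"])
        (use d[unfolded distinct_count] in auto)
    have "\<Sum>\<^sub># (image_mset snd R) = mset a + mset b + mset (concat (map (\<lambda>i. map (\<lambda>j. w i j) [0..<length b]) [0..<length a])) +
      mset (concat (map (\<lambda>i. map (\<lambda>j. w i j) [0..<length b]) [0..<length a]))"
      unfolding R_def image_mset_union sum_mset.union sum_ends_map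
      unfolding mset_concat_swap[of w "[0..<length a]" "[0..<length b]"]
      by (simp add: map_nth ac_simps)
    then show "well_formed (Diagram R a b)"
      using d'[unfolded distinct_count]
      by (intro well_formed_double[of _ "mset (a @ b @ concat (map (\<lambda>i. map (\<lambda>j. w i j) [0..<length b]) [0..<length a]))"])
        (auto simp: R_def ac_simps)
  qed
  then show ?thesis
    using zx_eq_context[of ?L a b R C I O'] wf wf' d by simp
qed

lemma UNIV_bit: "(UNIV :: bit set) = {0, 1}"
  by (metis (full_types) UNIV_eq_I bit_not_zero_iff insertCI)

text \<open>The one-legged X-spider is sqrt 2 times the basis state 0, on which a one-legged
  Z-spider has value 1 whatever its phase. So the scalar is sqrt 2.\<close>

lemma zx_eq_drop_scalar:
  assumes wf: "well_formed (Diagram (add_mset (Spider X 0, {#e#}) (add_mset (Spider Z \<alpha>, {#e#}) C)) I O')"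
  shows "Diagram (add_mset (Spider X 0, {#e#}) (add_mset (Spider Z \<alpha>, {#e#}) C)) I O' \<approx> Diagram C I O'"
proof -
  let ?V = "{#(Spider X 0, {#e#}), (Spider Z \<alpha>, {#e#})#}"
  let ?s = "\<lambda>b. \<lambda>w\<in>{e}. b"
  have w: "well_formed (Diagram ?V [] [])"
    by (rule well_formed_double[of _ "{#e#}"]) auto
  have "{e} \<rightarrow>\<^sub>E (UNIV :: bit set) = ?s ` UNIV"
    unfolding PiE_over_singleton_iff by blast
  moreover have "inj_on ?s (UNIV :: bit set)"
    by (rule inj_onI) (metis restrict_apply' singletonI)
  ultimately have "denote (Diagram ?V [] []) [] [] =
    (\<Sum>b\<in>UNIV. \<Prod>(a, legs)\<in>#?V. label_tensor a (image_mset (?s b) legs))"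
    by (simp add: denote_def wires_Diagram sum.reindex)
  also have "\<dots> = 2 / sqrt 2"
    unfolding UNIV_bit by (simp add: zero_phase_def expi.abs_eq flip: of_real_add)
  finally have "denote (Diagram ?V [] []) [] [] \<noteq> 0" by simp
  from transformable_drop_scalar[OF _ w this, of C I O'] wf show ?thesis
    by (simp add: zx_eq_def)
qed

text \<open>One of the two wires is replaced by \<open>Z(0) \<circ> X(0)\<close> using that both 2-legged spiders are identities;
  read the other way round, this turns the antipode of the bialgebra into the identity, and strong
  complementarity applies backwards.\<close>

lemma hopf_core:
  "Diagram {#(Spider Z 0, {#0, 2, 3#}), (Spider X 0, {#1, 2, 3#})#} [] [0, 1] \<approx>
   Diagram {#(Spider Z 0, {#0#}), (Spider X 0, {#1#})#} [] [0, 1]"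
proof -
  let ?D = "\<lambda>V. Diagram V [] [0, 1]"
  define V1 :: "vertex multiset" where "V1 = {#(Spider Z 0, {#0, 2, 4#}), (Spider Z 0, {#3, 4#}), (Spider X 0, {#1, 2, 5#}), (Spider X 0, {#3, 5#})#}"
  define V2 :: "vertex multiset" where "V2 = {#(Spider Z 0, {#0, 2, 4#}), (Spider X 0, {#3, 4#}), (Spider X 0, {#1, 2, 5#}), (Spider Z 0, {#3, 5#})#}"
  \<comment> \<open>The unit legs 6 and 7 give each of the two Z- and two X-spiders exactly one
    outer leg: 0 and 7, respectively 1 and 6. The remaining wires form a complete bipartite graph,
    the right-hand side of strong complementarity.\<close>
  define V3 :: "vertex multiset" where "V3 = {#(Spider Z 0, {#0, 2, 4#}), (Spider X 0, {#3, 4, 6#}), (Spider X 0, {#6#}), (Spider X 0, {#1, 2, 5#}),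
      (Spider Z 0, {#3, 5, 7#}), (Spider Z 0, {#7#})#}"
  define V4 :: "vertex multiset" where "V4 = {#(Spider X 0, {#8, 0, 7#}), (Spider Z 0, {#8, 1, 6#}), (Spider X 0, {#6#}), (Spider Z 0, {#7#})#}"
  define V5 :: "vertex multiset" where "V5 = {#(Spider Z 0, {#8#}), (Spider Z 0, {#0#}), (Spider Z 0, {#8, 1, 6#}), (Spider X 0, {#6#})#}"
  define V6 :: "vertex multiset" where "V6 = {#(Spider X 0, {#8#}), (Spider Z 0, {#8#}), (Spider Z 0, {#0#}), (Spider X 0, {#1#})#}"
  note V = V1_def V2_def V3_def V4_def V5_def V6_def
  have w1: "well_formed (?D V1)"
    by (rule well_formed_double[of _ "{#0,1,2,3,4,5#}"]) (auto simp: V)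
  have w2: "well_formed (?D V2)"
    by (rule well_formed_double[of _ "{#0,1,2,3,4,5#}"]) (auto simp: V)
  have w3: "well_formed (?D V3)"
    by (rule well_formed_double[of _ "{#0,1,2,3,4,5,6,7#}"]) (auto simp: V)
  have w4: "well_formed (?D V4)"
    by (rule well_formed_double[of _ "{#0,1,6,7,8#}"]) (auto simp: V)
  have w5: "well_formed (?D V5)"
    by (rule well_formed_double[of _ "{#0,1,6,8#}"]) (auto simp: V)
  have w6: "well_formed (?D V6)"
    by (rule well_formed_double[of _ "{#0,1,8#}"]) (auto simp: V)
  have "?D V1 \<approx> ?D {#(Spider Z 0, {#0, 2, 3#}), (Spider X 0, {#1, 2, 5#}), (Spider X 0, {#3, 5#})#}"
    using zx_eq_fusion[of Z 0 "{#0,2#}" "{#4#}" 0 "{#3#}" "{#(Spider X 0, {#1, 2, 5#}), (Spider X 0, {#3, 5#})#}" "[]" "[0,1]"]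
      w1 by (simp add: V add_mset_commute)
  also have "\<dots> \<approx> ?D {#(Spider Z 0, {#0, 2, 3#}), (Spider X 0, {#1, 2, 3#})#}"
    using zx_eq_fusion[of X 0 "{#1,2#}" "{#5#}" 0 "{#3#}" "{#(Spider Z 0, {#0, 2, 3#})#}" "[]" "[0,1]"]
      calculation by (simp add: V zx_eq_def add_mset_commute)
  finally have e0: "?D {#(Spider Z 0, {#0, 2, 3#}), (Spider X 0, {#1, 2, 3#})#} \<approx> ?D V1"
    by (rule zx_eq_sym)
  have "?D V1 \<approx> ?D {#(Spider Z 0, {#0, 2, 4#}), (Spider X 0, {#3, 4#}), (Spider X 0, {#1, 2, 5#}), (Spider X 0, {#3, 5#})#}"
    using zx_eq_swap_identity[of Z 3 4 "V1 - {#(Spider Z 0, {#3, 4#})#}" "[]" "[0,1]"]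
      w1 by (simp add: V add_mset_commute)
  also have "\<dots> \<approx> ?D V2"
    using zx_eq_swap_identity[of X 3 5 "V2 - {#(Spider Z 0, {#3, 5#})#}" "[]" "[0,1]"]
      calculation by (simp add: V zx_eq_def add_mset_commute)
  finally have e1: "?D V1 \<approx> ?D V2" .
  have "?D V3 \<approx> ?D {#(Spider Z 0, {#0, 2, 4#}), (Spider X 0, {#3, 4#}), (Spider X 0, {#1, 2, 5#}),
      (Spider Z 0, {#3, 5, 7#}), (Spider Z 0, {#7#})#}"
    using zx_eq_fusion[of X 0 "{#3,4#}" "{#6#}" 0 "{#}" "{#(Spider Z 0, {#0, 2, 4#}), (Spider X 0, {#1, 2, 5#}),
      (Spider Z 0, {#3, 5, 7#}), (Spider Z 0, {#7#})#}" "[]" "[0,1]"]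
      w3 by (simp add: V add_mset_commute)
  also have "\<dots> \<approx> ?D V2"
    using zx_eq_fusion[of Z 0 "{#3,5#}" "{#7#}" 0 "{#}" "{#(Spider Z 0, {#0, 2, 4#}), (Spider X 0, {#3, 4#}),
      (Spider X 0, {#1, 2, 5#})#}" "[]" "[0,1]"]
      calculation by (simp add: V zx_eq_def add_mset_commute)
  finally have e2: "?D V2 \<approx> ?D V3" by (rule zx_eq_sym)
  \<comment> \<open>\<open>f i j\<close> is the edge between the Z-spider at leg 0 or 7 and the
    X-spider at leg 1 or 6.\<close>
  define f :: "nat \<Rightarrow> nat \<Rightarrow> nat" where "f i j = (if i = 0 then if j = 0 then 2 else 4 else if j = 0 then 5 else 3)" for i j
  have "?D V4 \<approx> ?D V3"
    using zx_eq_strong_complementarity[of Z 8 "[0,7]" "[1,6]" "{#(Spider X 0, {#6#}), (Spider Z 0, {#7#})#}" "[]" "[0,1]" f]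
      w3 w4 by (simp add: V f_def upt_rec numeral_2_eq_2 add_mset_commute)
  then have e3: "?D V3 \<approx> ?D V4" by (rule zx_eq_sym)
  \<comment> \<open>Strong complementarity with an empty side copies a unit: the Z-unit on wire 7
    passes through the X-spider here, and the X-unit on wire 6 through the Z-spider in
    \<open>e5\<close>. What remains on wire 8 is a scalar.\<close>
  have e4: "?D V4 \<approx> ?D V5"
    using zx_eq_strong_complementarity[of Z 7 "[8,0]" "[]" "{#(Spider Z 0, {#8, 1, 6#}), (Spider X 0, {#6#})#}" "[]" "[0,1]" f]
      w4 w5 by (simp add: V f_def upt_rec add_mset_commute)
  have e5: "?D V5 \<approx> ?D V6"
    using zx_eq_strong_complementarity[of X 6 "[8,1]" "[]" "{#(Spider Z 0, {#8#}), (Spider Z 0, {#0#})#}" "[]" "[0,1]" f]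
      w5 w6 by (simp add: V f_def upt_rec add_mset_commute)
  have e6: "?D V6 \<approx> ?D {#(Spider Z 0, {#0#}), (Spider X 0, {#1#})#}"
    using zx_eq_drop_scalar[of 8 0 "{#(Spider Z 0, {#0#}), (Spider X 0, {#1#})#}" "[]" "[0,1]"]
      w6 by (simp add: V)
  show ?thesis
    by (rule e0[THEN zx_eq_trans, OF e1[THEN zx_eq_trans, OF e2[THEN zx_eq_trans, OF e3[THEN zx_eq_trans, OF
      e4[THEN zx_eq_trans, OF e5[THEN zx_eq_trans, OF e6]]]]]])
qed

text \<open>The legs \<open>u\<close>, \<open>t\<close> are split off both spiders along fresh wires
  \<open>z\<close> and \<open>x\<close>, so that the phase-free core applies, and the units it
  leaves are fused back. The phases stay on the outer spiders throughout.\<close>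

lemma zx_eq_hopf:
  assumes wf: "well_formed (Diagram (add_mset (Spider Z \<alpha>, add_mset u (add_mset t A))
      (add_mset (Spider X \<beta>, add_mset u (add_mset t B)) C)) I O')"
    and A: "\<And>w. count A w \<le> 1" and B: "\<And>w. count B w \<le> 1" and ut: "u \<noteq> t"
  shows "Diagram (add_mset (Spider Z \<alpha>, add_mset u (add_mset t A))
      (add_mset (Spider X \<beta>, add_mset u (add_mset t B)) C)) I O' \<approx>
    Diagram (add_mset (Spider Z \<alpha>, A) (add_mset (Spider X \<beta>, B) C)) I O'"
proof -
  let ?D = "\<lambda>V. Diagram V I O'"
  let ?F = "add_mset (Spider Z \<alpha>, add_mset u (add_mset t A)) (add_mset (Spider X \<beta>, add_mset u (add_mset t B)) C)"
  let ?E = "wire_ends (?D ?F)"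
  \<comment> \<open>Both ends of \<open>u\<close> and \<open>t\<close> are already used by the
    displayed legs.\<close>
  have ut': "u \<notin># A" "t \<notin># A" "u \<notin># B" "t \<notin># B"
  proof -
    have c: "count ?E w \<le> 2" for w using wf unfolding well_formed_count by (metis le_refl zero_le)
    have "count A u = 0 \<and> count B u = 0" using c[of u] ut by simp
    moreover have "count A t = 0 \<and> count B t = 0" using c[of t] ut by simp
    ultimately show "u \<notin># A" "t \<notin># A" "u \<notin># B" "t \<notin># B" by (simp_all add: count_eq_zero_iff)
  qed
  have "finite (wires (?D ?F))" by (simp add: wires_def)
  then obtain z where z: "z \<notin> wires (?D ?F)" by (metis ex_new_if_finite infinite_UNIV_nat)
  have "finite (insert z (wires (?D ?F)))" by (simp add: wires_def)
  then obtain x where x: "x \<notin> insert z (wires (?D ?F))" by (metis ex_new_if_finite infinite_UNIV_nat)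
  have zx: "z \<notin># A" "z \<noteq> u" "z \<noteq> t" "x \<notin># B" "x \<noteq> u" "x \<noteq> t" "x \<noteq> z"
    using z x by (auto simp: wires_Diagram)
  define F1 where "F1 = add_mset (Spider Z \<alpha>, add_mset z A) (add_mset (Spider Z 0, {#z, u, t#})
      (add_mset (Spider X \<beta>, add_mset u (add_mset t B)) C))"
  define F2 where "F2 = add_mset (Spider X \<beta>, add_mset x B) (add_mset (Spider X 0, {#x, u, t#})
      (add_mset (Spider Z \<alpha>, add_mset z A) (add_mset (Spider Z 0, {#z, u, t#}) C)))"
  define F3 where "F3 = add_mset (Spider X \<beta>, add_mset x B) (add_mset (Spider X 0, {#x#})
      (add_mset (Spider Z \<alpha>, add_mset z A) (add_mset (Spider Z 0, {#z#}) C)))"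
  have w1: "well_formed (?D F1)"
    by (rule well_formed_insert[OF wf, of "{#z#}"]) (use z in \<open>auto simp: F1_def\<close>)
  have xF1: "x \<notin> wires (?D F1)"
    using x by (auto simp: F1_def wires_Diagram)
  have w2: "well_formed (?D F2)"
    by (rule well_formed_insert[OF w1, of "{#x#}"]) (use xF1 in \<open>auto simp: F1_def F2_def\<close>)
  have w3: "well_formed (?D F3)"
    by (rule well_formed_remove[OF w2, of _ "{#u, t#}"]) (auto simp: F2_def F3_def)
  have c: "count A w \<le> Suc 0" "count B w \<le> Suc 0" for w using A B by simp_all
  have z1: "count A z = 0" "count B x = 0" "count A u = 0" "count A t = 0" "count B u = 0" "count B t = 0"
    using zx ut' by (simp_all add: count_eq_zero_iff)
  have cA: "count (A + {#u, t#} + {#z#}) w \<le> 1" "count (A + {#} + {#z#}) w \<le> 1"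
    and cB: "count (B + {#u, t#} + {#x#}) w \<le> 1" "count (B + {#} + {#x#}) w \<le> 1" for w
    using c[of w] z1 zx ut by auto
  have e1: "?D F1 \<approx> ?D ?F"
    using zx_eq_fusion[of Z \<alpha> A "{#z#}" 0 "{#u, t#}" "add_mset (Spider X \<beta>, add_mset u (add_mset t B)) C" I O', OF _ cA(1)] w1
    by (simp add: F1_def add_mset_commute)
  have e2: "?D F2 \<approx> ?D F1"
    using zx_eq_fusion[of X \<beta> B "{#x#}" 0 "{#u, t#}" "add_mset (Spider Z \<alpha>, add_mset z A)
      (add_mset (Spider Z 0, {#z, u, t#}) C)" I O', OF _ cB(1)] w2
    by (simp add: F1_def F2_def add_mset_commute)
  define f where "f = id(0 := z, 1 := x, 2 := u, 3 := t)"
  have "rename f (Diagram {#(Spider Z 0, {#0, 2, 3#}), (Spider X 0, {#1, 2, 3#})#} [] [0, 1]) \<approx>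
    rename f (Diagram {#(Spider Z 0, {#0#}), (Spider X 0, {#1#})#} [] [0, 1])"
    by (rule zx_eq_rename_both[OF hopf_core])
      (use zx ut in \<open>auto simp: f_def wires_Diagram\<close>)
  then have "Diagram {#(Spider Z 0, {#z, u, t#}), (Spider X 0, {#x, u, t#})#} [] [z, x] \<approx>
    Diagram {#(Spider Z 0, {#z#}), (Spider X 0, {#x#})#} [] [z, x]"
    by (simp add: f_def)
  from zx_eq_context[OF this, of "add_mset (Spider X \<beta>, add_mset x B) (add_mset (Spider Z \<alpha>, add_mset z A) C)" I O']
  have e3: "?D F2 \<approx> ?D F3"
    using w2 w3 zx by (simp add: F2_def F3_def add_mset_commute)
  have e4: "?D F3 \<approx> ?D (add_mset (Spider X \<beta>, B) (add_mset (Spider Z \<alpha>, add_mset z A) (add_mset (Spider Z 0, {#z#}) C)))"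
    using zx_eq_fusion[of X \<beta> B "{#x#}" 0 "{#}" "add_mset (Spider Z \<alpha>, add_mset z A)
      (add_mset (Spider Z 0, {#z#}) C)" I O', OF _ cB(2)] w3
    by (simp add: F3_def add_mset_commute)
  also have "\<dots> \<approx> ?D (add_mset (Spider Z \<alpha>, A) (add_mset (Spider X \<beta>, B) C))"
    using zx_eq_fusion[of Z \<alpha> A "{#z#}" 0 "{#}" "add_mset (Spider X \<beta>, B) C" I O', OF _ cA(2)] calculation
    by (simp add: zx_eq_def add_mset_commute)
  finally show ?thesis
    by (rule zx_eq_trans[OF zx_eq_sym[OF e1] zx_eq_trans[OF zx_eq_sym[OF e2] zx_eq_trans[OF e3]]])
qed

section \<open>Phase gadgets on a register of qubits\<close>

text \<open>The context varies in the hypothesis because members of the family that are already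
  rewritten, or still waiting, belong to the context of the current one.\<close>

lemma zx_eq_sum:
  assumes "finite S"
    and "\<And>i C. i \<in> S \<Longrightarrow> well_formed (Diagram (F i + C) I O') \<Longrightarrow> Diagram (F i + C) I O' \<approx> Diagram (G i + C) I O'"
    and "well_formed (Diagram (sum F S + C) I O')"
  shows "Diagram (sum F S + C) I O' \<approx> Diagram (sum G S + C) I O'"
  using assms
proof (induction S arbitrary: C rule: finite_induct)
  case empty
  then show ?case by (simp add: zx_eq_refl)
next
  case (insert i S)
  have "Diagram (F i + (sum F S + C)) I O' \<approx> Diagram (G i + (sum F S + C)) I O'"
    using insert.prems insert.hyps by (intro insert.prems(1)) (simp_all add: ac_simps)
  then have 1: "Diagram (sum F (insert i S) + C) I O' \<approx> Diagram (sum F S + (G i + C)) I O'"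
    using insert.hyps by (simp add: ac_simps)
  have "Diagram (sum F S + (G i + C)) I O' \<approx> Diagram (sum G S + (G i + C)) I O'"
    using 1 insert.prems(1) by (intro insert.IH) (auto simp: zx_eq_def)
  then show ?case using zx_eq_trans[OF 1] insert.hyps by (simp add: ac_simps)
qed

text \<open>Symbolic names make freshness a matter of distinct constructors. \<open>Edge i e\<close>
  joins the spider of qubit \<open>i\<close> to the spider computing parity \<open>e\<close>, and
  \<open>Ext e\<close> carries that parity onwards; countability injects all of them into the
  natural numbers.\<close>

datatype wire = In nat | Out nat | Edge nat nat | Ext nat

instance wire :: countable
  by countable_datatype

abbreviation wn :: "wire \<Rightarrow> nat"
  where "wn \<equiv> to_nat"

definition edges :: "nat \<Rightarrow> nat set \<Rightarrow> nat multiset"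
  where "edges i T = image_mset (\<lambda>e. wn (Edge i e)) (mset_set T)"

definition redges :: "nat \<Rightarrow> nat set \<Rightarrow> nat multiset"
  where "redges e T = image_mset (\<lambda>i. wn (Edge i e)) (mset_set T)"

definition hub :: "nat set \<Rightarrow> nat \<Rightarrow> vertex"
  where "hub T i = (Spider Z 0, {#wn (In i), wn (Out i)#} + edges i T)"

definition parity :: "nat set \<Rightarrow> nat \<Rightarrow> vertex"
  where "parity T e = (Spider X 0, add_mset (wn (Ext e)) (redges e T))"

definition ext :: "vertex multiset \<Rightarrow> vertex multiset"
  where "ext W = image_mset (map_prod id (image_mset (\<lambda>e. wn (Ext e)))) W"

text \<open>Every \<open>e \<in> A\<close> names a wire carrying the parity of the qubits in \<open>v e\<close>; these wires are plugged
  into the diagram fragment \<open>W\<close>.\<close>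

definition sys :: "nat \<Rightarrow> nat set \<Rightarrow> (nat \<Rightarrow> nat set) \<Rightarrow> vertex multiset \<Rightarrow> diagram"
  where "sys n A v W = Diagram
    ((\<Sum>i<n. {#hub {e \<in> A. i \<in> v e} i#}) + (\<Sum>e\<in>A. {#parity (v e \<inter> {..<n}) e#}) + ext W)
    (map (\<lambda>i. wn (In i)) [0..<n]) (map (\<lambda>i. wn (Out i)) [0..<n])"

abbreviation ends :: "vertex multiset \<Rightarrow> nat multiset"
  where "ends W \<equiv> \<Sum>\<^sub># (image_mset snd W)"

text \<open>\<open>A\<close> is exactly the set of open wires of the fragment \<open>W\<close>: an
  open wire has its second end at a parity spider, and every other wire lies entirely inside
  \<open>W\<close>. This is what well-formedness of \<open>sys\<close> demands of
  \<open>W\<close>.\<close>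

definition admissible :: "nat set \<Rightarrow> vertex multiset \<Rightarrow> bool"
  where "admissible A W \<longleftrightarrow> finite A \<and> (\<forall>legs. (Hadamard, legs) \<notin># W) \<and>
    (\<forall>e. if e \<in> A then count (ends W) e = 1 else count (ends W) e = 0 \<or> count (ends W) e = 2)"

section \<open>Counting the wire ends of a system\<close>

lemma admissible_count:
  "admissible A W \<Longrightarrow>
    if e \<in> A then count (ends W) e = 1 else count (ends W) e = 0 \<or> count (ends W) e = 2"
  unfolding admissible_def by blast

lemma count_image_mset_le_1:
  assumes "inj_on f S"
  shows "count (image_mset f (mset_set S)) x \<le> 1"
  by (simp add: image_mset_mset_set[OF assms] count_mset_set')

lemma edges_Un: "finite T \<Longrightarrow> finite U \<Longrightarrow> T \<inter> U = {} \<Longrightarrow> edges i (T \<union> U) = edges i T + edges i U"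
  by (simp add: edges_def mset_set_Union)

lemma redges_Un: "finite T \<Longrightarrow> finite U \<Longrightarrow> T \<inter> U = {} \<Longrightarrow> redges i (T \<union> U) = redges i T + redges i U"
  by (simp add: redges_def mset_set_Union)

lemma edges_insert: "finite T \<Longrightarrow> e \<notin> T \<Longrightarrow> edges i (insert e T) = add_mset (wn (Edge i e)) (edges i T)"
  by (simp add: edges_def)

lemma redges_insert: "finite T \<Longrightarrow> i \<notin> T \<Longrightarrow> redges e (insert i T) = add_mset (wn (Edge i e)) (redges e T)"
  by (simp add: redges_def)

lemma edges_empty [simp]: "edges i {} = {#}" "redges i {} = {#}"
  by (simp_all add: edges_def redges_def)

lemma count_hub_le_1: "finite T \<Longrightarrow> count ({#wn (In i), wn (Out i)#} + edges i T) x \<le> 1"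
proof -
  assume T: "finite T"
  have "{#wn (In i), wn (Out i)#} + edges i T = image_mset wn (mset_set ({In i, Out i} \<union> Edge i ` T))"
    using T by (subst mset_set_Union)
      (auto simp: edges_def image_mset_mset_set[symmetric] inj_on_def multiset.map_comp comp_def)
  then show ?thesis by (metis count_image_mset_le_1 inj_to_nat inj_on_subset subset_UNIV)
qed

lemma count_parity_le_1:
  assumes "finite T" "finite U" "e \<noteq> f" "finite S"
  shows "count (redges e T + redges f U + image_mset (\<lambda>x. wn (Ext x)) (mset_set S)) x \<le> 1"
proof -
  have "redges e T + redges f U + image_mset (\<lambda>x. wn (Ext x)) (mset_set S) =
    image_mset wn (mset_set ((\<lambda>i. Edge i e) ` T \<union> (\<lambda>i. Edge i f) ` U \<union> Ext ` S))"
    using assms by (subst mset_set_Union; (subst mset_set_Union)?)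
      (auto simp: redges_def image_mset_mset_set[symmetric] inj_on_def multiset.map_comp comp_def)
  then show ?thesis by (metis count_image_mset_le_1 inj_to_nat inj_on_subset subset_UNIV)
qed

lemma ends_ext: "ends (ext W) = image_mset (\<lambda>e. wn (Ext e)) (ends W)"
  unfolding ext_def by (induction W) auto

lemma ends_sum: "ends (sum F S) = (\<Sum>i\<in>S. ends (F i))"
  by (induction S rule: infinite_finite_induct) auto

lemma Hadamard_sum: "(Hadamard, legs) \<in># sum F S \<Longrightarrow> \<exists>i\<in>S. (Hadamard, legs) \<in># F i"
  by (induction S rule: infinite_finite_induct) auto

lemma no_Hadamard [simp]: "(Hadamard, legs) \<noteq> hub T i" "(Hadamard, legs) \<noteq> parity T e"
  by (auto simp: hub_def parity_def)

lemma ext_simps [simp]: "ext {#} = {#}" "ext (V + W) = ext V + ext W"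
  "ext (add_mset p W) = add_mset (fst p, image_mset (\<lambda>e. wn (Ext e)) (snd p)) (ext W)"
  by (simp_all add: ext_def map_prod_def case_prod_unfold)

text \<open>Since the numbering is injective, ends may be counted at symbolic wires.\<close>

lemma well_formed_wire_level:
  assumes "wire_ends D = image_mset wn N" "\<And>x. count N x = 0 \<or> count N x = 2"
    and "\<And>legs. (Hadamard, legs) \<notin># vertices D"
  shows "well_formed D"
  unfolding well_formed_count
proof (intro conjI allI impI)
  fix w
  show "count (wire_ends D) w = 0 \<or> count (wire_ends D) w = 2"
  proof (cases "w \<in> range wn")
    case True
    then obtain x where x: "w = wn x" by auto
    have "count (wire_ends D) w = count N x"
      unfolding assms(1) x by (rule count_image_mset_inj_on[of _ UNIV]) auto
    then show ?thesis using assms(2)[of x] by simp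
  next
    case False
    then have "w \<notin># image_mset wn N" by auto
    then show ?thesis by (simp add: assms(1) count_eq_zero_iff)
  qed
qed (use assms(3) in auto)

lemma count_image_inj: "inj f \<Longrightarrow> count (image_mset f M) (f x) = count M x"
  by (rule count_image_mset_inj_on[of _ UNIV]) auto

lemma count_image_notin: "x \<notin> range f \<Longrightarrow> count (image_mset f M) x = 0"
  by (auto simp: count_eq_zero_iff)

lemma well_formed_sys:
  assumes "admissible A W"
  shows "well_formed (sys n A v W)"
proof -
  have A: "finite A" using assms by (simp add: admissible_def)
  define H where "H i = {#In i, Out i#} + image_mset (Edge i) (mset_set {e \<in> A. i \<in> v e})" for i
  define P where "P e = add_mset (Ext e) (image_mset (\<lambda>i. Edge i e) (mset_set (v e \<inter> {..<n})))" for e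
  define N where "N = (\<Sum>i<n. H i) + (\<Sum>e\<in>A. P e) + image_mset Ext (ends W) + image_mset In (mset_set {..<n}) + image_mset Out (mset_set {..<n})"
  have im: "image_mset f (sum F S) = (\<Sum>i\<in>S. image_mset f (F i))" for f :: "wire \<Rightarrow> nat" and F :: "nat \<Rightarrow> wire multiset" and S
    by (induction S rule: infinite_finite_induct) auto
  have "wire_ends (sys n A v W) = image_mset wn N"
    by (simp add: sys_def N_def ends_sum ends_ext im hub_def parity_def H_def P_def edges_def redges_def
      multiset.map_comp comp_def atLeast0LessThan)
  moreover have "count N x = 0 \<or> count N x = 2" for x
  proof (cases x)
    case (In i)
    have "count (H j) x = (if j = i then 1 else 0)" for j
      by (auto simp: In H_def count_image_notin image_iff)
    then show ?thesis
      by (auto simp: In N_def count_sum P_def count_image_notin count_image_inj inj_def count_mset_set' image_iff)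
  next
    case (Out i)
    have "count (H j) x = (if j = i then 1 else 0)" for j
      by (auto simp: Out H_def count_image_notin image_iff)
    then show ?thesis
      by (auto simp: Out N_def count_sum P_def count_image_notin count_image_inj inj_def count_mset_set' image_iff)
  next
    case (Edge i e)
    have 1: "count (H j) x = (if j = i then if e \<in> A \<and> i \<in> v e then 1 else 0 else 0)" for j
      using A by (cases "j = i") (auto simp: Edge H_def count_image_notin count_image_inj inj_def count_mset_set' image_iff)
    have 2: "count (P f) x = (if f = e then if i < n \<and> i \<in> v e then 1 else 0 else 0)" for f
      using A by (cases "f = e")
        (auto simp: Edge P_def count_image_notin count_image_inj[of "\<lambda>i. Edge i e"] inj_def count_mset_set' image_iff)
    show ?thesis
      using A by (auto simp: N_def count_sum 1 2) (auto simp: Edge count_image_notin image_iff)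
  next
    case (Ext e)
    have 2: "count (P f) x = (if f = e then 1 else 0)" for f
      by (auto simp: Ext P_def count_image_notin image_iff)
    have "count N x = (if e \<in> A then 1 else 0) + count (ends W) e"
      using A by (auto simp: N_def count_sum 2) (auto simp: Ext H_def count_image_inj inj_def count_image_notin image_iff)
    then show ?thesis using assms by (auto simp: admissible_def split: if_splits)
  qed
  moreover have "(Hadamard, legs) \<notin># vertices (sys n A v W)" for legs
    using assms by (auto simp: sys_def admissible_def ext_def dest!: Hadamard_sum)
  ultimately show ?thesis by (rule well_formed_wire_level)
qed

lemma map_nth_comp: "map (\<lambda>k. F (xs ! k)) [0..<length xs] = map F xs"
  by (rule nth_equalityI) auto

lemma mset_map_sum: "distinct xs \<Longrightarrow> mset (map F xs) = (\<Sum>x\<in>set xs. {#F x#})"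
  by (induction xs) auto

lemma sum_singleton: "finite S \<Longrightarrow> (\<Sum>x\<in>S. {#F x#}) = image_mset F (mset_set S)"
  by (induction S rule: finite_induct) auto

lemma wires_sys:
  assumes "finite A"
  shows "wires (sys n A v W) \<subseteq> wn ` (In ` {..<n} \<union> Out ` {..<n} \<union>
    (\<lambda>(i, e). Edge i e) ` (SIGMA i:{..<n}. {e \<in> A. i \<in> v e}) \<union> Ext ` (A \<union> set_mset (ends W)))" (is "_ \<subseteq> ?R")
proof -
  have E: "wn (Edge i e) \<in> ?R" if "i < n" "e \<in> A" "i \<in> v e" for i e
    by (rule imageI, rule UnI1, rule UnI2, rule image_eqI[of _ _ "(i, e)"]) (use that in auto)
  have 1: "set_mset (snd p) \<subseteq> ?R" if p: "p \<in># (\<Sum>i<n. {#hub {e \<in> A. i \<in> v e} i#})" for p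
  proof -
    obtain i where "i < n" "p = hub {e \<in> A. i \<in> v e} i" using p by (auto simp: sum_singleton)
    then show ?thesis using assms E by (auto simp: hub_def edges_def)
  qed
  have 2: "set_mset (snd p) \<subseteq> ?R" if p: "p \<in># (\<Sum>e\<in>A. {#parity (v e \<inter> {..<n}) e#})" for p
  proof -
    obtain e where "e \<in> A" "p = parity (v e \<inter> {..<n}) e" using p assms by (auto simp: sum_singleton)
    then show ?thesis using E by (auto simp: parity_def redges_def)
  qed
  have 3: "set_mset (snd p) \<subseteq> ?R" if p: "p \<in># ext W" for p
    using p by (fastforce simp: ext_def)
  have 4: "set (map (\<lambda>i. wn (In i)) [0..<n]) \<subseteq> ?R" "set (map (\<lambda>i. wn (Out i)) [0..<n]) \<subseteq> ?R"
    by auto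
  show ?thesis
    unfolding sys_def wires_Diagram set_mset_union UN_Un by (intro Un_least UN_least 1 2 3 4)
qed

text \<open>A Z-spider fed by a parity copies it. Strong complementarity turns the parity spider and
  this Z-spider into one parity spider per output and one Z-spider per qubit of \<open>v e\<close>;
  the latter fuse with the hubs. For \<open>b = []\<close> the parity is discarded.\<close>

lemma sys_spread:
  fixes A :: "nat set" and b :: "nat list" and v :: "nat \<Rightarrow> nat set" and e :: nat
  defines "A' \<equiv> A - {e} \<union> set b" and "v' \<equiv> \<lambda>x. if x \<in> set b then v e else v x"
  assumes adm: "admissible A (add_mset (Spider Z 0, mset (e # b)) W)"
    and e: "e \<in> A" and b: "distinct b" "set b \<inter> A = {}"
  shows "admissible A' W" "sys n A v (add_mset (Spider Z 0, mset (e # b)) W) \<approx> sys n A' v' W"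
proof -
  have A: "finite A" using adm by (simp add: admissible_def)
  have eb: "e \<notin> set b" using e b by auto
  show adm': "admissible A' W"
    unfolding admissible_def
  proof (intro conjI allI)
    show "finite A'" using A by (simp add: A'_def)
    show "(Hadamard, legs) \<notin># W" for legs using adm by (auto simp: admissible_def)
    fix x
    have *: "if x \<in> A then count (mset (e # b)) x + count (ends W) x = 1
      else count (mset (e # b)) x + count (ends W) x = 0 \<or> count (mset (e # b)) x + count (ends W) x = 2"
      using admissible_count[OF adm, of x]
      by (simp only: image_mset_add_mset sum_mset.add_mset count_union snd_conv)
    have cb: "count (mset b) x = (if x \<in> set b then 1 else 0)"
      using b(1) by (simp add: distinct_count_atmost_1)
    show "if x \<in> A' then count (ends W) x = 1 else count (ends W) x = 0 \<or> count (ends W) x = 2"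
      using * e b(2) eb by (cases "x = e"; cases "x \<in> set b"; cases "x \<in> A") (auto simp: cb A'_def)
  qed
  let ?I = "map (\<lambda>i. wn (In i)) [0..<n]" and ?O = "map (\<lambda>i. wn (Out i)) [0..<n]"
  define S where "S = v e \<inter> {..<n}"
  define sl where "sl = sorted_list_of_set S"
  have S: "finite S" "S \<subseteq> {..<n}" "set sl = S" "distinct sl"
    by (auto simp: S_def sl_def)
  note S = S mset_set_set[OF S(4), unfolded S(3)]
  define T where "T i = {x \<in> A. i \<in> v x}" for i
  define T' where "T' i = {x \<in> A'. i \<in> v' x}" for i
  define U where "U i = {x \<in> A - {e}. i \<in> v x}" for i
  have fin: "finite (T i)" "finite (T' i)" "finite (U i)" for i
    using A by (auto simp: T_def T'_def U_def A'_def)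
  have TS: "T i = insert e (U i)" "T' i = U i \<union> set b" "U i \<inter> set b = {}" "e \<notin> U i" if "i \<in> S" for i
    using that e b eb by (auto simp: T_def T'_def U_def A'_def v'_def S_def split: if_splits)
  have TN: "T i = T' i" if "i \<in> {..<n} - S" for i
    using that e b eb by (auto simp: T_def T'_def U_def A'_def v'_def S_def split: if_splits)
  define Zi where "Zi i = (Spider Z 0, add_mset (wn (Edge i e)) (edges i (set b)))" for i
  define P where "P = (\<Sum>x\<in>A - {e}. {#parity (v x \<inter> {..<n}) x#})"
  define Q where "Q = (\<Sum>x\<in>set b. {#parity S x#})"
  define C where "C = (\<Sum>i\<in>{..<n} - S. {#hub (T' i) i#}) + (P + Q + ext W)"
  have hubs: "(\<Sum>i<n. {#hub (F i) i#}) = (\<Sum>i\<in>S. {#hub (F i) i#}) + (\<Sum>i\<in>{..<n} - S. {#hub (F i) i#})" for F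
    using sum.subset_diff[OF S(2) finite_lessThan, of "\<lambda>i. {#hub (F i) i#}"] by (simp only: add.commute)
  have P': "(\<Sum>x\<in>A - {e}. {#parity (v' x \<inter> {..<n}) x#}) = P"
    unfolding P_def by (rule sum.cong) (use b in \<open>auto simp: v'_def\<close>)
  have Q': "(\<Sum>x\<in>set b. {#parity (v' x \<inter> {..<n}) x#}) = Q"
    unfolding Q_def by (rule sum.cong) (auto simp: v'_def S_def)
  have fin_eq: "sys n A' v' W = Diagram ((\<Sum>i\<in>S. {#hub (T' i) i#}) + C) ?I ?O"
  proof -
    have "(\<Sum>x\<in>A'. {#parity (v' x \<inter> {..<n}) x#}) = P + Q"
      unfolding A'_def using A b(2) by (subst sum.union_disjoint) (auto simp: P' Q')
    then show ?thesis
      unfolding sys_def T'_def[symmetric] hubs C_def by (simp add: ac_simps)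
  qed
  have hubTT': "(\<Sum>i\<in>{..<n} - S. {#hub (T i) i#}) = (\<Sum>i\<in>{..<n} - S. {#hub (T' i) i#})"
    by (rule sum.cong) (auto simp: TN)
  \<comment> \<open>The diagram after strong complementarity, before the new Z-spiders
    \<open>Zi\<close> are fused with the hubs.\<close>
  define mid where "mid = (\<Sum>i\<in>S. {#hub (T i) i, Zi i#}) + C"
  have e1: "Diagram mid ?I ?O \<approx> sys n A' v' W" if wf: "well_formed (Diagram mid ?I ?O)"
    unfolding fin_eq unfolding mid_def
  proof (rule zx_eq_sum[OF S(1)])
    show "well_formed (Diagram ((\<Sum>i\<in>S. {#hub (T i) i, Zi i#}) + C) ?I ?O)"
      using wf by (simp add: mid_def)
    fix i K assume i: "i \<in> S" and w: "well_formed (Diagram ({#hub (T i) i, Zi i#} + K) ?I ?O)"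
    have c: "count (({#wn (In i), wn (Out i)#} + edges i (U i)) + edges i (set b) + {#wn (Edge i e)#}) x \<le> 1" for x
      using count_hub_le_1[of "U i \<union> set b \<union> {e}" i x] TS[OF i] fin eb
      by (simp add: edges_Un edges_insert del: Un_insert_right)
    have h: "hub (T i) i = (Spider Z 0, ({#wn (In i), wn (Out i)#} + edges i (U i)) + {#wn (Edge i e)#})"
      "Zi i = (Spider Z 0, edges i (set b) + {#wn (Edge i e)#})"
      "hub (T' i) i = (Spider Z (0 + 0), ({#wn (In i), wn (Out i)#} + edges i (U i)) + edges i (set b))"
      using TS[OF i] fin eb by (simp_all add: hub_def Zi_def edges_Un edges_insert)
    show "Diagram ({#hub (T i) i, Zi i#} + K) ?I ?O \<approx> Diagram ({#hub (T' i) i#} + K) ?I ?O"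
      using zx_eq_fusion[OF _ c, of Z 0 0 K ?I ?O] w unfolding h by simp
  qed
  \<comment> \<open>Well-formedness is obtained backwards from the final system: \<open>mid\<close>
    only adds the wires \<open>Edge i e\<close>, which are fresh as \<open>e\<close> is no longer a
    parity.\<close>
  have wmid: "well_formed (Diagram mid ?I ?O)"
  proof (rule well_formed_insert[where E = "redges e S"])
    show "well_formed (Diagram ((\<Sum>i\<in>S. {#hub (T' i) i#}) + C) ?I ?O)"
      unfolding fin_eq[symmetric] by (rule well_formed_sys[OF adm'])
    show "w \<notin> wires (Diagram ((\<Sum>i\<in>S. {#hub (T' i) i#}) + C) ?I ?O)" if w: "w \<in># redges e S" for w
    proof
      assume "w \<in> wires (Diagram ((\<Sum>i\<in>S. {#hub (T' i) i#}) + C) ?I ?O)"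
      then have "w \<in> wires (sys n A' v' W)" unfolding fin_eq .
      moreover obtain i where "w = wn (Edge i e)" using w S(1) by (auto simp: redges_def)
      ultimately have "e \<in> A'" using wires_sys[of A' n v' W] A by (auto simp: A'_def)
      then show False using eb by (simp add: A'_def)
    qed
    show "count (redges e S) w \<le> 1" for w
      unfolding redges_def by (rule count_image_mset_le_1) (auto simp: inj_on_def)
    have "ends {#hub (T i) i, Zi i#} = ends {#hub (T' i) i#} + {#wn (Edge i e)#} + {#wn (Edge i e)#}" if "i \<in> S" for i
      using TS[OF that] fin eb by (simp add: hub_def Zi_def edges_Un edges_insert)
    then have "(\<Sum>i\<in>S. ends {#hub (T i) i, Zi i#}) =
        (\<Sum>i\<in>S. ends {#hub (T' i) i#} + {#wn (Edge i e)#} + {#wn (Edge i e)#})"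
      by (intro sum.cong) auto
    also have "\<dots> = (\<Sum>i\<in>S. ends {#hub (T' i) i#}) + redges e S + redges e S"
      by (simp only: sum.distrib sum_singleton[OF S(1)] redges_def)
    finally have "(\<Sum>i\<in>S. ends {#hub (T i) i, Zi i#}) = (\<Sum>i\<in>S. ends {#hub (T' i) i#}) + redges e S + redges e S" .
    then show "ends mid = ends ((\<Sum>i\<in>S. {#hub (T' i) i#}) + C) + redges e S + redges e S"
      unfolding mid_def image_mset_union sum_mset.union ends_sum by (simp add: ac_simps)
    show "(Hadamard, legs) \<in># (\<Sum>i\<in>S. {#hub (T' i) i#}) + C" if "(Hadamard, legs) \<in># mid" for legs
      using that unfolding mid_def by (auto simp: Zi_def dest!: Hadamard_sum)
  qed
  let ?a = "map (\<lambda>i. wn (Edge i e)) sl" and ?b = "map (\<lambda>x. wn (Ext x)) b"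
  let ?w = "\<lambda>k j. wn (Edge (sl ! k) (b ! j))"
  let ?K = "(\<Sum>i<n. {#hub (T i) i#}) + (P + ext W)"
  have init: "sys n A v (add_mset (Spider Z 0, mset (e # b)) W) =
    Diagram (add_mset (Spider (opp Z) 0, mset (wn (Ext e) # ?a)) (add_mset (Spider Z 0, mset (wn (Ext e) # ?b)) ?K)) ?I ?O"
  proof -
    have "(\<Sum>x\<in>A. {#parity (v x \<inter> {..<n}) x#}) = add_mset (parity S e) P"
      using A e by (simp add: sum.remove P_def S_def)
    moreover have "parity S e = (Spider X 0, mset (wn (Ext e) # ?a))"
      by (simp add: parity_def redges_def S(5))
    ultimately show ?thesis
      unfolding sys_def T_def[symmetric] by simp
  qed
  have R: "mset (map (\<lambda>i. (Spider Z 0, mset (?a ! i # map (\<lambda>j. ?w i j) [0..<length ?b]))) [0..<length ?a]) +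
      mset (map (\<lambda>j. (Spider (opp Z) 0, mset (?b ! j # map (\<lambda>i. ?w i j) [0..<length ?a]))) [0..<length ?b]) =
      (\<Sum>i\<in>S. {#Zi i#}) + Q"
  proof -
    have 1: "mset (map (\<lambda>j. ?w k j) [0..<length b]) = edges (sl ! k) (set b)" for k
      using map_nth_comp[of "\<lambda>x. wn (Edge (sl ! k) x)" b] b(1)
      by (simp add: edges_def mset_set_set flip: mset_map)
    have 2: "mset (map (\<lambda>k. ?w k j) [0..<length sl]) = redges (b ! j) S" for j
      using map_nth_comp[of "\<lambda>x. wn (Edge x (b ! j))" sl]
      by (simp add: redges_def S(5) flip: mset_map)
    have "map (\<lambda>i. (Spider Z 0, mset (?a ! i # map (\<lambda>j. ?w i j) [0..<length ?b]))) [0..<length ?a] =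
      map (\<lambda>k. Zi (sl ! k)) [0..<length sl]"
      using 1 by (intro map_cong) (auto simp: Zi_def)
    moreover have "map (\<lambda>j. (Spider (opp Z) 0, mset (?b ! j # map (\<lambda>i. ?w i j) [0..<length ?a]))) [0..<length ?b] =
      map (\<lambda>j. parity S (b ! j)) [0..<length b]"
      using 2 by (intro map_cong) (auto simp: parity_def)
    ultimately show ?thesis
      unfolding map_nth_comp using b(1) S(3,4) by (simp only: mset_map_sum Q_def)
  qed
  have RK: "((\<Sum>i\<in>S. {#Zi i#}) + Q) + ?K = mid"
  proof -
    have "(\<Sum>i\<in>S. {#hub (T i) i, Zi i#}) = (\<Sum>i\<in>S. {#hub (T i) i#}) + (\<Sum>i\<in>S. {#Zi i#})"
      unfolding sum.distrib[symmetric] by (simp add: add_mset_commute)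
    then show ?thesis
      unfolding hubs mid_def C_def hubTT' by (simp add: ac_simps)
  qed
  have cc: "concat (map (\<lambda>i. map (\<lambda>j. ?w i j) [0..<length ?b]) [0..<length ?a]) = map (\<lambda>(i, x). wn (Edge i x)) (List.product sl b)"
    using map_nth_comp[of "\<lambda>i. map (\<lambda>x. wn (Edge i x)) b" sl]
    by (simp add: map_nth_comp[of "\<lambda>x. wn (Edge _ x)" b] product_concat_map map_concat comp_def)
  have "sys n A v (add_mset (Spider Z 0, mset (e # b)) W) \<approx> Diagram mid ?I ?O"
    unfolding init RK[symmetric] R[symmetric]
  proof (rule zx_eq_strong_complementarity)
    show "well_formed (Diagram (add_mset (Spider (opp Z) 0, mset (wn (Ext e) # ?a)) (add_mset (Spider Z 0, mset (wn (Ext e) # ?b)) ?K)) ?I ?O)"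
      unfolding init[symmetric] by (rule well_formed_sys[OF adm])
    show "distinct (wn (Ext e) # ?a @ ?b)"
      using S b eb by (auto simp: distinct_map inj_on_def)
    show "distinct (?a @ ?b @ concat (map (\<lambda>i. map (\<lambda>j. ?w i j) [0..<length ?b]) [0..<length ?a]))"
      unfolding cc using S b eb by (auto simp: distinct_map inj_on_def distinct_product)
  qed (unfold R RK, rule wmid)
  then show "sys n A v (add_mset (Spider Z 0, mset (e # b)) W) \<approx> sys n A' v' W"
    using e1[OF wmid] by (rule zx_eq_trans)
qed

text \<open>The parity spider of an empty set of qubits has only the leg towards the gate, so it
  forms a closed scalar with the gate.\<close>

lemma sys_drop_zero:
  assumes adm: "admissible A (add_mset (Spider Z \<alpha>, {#e#}) W)" and e: "e \<in> A" "v e \<inter> {..<n} = {}"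
  shows "admissible (A - {e}) W" "sys n A v (add_mset (Spider Z \<alpha>, {#e#}) W) \<approx> sys n (A - {e}) v W"
proof -
  have A: "finite A" using adm by (simp add: admissible_def)
  show "admissible (A - {e}) W"
    unfolding admissible_def
  proof (intro conjI allI)
    show "finite (A - {e})" using A by simp
    show "(Hadamard, legs) \<notin># W" for legs using adm by (auto simp: admissible_def)
    fix x
    have "if x \<in> A then count {#e#} x + count (ends W) x = 1
      else count {#e#} x + count (ends W) x = 0 \<or> count {#e#} x + count (ends W) x = 2"
      using admissible_count[OF adm, of x]
      by (simp only: image_mset_add_mset sum_mset.add_mset count_union snd_conv)
    then show "if x \<in> A - {e} then count (ends W) x = 1 else count (ends W) x = 0 \<or> count (ends W) x = 2"
      using e by (cases "x = e") auto
  qed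
  let ?I = "map (\<lambda>i. wn (In i)) [0..<n]" and ?O = "map (\<lambda>i. wn (Out i)) [0..<n]"
  let ?K = "(\<Sum>i<n. {#hub {x \<in> A - {e}. i \<in> v x} i#}) + (\<Sum>x\<in>A - {e}. {#parity (v x \<inter> {..<n}) x#}) + ext W"
  have "(\<Sum>i<n. {#hub {x \<in> A. i \<in> v x} i#}) = (\<Sum>i<n. {#hub {x \<in> A - {e}. i \<in> v x} i#})"
  proof (rule sum.cong)
    fix i assume "i \<in> {..<n}"
    then have "{x \<in> A. i \<in> v x} = {x \<in> A - {e}. i \<in> v x}" using e by auto
    then show "{#hub {x \<in> A. i \<in> v x} i#} = {#hub {x \<in> A - {e}. i \<in> v x} i#}" by simp
  qed simp
  then have eq: "sys n A v (add_mset (Spider Z \<alpha>, {#e#}) W) =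
    Diagram (add_mset (Spider X 0, {#wn (Ext e)#}) (add_mset (Spider Z \<alpha>, {#wn (Ext e)#}) ?K)) ?I ?O"
    using A e by (simp add: sys_def sum.remove[of A e] parity_def)
  have "well_formed (sys n A v (add_mset (Spider Z \<alpha>, {#e#}) W))"
    by (rule well_formed_sys[OF adm])
  then have "sys n A v (add_mset (Spider Z \<alpha>, {#e#}) W) \<approx> Diagram ?K ?I ?O"
    unfolding eq by (rule zx_eq_drop_scalar)
  then show "sys n A v (add_mset (Spider Z \<alpha>, {#e#}) W) \<approx> sys n (A - {e}) v W"
    by (simp only: sys_def)
qed

lemma sys_ext_context:
  assumes eq: "Diagram V [] h \<approx> Diagram V' [] h" and h: "distinct h"
    and adm: "admissible A (V + W)" "admissible A (V' + W)"
  shows "sys n A v (V + W) \<approx> sys n A v (V' + W)"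
proof -
  let ?f = "\<lambda>e. wn (Ext e)"
  have inj: "inj_on ?f B" for B by (auto simp: inj_on_def)
  have "rename ?f (Diagram V [] h) \<approx> rename ?f (Diagram V' [] h)"
    by (rule zx_eq_rename_both[OF eq inj inj])
  then have "Diagram (ext V) [] (map ?f h) \<approx> Diagram (ext V') [] (map ?f h)"
    by (simp add: ext_def)
  then show ?thesis
    using zx_eq_context[of "ext V" "[]" "map ?f h" "ext V'"
      "(\<Sum>i<n. {#hub {e \<in> A. i \<in> v e} i#}) + (\<Sum>e\<in>A. {#parity (v e \<inter> {..<n}) e#}) + ext W"]
      well_formed_sys[OF adm(1), of n v] well_formed_sys[OF adm(2), of n v] h inj
    by (simp add: sys_def distinct_map ac_simps)
qed

text \<open>Edges and external wires get separate maps: when two parities are added, their edges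
  have to be renamed to the new parity while the external wires keep their names.\<close>

fun relabel :: "(nat \<Rightarrow> nat) \<Rightarrow> (nat \<Rightarrow> nat) \<Rightarrow> wire \<Rightarrow> wire"
  where
    "relabel k m (In i) = In i"
  | "relabel k m (Out i) = Out i"
  | "relabel k m (Edge i e) = Edge i (k e)"
  | "relabel k m (Ext e) = Ext (m e)"

definition relabel_nat :: "(nat \<Rightarrow> nat) \<Rightarrow> (nat \<Rightarrow> nat) \<Rightarrow> nat \<Rightarrow> nat"
  where "relabel_nat k m w = wn (relabel k m (from_nat w))"

lemma relab_wn [simp]: "relabel_nat k m (wn w) = wn (relabel k m w)"
  by (simp add: relabel_nat_def)

lemma image_mset_sum: "image_mset f (sum F S) = (\<Sum>i\<in>S. image_mset f (F i))"
  by (induction S rule: infinite_finite_induct) auto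

lemma image_edges:
  assumes "inj_on k T"
  shows "image_mset (relabel_nat k m) (edges i T) = edges i (k ` T)"
  unfolding edges_def image_mset_mset_set[OF assms, symmetric]
  by (simp add: multiset.map_comp comp_def)

lemma image_redges: "image_mset (relabel_nat k m) (redges e T) = redges (k e) T"
  by (simp add: redges_def multiset.map_comp comp_def)

lemma relab_hub: "inj_on k T \<Longrightarrow> map_prod id (image_mset (relabel_nat k m)) (hub T i) = hub (k ` T) i"
  by (simp add: hub_def image_edges)

lemma relab_parity: "k e = m e \<Longrightarrow> map_prod id (image_mset (relabel_nat k m)) (parity T e) = parity T (m e)"
  by (simp add: parity_def image_redges)

lemma relab_ext: "image_mset (map_prod id (image_mset (relabel_nat k m))) (ext W) =
    ext (image_mset (map_prod id (image_mset m)) W)"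
  by (simp add: ext_def multiset.map_comp comp_def map_prod_def case_prod_unfold)

lemma sys_rename:
  assumes adm: "admissible A W" and f: "inj_on f (A \<union> set_mset (ends W))"
    and v: "\<And>e. e \<in> A \<Longrightarrow> v' (f e) = v e"
  shows "sys n A v W \<approx> sys n (f ` A) v' (image_mset (map_prod id (image_mset f)) W)"
proof -
  have A: "finite A" using adm by (simp add: admissible_def)
  have fA: "inj_on f A" using f by (rule inj_on_subset) simp
  have "inj_on (relabel_nat f f) (wires (sys n A v W))"
  proof (rule inj_on_subset[OF _ wires_sys[OF A]], rule inj_on_imageI)
    have "inj_on (relabel_nat f f \<circ> wn) (In ` {..<n} \<union> Out ` {..<n} \<union>
      (\<lambda>(i, e). Edge i e) ` (SIGMA i:{..<n}. {e \<in> A. i \<in> v e}) \<union> Ext ` M)" if "inj_on f M" for M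
      by (intro inj_onI) (auto dest: inj_onD[OF that] inj_onD[OF fA])
    from this[OF f] show "inj_on (relabel_nat f f \<circ> wn) (In ` {..<n} \<union> Out ` {..<n} \<union>
      (\<lambda>(i, e). Edge i e) ` (SIGMA i:{..<n}. {e \<in> A. i \<in> v e}) \<union> Ext ` (A \<union> set_mset (ends W)))" .
  qed
  then have "sys n A v W \<approx> rename (relabel_nat f f) (sys n A v W)"
    by (rule zx_eq_rename[OF well_formed_sys[OF adm]])
  also have "rename (relabel_nat f f) (sys n A v W) = sys n (f ` A) v' (image_mset (map_prod id (image_mset f)) W)"
  proof -
    have "map_prod id (image_mset (relabel_nat f f)) (hub {e \<in> A. i \<in> v e} i) = hub {e \<in> f ` A. i \<in> v' e} i" for i
    proof -
      have "f ` {e \<in> A. i \<in> v e} = {e \<in> f ` A. i \<in> v' e}" using v by auto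
      then show ?thesis
        by (subst relab_hub) (auto intro: inj_on_subset[OF fA])
    qed
    moreover have "(\<Sum>e\<in>A. {#parity (v e \<inter> {..<n}) (f e)#}) = (\<Sum>e\<in>f ` A. {#parity (v' e \<inter> {..<n}) e#})"
      using fA v by (simp add: sum.reindex)
    ultimately show ?thesis
      by (simp add: sys_def image_mset_sum relab_parity relab_ext)
  qed
  finally show ?thesis .
qed

text \<open>The X-spider fuses with the two parity spiders it joins. A qubit in both vectors is then
  connected twice to the result, and the Hopf law removes such pairs, leaving the sum over F_2,
  which is the symmetric difference.\<close>

lemma sys_add:
  fixes A :: "nat set" and v :: "nat \<Rightarrow> nat set" and e1 e2 e3 :: nat
  defines "A' \<equiv> insert e3 (A - {e1, e2})" and "v' \<equiv> v(e3 := sym_diff (v e1) (v e2))"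
  assumes adm: "admissible A (add_mset (Spider X 0, {#e1, e2, e3#}) W)"
    and e: "e1 \<in> A" "e2 \<in> A" "e1 \<noteq> e2" "e3 \<notin> A"
  shows "admissible A' W" "sys n A v (add_mset (Spider X 0, {#e1, e2, e3#}) W) \<approx> sys n A' v' W"
proof -
  have A: "finite A" using adm by (simp add: admissible_def)
  have e3: "e3 \<noteq> e1" "e3 \<noteq> e2" using e by auto
  show adm': "admissible A' W"
    unfolding admissible_def
  proof (intro conjI allI)
    show "finite A'" using A by (simp add: A'_def)
    show "(Hadamard, legs) \<notin># W" for legs using adm by (auto simp: admissible_def)
    fix x
    have "if x \<in> A then count {#e1, e2, e3#} x + count (ends W) x = 1
      else count {#e1, e2, e3#} x + count (ends W) x = 0 \<or> count {#e1, e2, e3#} x + count (ends W) x = 2"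
      using admissible_count[OF adm, of x]
      by (simp only: image_mset_add_mset sum_mset.add_mset count_union snd_conv)
    then show "if x \<in> A' then count (ends W) x = 1 else count (ends W) x = 0 \<or> count (ends W) x = 2"
    proof -
      assume *: "if x \<in> A then count {#e1, e2, e3#} x + count (ends W) x = 1
        else count {#e1, e2, e3#} x + count (ends W) x = 0 \<or> count {#e1, e2, e3#} x + count (ends W) x = 2"
      have c: "count {#e1, e2, e3#} x = (if x \<in> {e1, e2, e3} then 1 else 0)" using e e3 by auto
      consider "x = e1" | "x = e2" | "x = e3" | "x \<notin> {e1, e2, e3}" by blast
      then show ?thesis using * e e3 unfolding c by cases (auto simp: A'_def)
    qed
  qed
  let ?I = "map (\<lambda>i. wn (In i)) [0..<n]" and ?O = "map (\<lambda>i. wn (Out i)) [0..<n]"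
  define B where "B = A - {e1, e2}"
  define V1 where "V1 = v e1 \<inter> {..<n}"
  define V2 where "V2 = v e2 \<inter> {..<n}"
  define S where "S = V1 \<inter> V2"
  define T where "T i = {x \<in> A. i \<in> v x}" for i
  define U where "U i = {x \<in> B. i \<in> v x}" for i
  have fin: "finite (T i)" "finite (U i)" "finite V1" "finite V2" "finite S" for i
    using A by (auto simp: T_def U_def B_def V1_def V2_def S_def)
  define C where "C = (\<Sum>x\<in>B. {#parity (v x \<inter> {..<n}) x#}) + ext W"
  define H where "H P i = hub (if i \<in> P then U i else T i) i" for P i
  \<comment> \<open>\<open>P\<close> is the set of common qubits whose double edges are already
    removed; the Hopf law enlarges it one qubit at a time until it is \<open>S\<close>.\<close>
  define D where "D P = Diagram ((\<Sum>i<n. {#H P i#}) +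
    add_mset (Spider X 0, add_mset (wn (Ext e3)) (redges e1 (V1 - P) + redges e2 (V2 - P))) C) ?I ?O" for P
  let ?K = "(\<Sum>i<n. {#H {} i#}) + C"
  have init: "sys n A v (add_mset (Spider X 0, {#e1, e2, e3#}) W) = Diagram
    (add_mset (Spider X 0, {#wn (Ext e2), wn (Ext e3)#} + {#wn (Ext e1)#})
      (add_mset (Spider X 0, redges e1 V1 + {#wn (Ext e1)#}) (add_mset (parity V2 e2) ?K))) ?I ?O"
  proof -
    let ?g = "\<lambda>x. {#parity (v x \<inter> {..<n}) x#}"
    have AB: "A - {e1} - {e2} = B" by (auto simp: B_def)
    have 1: "sum ?g A = ?g e1 + sum ?g (A - {e1})"
      by (rule sum.remove[OF A e(1)])
    have 2: "sum ?g (A - {e1}) = ?g e2 + sum ?g B"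
      unfolding AB[symmetric] by (rule sum.remove) (use A e in auto)
    have "sum ?g A = add_mset (parity V1 e1) (add_mset (parity V2 e2) (sum ?g B))"
      unfolding 1 2 V1_def V2_def by simp
    then show ?thesis
      by (simp add: sys_def C_def H_def T_def parity_def add_mset_commute)
  qed
  have "sys n A v (add_mset (Spider X 0, {#e1, e2, e3#}) W) \<approx> Diagram
    (add_mset (Spider X (0 + 0), {#wn (Ext e2), wn (Ext e3)#} + redges e1 V1) (add_mset (parity V2 e2) ?K)) ?I ?O"
    unfolding init
  proof (rule zx_eq_fusion[OF well_formed_sys[OF adm, of n v, unfolded init]])
    show "count ({#wn (Ext e2), wn (Ext e3)#} + redges e1 V1 + {#wn (Ext e1)#}) w \<le> 1" for w
    proof -
      have *: "{#wn (Ext e2), wn (Ext e3)#} + redges e1 V1 + {#wn (Ext e1)#} =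
        redges e1 V1 + redges e2 {} + image_mset (\<lambda>x. wn (Ext x)) (mset_set {e1, e2, e3})"
        using e e3 by simp
      show ?thesis unfolding * by (rule count_parity_le_1) (use fin e in auto)
    qed
  qed simp
  also have "\<dots> = Diagram
    (add_mset (Spider X 0, (add_mset (wn (Ext e3)) (redges e1 V1)) + {#wn (Ext e2)#})
      (add_mset (Spider X 0, redges e2 V2 + {#wn (Ext e2)#}) ?K)) ?I ?O"
    by (simp add: parity_def)
  also have "\<dots> \<approx> Diagram (add_mset (Spider X (0 + 0), (add_mset (wn (Ext e3)) (redges e1 V1)) + redges e2 V2) ?K) ?I ?O"
  proof (rule zx_eq_fusion[OF zx_eq_wf(2)[OF calculation]])
    show "count (add_mset (wn (Ext e3)) (redges e1 V1) + redges e2 V2 + {#wn (Ext e2)#}) w \<le> 1" for w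
    proof -
      have *: "add_mset (wn (Ext e3)) (redges e1 V1) + redges e2 V2 + {#wn (Ext e2)#} =
        redges e1 V1 + redges e2 V2 + image_mset (\<lambda>x. wn (Ext x)) (mset_set {e2, e3})"
        using e e3 by simp
      show ?thesis unfolding * by (rule count_parity_le_1) (use fin e in auto)
    qed
  qed simp
  also have "\<dots> = D {}"
    by (simp add: D_def)
  finally have e1: "sys n A v (add_mset (Spider X 0, {#e1, e2, e3#}) W) \<approx> D {}" .
  have e2: "D {} \<approx> D P" if "P \<subseteq> S" for P
    using finite_subset[OF that fin(5)] that
  proof (induction P rule: finite_induct)
    case empty
    then show ?case using zx_eq_refl[OF zx_eq_wf(2)[OF e1]] by simp
  next
    case (insert i P)
    then have IH: "D {} \<approx> D P" and i: "i \<in> V1" "i \<in> V2" "i < n" by (auto simp: S_def V1_def)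
    let ?Q = "insert i P"
    have T: "T i = insert e1 (insert e2 (U i))" "e1 \<notin> U i" "e2 \<notin> U i"
      using i e by (auto simp: T_def U_def B_def V1_def V2_def)
    have V: "V1 - P = insert i (V1 - ?Q)" "V2 - P = insert i (V2 - ?Q)"
      using i insert.hyps by auto
    have Hi: "H P i = (Spider Z 0, add_mset (wn (Edge i e1)) (add_mset (wn (Edge i e2)) ({#wn (In i), wn (Out i)#} + edges i (U i))))"
      using insert.hyps T fin e(3) by (simp add: H_def hub_def edges_insert)
    have Xi: "add_mset (wn (Ext e3)) (redges e1 (V1 - P) + redges e2 (V2 - P)) =
      add_mset (wn (Edge i e1)) (add_mset (wn (Edge i e2)) (add_mset (wn (Ext e3)) (redges e1 (V1 - ?Q) + redges e2 (V2 - ?Q))))"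
      unfolding V using fin by (simp add: redges_insert)
    let ?R = "(\<Sum>j\<in>{..<n} - {i}. {#H P j#}) + C"
    have HR: "(\<Sum>j\<in>{..<n} - {i}. {#H P j#}) = (\<Sum>j\<in>{..<n} - {i}. {#H ?Q j#})"
      by (rule sum.cong) (auto simp: H_def)
    have DP: "D P = Diagram (add_mset (Spider Z 0, add_mset (wn (Edge i e1)) (add_mset (wn (Edge i e2)) ({#wn (In i), wn (Out i)#} + edges i (U i))))
      (add_mset (Spider X 0, add_mset (wn (Edge i e1)) (add_mset (wn (Edge i e2)) (add_mset (wn (Ext e3)) (redges e1 (V1 - ?Q) + redges e2 (V2 - ?Q))))) ?R)) ?I ?O"
      unfolding D_def Xi using i by (simp add: sum.remove[of "{..<n}" i] Hi)
    have DQ: "D ?Q = Diagram (add_mset (Spider Z 0, {#wn (In i), wn (Out i)#} + edges i (U i))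
      (add_mset (Spider X 0, add_mset (wn (Ext e3)) (redges e1 (V1 - ?Q) + redges e2 (V2 - ?Q))) ?R)) ?I ?O"
      unfolding D_def HR using i by (simp add: sum.remove[of "{..<n}" i] H_def[of ?Q i] hub_def)
    have "D P \<approx> D ?Q"
      unfolding DP DQ
    proof (rule zx_eq_hopf[OF zx_eq_wf(2)[OF IH, unfolded DP]])
      show "count ({#wn (In i), wn (Out i)#} + edges i (U i)) w \<le> 1" for w
        by (rule count_hub_le_1) (rule fin)
      show "count (add_mset (wn (Ext e3)) (redges e1 (V1 - ?Q) + redges e2 (V2 - ?Q))) w \<le> 1" for w
        using count_parity_le_1[of "V1 - ?Q" "V2 - ?Q" e1 e2 "{e3}" w] fin e(3) by simp
    qed (use e(3) in simp)
    with IH show ?case by (rule zx_eq_trans)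
  qed
  \<comment> \<open>The surviving edges are still named after \<open>e1\<close> or
    \<open>e2\<close>. No qubit keeps both, so renaming them to \<open>e3\<close> is injective at
    every hub.\<close>
  define k where "k x = (if x = e1 \<or> x = e2 then e3 else x)" for x
  define T' where "T' i = (if i \<in> S then U i else T i)" for i
  have kT: "inj_on k (T' i)" "k ` T' i = {x \<in> A'. i \<in> v' x}" if "i < n" for i
  proof -
    have kU: "k ` U i = U i" "inj_on k (U i)"
      by (auto simp: U_def B_def k_def inj_on_def image_iff)
    have U: "e1 \<notin> U i" "e2 \<notin> U i" "e3 \<notin> U i" using e by (auto simp: U_def B_def)
    have A': "{x \<in> A'. i \<in> v' x} = (if i \<in> v e1 \<longleftrightarrow> i \<in> v e2 then U i else insert e3 (U i))"
      using e e3 by (auto simp: A'_def v'_def U_def B_def)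
    have T': "T' i = (if i \<in> v e1 \<longleftrightarrow> i \<in> v e2 then U i else if i \<in> v e1 then insert e1 (U i) else insert e2 (U i))"
      using e that by (auto simp: T'_def S_def V1_def V2_def T_def U_def B_def)
    have k: "k e1 = e3" "k e2 = e3" by (simp_all add: k_def)
    have i1: "inj_on k (insert x (U i))" if "k x = e3" "x \<notin> U i" for x
      using kU U that by simp
    show "inj_on k (T' i)" unfolding T' using kU i1 k U by simp
    show "k ` T' i = {x \<in> A'. i \<in> v' x}" unfolding T' A' using kU k by simp
  qed
  have e3: "D S \<approx> sys n A' v' W"
  proof -
    let ?R = "wn ` (In ` {..<n} \<union> Out ` {..<n} \<union> (\<lambda>(i, e). Edge i e) ` (SIGMA i:{..<n}. T' i) \<union> range Ext)"
    have E: "wn (Edge i x) \<in> ?R" if "i < n" "x \<in> T' i" for i x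
      by (rule imageI, rule UnI1, rule UnI2, rule image_eqI[of _ _ "(i, x)"]) (use that in auto)
    have 1: "set_mset (snd p) \<subseteq> ?R" if p: "p \<in># (\<Sum>i<n. {#H S i#})" for p
    proof -
      obtain i where "i < n" "p = hub (T' i) i" using p by (auto simp: sum_singleton H_def T'_def)
      then show ?thesis using E fin by (auto simp: hub_def edges_def T'_def split: if_splits)
    qed
    have 2: "set_mset (snd p) \<subseteq> ?R" if p: "p \<in># add_mset (Spider X 0, add_mset (wn (Ext e3)) (redges e1 (V1 - S) + redges e2 (V2 - S))) C" for p
    proof -
      consider "p = (Spider X 0, add_mset (wn (Ext e3)) (redges e1 (V1 - S) + redges e2 (V2 - S)))"
        | x where "x \<in> B" "p = parity (v x \<inter> {..<n}) x" | "p \<in># ext W"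
        using p A by (auto simp: C_def sum_singleton B_def)
      then show ?thesis
      proof cases
        case 1
        then show ?thesis using E e by (auto simp: redges_def T'_def T_def V1_def V2_def)
      next
        case 2
        then show ?thesis using E by (auto simp: parity_def redges_def T'_def T_def U_def B_def)
      next
        case 3
        then show ?thesis by (fastforce simp: ext_def)
      qed
    qed
    have 4: "set ?I \<subseteq> ?R" "set ?O \<subseteq> ?R" by auto
    have "wires (D S) \<subseteq> ?R"
      unfolding D_def wires_Diagram set_mset_union UN_Un by (intro Un_least UN_least 1 2 4)
    moreover have "inj_on (relabel_nat k id) ?R"
      by (rule inj_on_imageI, intro inj_onI) (auto dest: inj_onD[OF kT(1)])
    ultimately have "D S \<approx> rename (relabel_nat k id) (D S)"
      by (intro zx_eq_rename zx_eq_wf(2)[OF e2]) (auto intro: inj_on_subset)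
    also have "rename (relabel_nat k id) (D S) = sys n A' v' W"
    proof -
      have "(\<Sum>i<n. {#map_prod id (image_mset (relabel_nat k id)) (H S i)#}) = (\<Sum>i<n. {#hub {x \<in> A'. i \<in> v' x} i#})"
      proof (rule sum.cong)
        fix i assume "i \<in> {..<n}"
        then show "{#map_prod id (image_mset (relabel_nat k id)) (H S i)#} = {#hub {x \<in> A'. i \<in> v' x} i#}"
          using kT[of i] relab_hub[of k "T' i" id i] by (simp add: H_def T'_def)
      qed simp
      moreover have "(\<Sum>x\<in>B. {#map_prod id (image_mset (relabel_nat k id)) (parity (v x \<inter> {..<n}) x)#}) = (\<Sum>x\<in>B. {#parity (v' x \<inter> {..<n}) x#})"
      proof (rule sum.cong)
        fix x assume "x \<in> B"
        then have "k x = x" "v' x = v x" using e by (auto simp: k_def B_def v'_def)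
        then show "{#map_prod id (image_mset (relabel_nat k id)) (parity (v x \<inter> {..<n}) x)#} = {#parity (v' x \<inter> {..<n}) x#}"
          using relab_parity[of k x id] by simp
      qed simp
      moreover have "(Spider X 0, add_mset (wn (Ext e3)) (redges e3 (V1 - S) + redges e3 (V2 - S))) = parity (v' e3 \<inter> {..<n}) e3"
      proof -
        have "v' e3 \<inter> {..<n} = (V1 - S) \<union> (V2 - S)" by (auto simp: v'_def V1_def V2_def S_def)
        moreover have "redges e3 ((V1 - S) \<union> (V2 - S)) = redges e3 (V1 - S) + redges e3 (V2 - S)"
          using fin by (intro redges_Un) (auto simp: S_def)
        ultimately show ?thesis by (simp add: parity_def)
      qed
      moreover have "(\<Sum>x\<in>A'. {#parity (v' x \<inter> {..<n}) x#}) = add_mset (parity (v' e3 \<inter> {..<n}) e3) (\<Sum>x\<in>B. {#parity (v' x \<inter> {..<n}) x#})"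
        using A e by (simp add: A'_def B_def)
      moreover have "k e1 = e3" "k e2 = e3" by (simp_all add: k_def)
      ultimately show ?thesis
        by (simp add: sys_def D_def C_def image_mset_sum image_redges relab_ext map_prod.id multiset.map_id)
    qed
    finally show ?thesis .
  qed
  show "sys n A v (add_mset (Spider X 0, {#e1, e2, e3#}) W) \<approx> sys n A' v' W"
    by (rule zx_eq_trans[OF e1 zx_eq_trans[OF e2 e3]]) simp
qed

section \<open>Unfolding the spider-nest maps\<close>

text \<open>Sets stand for vectors over F_2 and \<open>sym_diff\<close> for their sum. The points of
  the affine cube are counted with multiplicity, which matters for dependent or zero
  directions.\<close>

primrec cube :: "nat \<Rightarrow> nat set \<Rightarrow> (nat \<Rightarrow> nat set) \<Rightarrow> nat set multiset"
  where
    "cube 0 s u = {#s#}"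
  | "cube (Suc n) s u = cube n s u + cube n (sym_diff s (u n)) u"

lemma cube_cong: "(\<And>j. j < n \<Longrightarrow> u j = u' j) \<Longrightarrow> cube n s u = cube n s u'"
  by (induction n arbitrary: s) auto

definition vmap :: "(nat \<Rightarrow> nat) \<Rightarrow> vertex multiset \<Rightarrow> vertex multiset"
  where "vmap f = image_mset (map_prod id (image_mset f))"

definition T_gates :: "nat set \<Rightarrow> vertex multiset"
  where "T_gates L = image_mset (\<lambda>e. (Spider Z (angle (pi / 4)), {#e#})) (mset_set L)"

lemma vmap_comp: "vmap f (vmap g V) = vmap (\<lambda>w. f (g w)) V"
  by (simp add: vmap_def multiset.map_comp comp_def map_prod_def case_prod_unfold)

lemma ends_vmap: "ends (vmap f V) = image_mset f (ends V)"
  unfolding vmap_def by (induction V) auto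

lemma vmap_union [simp]: "vmap f (V + W) = vmap f V + vmap f W" "vmap f {#} = {#}"
  "vmap f (add_mset p W) = add_mset (fst p, image_mset f (snd p)) (vmap f W)"
  by (simp_all add: vmap_def map_prod_def case_prod_unfold)

lemma length_nest [simp]: "length (outs (nest n)) = n" "length (ins (nest n)) = 1"
  by (cases n; simp add: Let_def)+

definition nest_in :: "nat \<Rightarrow> nat"
  where "nest_in n = hd (ins (nest n))"

definition nest_out :: "nat \<Rightarrow> nat \<Rightarrow> nat"
  where "nest_out n j = outs (nest n) ! j"

lemma nest_io:
  "nest_in 0 = 0" "nest_in (Suc n) = 3" "nest_out (Suc n) n = 7" "j < n \<Longrightarrow> nest_out (Suc n) j = 4 * j + 2"
  by (simp_all add: nest_in_def nest_out_def Let_def nth_append)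

lemma nest_vertices:
  "vertices (nest 0) = {#(Spider Z (angle (pi / 4)), {#0#})#}"
  "vertices (nest (Suc n)) = vmap (\<lambda>w. 4 * w) (vertices (nest n)) + vmap (\<lambda>w. 4 * w + 1) (vertices (nest n)) +
    {#(Spider Z 0, {#3, 4 * nest_in n, 11#}), (Spider X 0, {#11, 4 * nest_in n + 1, 7#})#} +
    mset (map (\<lambda>j. (Spider Z 0, {#4 * nest_out n j, 4 * nest_out n j + 1, 4 * j + 2#})) [0..<n])"
proof -
  have "ins (nest n) \<noteq> []" by (metis length_nest(2) length_0_conv zero_neq_one)
  then show "vertices (nest (Suc n)) = vmap (\<lambda>w. 4 * w) (vertices (nest n)) + vmap (\<lambda>w. 4 * w + 1) (vertices (nest n)) +
    {#(Spider Z 0, {#3, 4 * nest_in n, 11#}), (Spider X 0, {#11, 4 * nest_in n + 1, 7#})#} +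
    mset (map (\<lambda>j. (Spider Z 0, {#4 * nest_out n j, 4 * nest_out n j + 1, 4 * j + 2#})) [0..<n])"
    using image_mset_cong[of "mset_set {0..<n}"
      "\<lambda>x. (Spider Z 0, {#map ((*) 4) (outs (nest n)) ! x, map (\<lambda>w. Suc (4 * w)) (outs (nest n)) ! x, Suc (Suc (4 * x))#})"
      "\<lambda>x. (Spider Z 0, {#4 * outs (nest n) ! x, Suc (4 * outs (nest n) ! x), Suc (Suc (4 * x))#})"]
    by (simp add: Let_def vmap_def rename_def nest_in_def nest_out_def hd_map)
qed simp

declare nest.simps(2) [simp del]

definition nest_bd :: "nat \<Rightarrow> nat set"
  where "nest_bd n = insert (nest_in n) (nest_out n ` {..<n})"

lemma nest_bd_ends: "nest_in n \<in># ends (vertices (nest n))" "j < n \<Longrightarrow> nest_out n j \<in># ends (vertices (nest n))"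
proof -
  show "nest_in n \<in># ends (vertices (nest n))"
    by (cases n) (auto simp: nest_io nest_vertices)
  assume j: "j < n"
  then obtain m where n: "n = Suc m" by (cases n) auto
  show "nest_out n j \<in># ends (vertices (nest n))"
  proof (cases "j = m")
    case True
    then show ?thesis by (simp add: n nest_io nest_vertices)
  next
    case False
    then have "j < m" using j n by simp
    then show ?thesis by (auto simp: n nest_io nest_vertices)
  qed
qed

lemma nest_out_inj: "inj_on (nest_out n) {..<n}"
proof (cases n)
  case (Suc m)
  have "4 * j + 2 \<noteq> (7::nat)" for j by presburger
  moreover have "nest_out n j = (if j < m then 4 * j + 2 else 7)" if "j < n" for j
    using that Suc by (auto simp: nest_io less_Suc_eq)
  ultimately show ?thesis by (auto simp: inj_on_def Suc less_Suc_eq split: if_splits)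
qed simp

lemma nest_in_out: "j < n \<Longrightarrow> nest_in n \<noteq> nest_out n j"
proof (cases n)
  case (Suc m)
  assume "j < n"
  moreover have "4 * j + 2 \<noteq> (3::nat)" for j by presburger
  moreover have "nest_out n j = (if j < m then 4 * j + 2 else 7)" if "j < n" for j
    using that Suc by (auto simp: nest_io less_Suc_eq)
  ultimately show ?thesis by (auto simp: Suc nest_io)
qed simp

text \<open>A wire joining two pieces of the fragment has both ends inside it, so it is not
  open.\<close>

lemma admissible_notin:
  assumes "admissible A W" "ends W = K + L + M" "e \<in># K" "e \<in># L"
  shows "e \<notin> A"
proof -
  have "1 \<le> count K e" "1 \<le> count L e" using assms(3,4) by simp_all
  then have "count (ends W) e \<noteq> 1" unfolding assms(2) count_union by linarith
  then show ?thesis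
    using admissible_count[OF assms(1), of e] by auto
qed

text \<open>Entered from the output side, the spiders that merge the outputs of the two nest copies
  act as copiers: the vector on \<open>c j\<close> is handed to both \<open>a j\<close> and
  \<open>b j\<close>.\<close>

lemma sys_spread_merges:
  assumes "admissible A (mset (map (\<lambda>j. (Spider Z 0, {#a j, b j, c j#})) [0..<n]) + W)"
    and "c ` {..<n} \<subseteq> A" "inj_on a {..<n}" "inj_on b {..<n}" "inj_on c {..<n}"
    and "a ` {..<n} \<inter> A = {}" "b ` {..<n} \<inter> A = {}" "a ` {..<n} \<inter> b ` {..<n} = {}"
  shows "\<exists>v'. (\<forall>j<n. v' (a j) = v (c j) \<and> v' (b j) = v (c j)) \<and> (\<forall>e\<in>A - c ` {..<n}. v' e = v e) \<and>
    admissible (A - c ` {..<n} \<union> a ` {..<n} \<union> b ` {..<n}) W \<and>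
    sys N A v (mset (map (\<lambda>j. (Spider Z 0, {#a j, b j, c j#})) [0..<n]) + W) \<approx>
    sys N (A - c ` {..<n} \<union> a ` {..<n} \<union> b ` {..<n}) v' W"
  using assms
proof (induction n arbitrary: A v)
  case 0
  then show ?case by (auto intro!: exI[of _ v] zx_eq_refl well_formed_sys)
next
  case (Suc n)
  let ?M = "mset (map (\<lambda>j. (Spider Z 0, {#a j, b j, c j#})) [0..<n]) + W"
  let ?A = "A - {c n} \<union> set [a n, b n]"
  let ?v = "\<lambda>x. if x \<in> set [a n, b n] then v (c n) else v x"
  have eq: "mset (map (\<lambda>j. (Spider Z 0, {#a j, b j, c j#})) [0..<Suc n]) + W =
      add_mset (Spider Z 0, mset (c n # [a n, b n])) ?M"
    by (simp add: add_mset_commute)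
  have p: "admissible A (add_mset (Spider Z 0, mset (c n # [a n, b n])) ?M)"
    using Suc.prems(1) unfolding eq .
  have p': "c n \<in> A" "distinct [a n, b n]" "set [a n, b n] \<inter> A = {}"
    using Suc.prems(2,6-8) by auto
  note s = sys_spread(1)[OF p p'] sys_spread(2)[OF p p', where n = N and v = v]
  have lt: "{..<Suc n} = insert n {..<n}" by auto
  have nn: "a n \<notin> a ` {..<n}" "b n \<notin> b ` {..<n}" "c n \<notin> c ` {..<n}"
    using Suc.prems(3-5) by (auto simp: lt)
  have "\<exists>v'. (\<forall>j<n. v' (a j) = ?v (c j) \<and> v' (b j) = ?v (c j)) \<and> (\<forall>e\<in>?A - c ` {..<n}. v' e = ?v e) \<and>
    admissible (?A - c ` {..<n} \<union> a ` {..<n} \<union> b ` {..<n}) W \<and>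
    sys N ?A ?v ?M \<approx> sys N (?A - c ` {..<n} \<union> a ` {..<n} \<union> b ` {..<n}) v' W"
  proof (rule Suc.IH)
    show "admissible ?A ?M" by (rule s(1))
    show "c ` {..<n} \<subseteq> ?A" using Suc.prems(2) nn(3) unfolding lt by blast
    show "inj_on a {..<n}" "inj_on b {..<n}" "inj_on c {..<n}" using Suc.prems(3-5) by (auto simp: lt)
    show "a ` {..<n} \<inter> ?A = {}" "b ` {..<n} \<inter> ?A = {}" "a ` {..<n} \<inter> b ` {..<n} = {}"
      using Suc.prems(6-8) nn by (auto simp: lt)
  qed
  then obtain v' where v': "\<forall>j<n. v' (a j) = ?v (c j) \<and> v' (b j) = ?v (c j)" "\<forall>e\<in>?A - c ` {..<n}. v' e = ?v e"
    "admissible (?A - c ` {..<n} \<union> a ` {..<n} \<union> b ` {..<n}) W"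
    "sys N ?A ?v ?M \<approx> sys N (?A - c ` {..<n} \<union> a ` {..<n} \<union> b ` {..<n}) v' W" by blast
  have cA: "c j \<noteq> a n" "c j \<noteq> b n" if "j < Suc n" for j using that Suc.prems(2) p'(3) by auto
  have cA': "a n \<notin> c ` {..<n}" "b n \<notin> c ` {..<n}" using cA by (metis imageE lessThan_iff less_SucI)+
  have A: "?A - c ` {..<n} \<union> a ` {..<n} \<union> b ` {..<n} = A - c ` {..<Suc n} \<union> a ` {..<Suc n} \<union> b ` {..<Suc n}"
    using cA cA' by (auto simp: lt)
  have "v' (a j) = v (c j) \<and> v' (b j) = v (c j)" if "j < Suc n" for j
  proof (cases "j = n")
    case True
    have "a n \<in> ?A - c ` {..<n}" "b n \<in> ?A - c ` {..<n}" using cA' by auto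
    then show ?thesis using v'(2) True by simp
  next
    case False
    then show ?thesis using v'(1) cA[of j] that by auto
  qed
  moreover have "v' e = v e" if "e \<in> A - c ` {..<Suc n}" for e
  proof -
    have "e \<in> ?A - c ` {..<n}" "e \<notin> set [a n, b n]" using that p'(3) by (auto simp: lt)
    then show ?thesis using v'(2) by simp
  qed
  moreover have "sys N A v (mset (map (\<lambda>j. (Spider Z 0, {#a j, b j, c j#})) [0..<Suc n]) + W) \<approx>
      sys N (A - c ` {..<Suc n} \<union> a ` {..<Suc n} \<union> b ` {..<Suc n}) v' W"
    using zx_eq_trans[OF s(2) v'(4)] unfolding A eq .
  ultimately show ?case using v'(3) unfolding A by blast
qed

text \<open>The recursion of the nest is that of \<open>cube\<close>: the Z-spider duplicates the
  base vector, the X-spider shifts the second duplicate by the vector on the last output, and the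
  merging spiders hand the remaining directions to both copies. The renaming \<open>f\<close> and
  the context \<open>W\<close> are arbitrary so that each copy can be unfolded beside the
  other.\<close>

lemma nest_unfold:
  assumes "inj f" and "admissible A (vmap f (vertices (nest n)) + W)" and "f ` nest_bd n \<subseteq> A"
  shows "\<exists>L v'. finite L \<and> L \<inter> (A - f ` nest_bd n) = {} \<and> (\<forall>e \<in> A - f ` nest_bd n. v' e = v e) \<and>
    image_mset v' (mset_set L) = cube n (v (f (nest_in n))) (\<lambda>j. v (f (nest_out n j))) \<and>
    admissible (A - f ` nest_bd n \<union> L) (T_gates L + W) \<and>
    sys N A v (vmap f (vertices (nest n)) + W) \<approx> sys N (A - f ` nest_bd n \<union> L) v' (T_gates L + W)"
  using assms
proof (induction n arbitrary: f A v W)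
  case 0
  have "A - f ` nest_bd 0 \<union> {f 0} = A" using 0 by (auto simp: nest_bd_def nest_io)
  moreover have "vmap f (vertices (nest 0)) = T_gates {f 0}" by (simp add: T_gates_def)
  ultimately show ?case
    using 0 by (intro exI[of _ "{f 0}"] exI[of _ v])
      (auto simp: nest_bd_def nest_io intro!: zx_eq_refl well_formed_sys)
next
  case (Suc n)
  define p where "p w = f (4 * w)" for w
  define q where "q w = f (4 * w + 1)" for w
  note f = inj_eq[OF Suc.prems(1)]
  have pq: "inj p" "inj q" "p x \<noteq> q y" "p x \<noteq> f 11" "q y \<noteq> f 11" for x y
  proof -
    show "inj p" "inj q" by (auto simp: inj_def p_def q_def f)
    show "p x \<noteq> q y" "p x \<noteq> f 11" "q y \<noteq> f 11" unfolding p_def q_def f by presburger+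
  qed
  let ?VA = "vmap p (vertices (nest n))" and ?VB = "vmap q (vertices (nest n))"
  define a b c where "a j = p (nest_out n j)" and "b j = q (nest_out n j)" and "c j = f (4 * j + 2)" for j
  define a0 b0 where "a0 = p (nest_in n)" and "b0 = q (nest_in n)"
  let ?M = "mset (map (\<lambda>j. (Spider Z 0, {#a j, b j, c j#})) [0..<n])"
  have dec: "vmap f (vertices (nest (Suc n))) + W = add_mset (Spider Z 0, mset (f 3 # [a0, f 11]))
      (add_mset (Spider X 0, {#f 11, f 7, b0#}) (?M + (?VA + (?VB + W))))"
  proof -
    have "vmap f (mset (map (\<lambda>j. (Spider Z 0, {#4 * nest_out n j, 4 * nest_out n j + 1, 4 * j + 2#})) [0..<n])) = ?M"
      by (simp add: vmap_def multiset.map_comp comp_def a_def b_def c_def p_def q_def)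
    then show ?thesis
      unfolding nest_vertices vmap_union vmap_comp
      by (simp add: p_def[abs_def] q_def[abs_def] a0_def b0_def add_mset_commute ac_simps)
  qed
  have adm: "admissible A (add_mset (Spider Z 0, mset (f 3 # [a0, f 11]))
      (add_mset (Spider X 0, {#f 11, f 7, b0#}) (?M + (?VA + (?VB + W)))))"
    using Suc.prems(2) unfolding dec .
  have m: "a0 \<in># ends ?VA" "b0 \<in># ends ?VB" "j < n \<Longrightarrow> a j \<in># ends ?VA" "j < n \<Longrightarrow> b j \<in># ends ?VB" for j
    unfolding ends_vmap a0_def b0_def a_def b_def
    by (auto simp only: set_image_mset intro!: imageI nest_bd_ends)
  have mM: "a j \<in># ends ?M" "b j \<in># ends ?M" if "j < n" for j
    using that by (auto intro!: bexI[of _ j])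
  \<comment> \<open>These wires join pieces of the nest and so have both ends inside; hence they are
    free to become new parities.\<close>
  have notA: "a0 \<notin> A" "b0 \<notin> A" "f 11 \<notin> A" "j < n \<Longrightarrow> a j \<notin> A" "j < n \<Longrightarrow> b j \<notin> A" for j
  proof -
    show "a0 \<notin> A"
      by (rule admissible_notin[OF adm, of "{#f 3, a0, f 11#}" "ends ?VA" "{#f 11, f 7, b0#} + ends ?M + ends ?VB + ends W"])
        (use m in auto)
    show "b0 \<notin> A"
      by (rule admissible_notin[OF adm, of "{#f 11, f 7, b0#}" "ends ?VB" "{#f 3, a0, f 11#} + ends ?M + ends ?VA + ends W"])
        (use m in auto)
    show "f 11 \<notin> A"
      by (rule admissible_notin[OF adm, of "{#f 3, a0, f 11#}" "{#f 11, f 7, b0#}" "ends ?M + ends ?VA + ends ?VB + ends W"])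
        auto
    show "a j \<notin> A" if "j < n"
      by (rule admissible_notin[OF adm, of "ends ?M" "ends ?VA" "{#f 11, f 7, b0#} + {#f 3, a0, f 11#} + ends ?VB + ends W"])
        (use m mM that in \<open>auto simp del: mset_map\<close>)
    show "b j \<notin> A" if "j < n"
      by (rule admissible_notin[OF adm, of "ends ?M" "ends ?VB" "{#f 11, f 7, b0#} + {#f 3, a0, f 11#} + ends ?VA + ends W"])
        (use m mM that in \<open>auto simp del: mset_map\<close>)
  qed
  define B where "B = f ` nest_bd (Suc n)"
  have B: "B = {f 3, f 7} \<union> c ` {..<n}"
  proof -
    have "{..<Suc n} = insert n {..<n}" by auto
    then show ?thesis
      by (auto simp: B_def nest_bd_def nest_io c_def image_iff)
  qed
  have BA: "f 3 \<in> A" "f 7 \<in> A" "c ` {..<n} \<subseteq> A" using Suc.prems(3) unfolding B_def[symmetric] B by auto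
  have inj: "inj_on a {..<n}" "inj_on b {..<n}" "inj_on c {..<n}"
    by (auto intro!: inj_onI dest: inj_onD[OF nest_out_inj] simp: a_def b_def c_def f inj_eq[OF pq(1)] inj_eq[OF pq(2)])
  have ne: "a0 \<noteq> a j" "a0 \<noteq> b j" "b0 \<noteq> a j" "b0 \<noteq> b j" "a j \<noteq> b k" "f 11 \<noteq> a j" "f 11 \<noteq> b j" "a0 \<noteq> b0" "a0 \<noteq> f 11" "b0 \<noteq> f 11"
    if "j < n" for j k
    by (simp_all add: a0_def b0_def a_def b_def nest_in_out[OF that] pq(3,4,5) pq(3,4,5)[symmetric]
      inj_eq[OF pq(1)] inj_eq[OF pq(2)])
  have na: "f 11 \<notin> a ` {..<n}" "f 11 \<notin> b ` {..<n}" "a0 \<notin> a ` {..<n}" "a0 \<notin> b ` {..<n}"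
    "b0 \<notin> a ` {..<n}" "b0 \<notin> b ` {..<n}"
    using ne(1,2,3,4,6,7) by blast+
  have ne0: "a0 \<noteq> b0" "a0 \<noteq> f 11" "b0 \<noteq> f 11" by (simp_all add: a0_def b0_def pq(3,4,5))
  have fc: "f 3 \<noteq> f 7" "f 3 \<noteq> c j" "f 7 \<noteq> c j" "f 11 \<noteq> f 7" for j unfolding c_def f by presburger+
  \<comment> \<open>The input spider puts the base vector on \<open>a0\<close>, where the first copy
    reads it, and on \<open>f 11\<close>, which leads to the X-spider.\<close>
  define A1 where "A1 = A - {f 3} \<union> set [a0, f 11]"
  define v1 where "v1 = (\<lambda>x. if x \<in> set [a0, f 11] then v (f 3) else v x)"
  have "distinct [a0, f 11]" "set [a0, f 11] \<inter> A = {}" using notA ne0 by auto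
  note s1 = sys_spread(1)[OF adm BA(1) this, folded A1_def]
    sys_spread(2)[OF adm BA(1) this, where n = N and v = v, folded A1_def v1_def]
  have comm: "add_mset (Spider X 0, {#f 11, f 7, b0#}) (?M + (?VA + (?VB + W))) = ?M + add_mset (Spider X 0, {#f 11, f 7, b0#}) (?VA + (?VB + W))"
    by simp
  define A2 where "A2 = A1 - c ` {..<n} \<union> a ` {..<n} \<union> b ` {..<n}"
  have "\<exists>v'. (\<forall>j<n. v' (a j) = v1 (c j) \<and> v' (b j) = v1 (c j)) \<and> (\<forall>e\<in>A1 - c ` {..<n}. v' e = v1 e) \<and>
    admissible (A1 - c ` {..<n} \<union> a ` {..<n} \<union> b ` {..<n}) (add_mset (Spider X 0, {#f 11, f 7, b0#}) (?VA + (?VB + W))) \<and>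
    sys N A1 v1 (?M + add_mset (Spider X 0, {#f 11, f 7, b0#}) (?VA + (?VB + W))) \<approx>
    sys N (A1 - c ` {..<n} \<union> a ` {..<n} \<union> b ` {..<n}) v' (add_mset (Spider X 0, {#f 11, f 7, b0#}) (?VA + (?VB + W)))"
  proof (rule sys_spread_merges)
    show "admissible A1 (?M + add_mset (Spider X 0, {#f 11, f 7, b0#}) (?VA + (?VB + W)))"
      using s1(1) unfolding comm .
    show "c ` {..<n} \<subseteq> A1" using BA fc(2)[symmetric] by (auto simp: A1_def)
    show "a ` {..<n} \<inter> A1 = {}" "b ` {..<n} \<inter> A1 = {}" "a ` {..<n} \<inter> b ` {..<n} = {}"
      using notA ne(5) na by (auto simp: A1_def)
  qed (rule inj)+
  then obtain v2 where v2: "\<forall>j<n. v2 (a j) = v1 (c j) \<and> v2 (b j) = v1 (c j)" "\<forall>e\<in>A1 - c ` {..<n}. v2 e = v1 e"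
    and a2: "admissible A2 (add_mset (Spider X 0, {#f 11, f 7, b0#}) (?VA + (?VB + W)))"
    and s2: "sys N A1 v1 (?M + add_mset (Spider X 0, {#f 11, f 7, b0#}) (?VA + (?VB + W))) \<approx>
      sys N A2 v2 (add_mset (Spider X 0, {#f 11, f 7, b0#}) (?VA + (?VB + W)))"
    unfolding A2_def by blast
  \<comment> \<open>The X-spider adds the last direction, on \<open>f 7\<close>, to the duplicate of
    the base vector; the second copy reads the sum on \<open>b0\<close>.\<close>
  define A3 where "A3 = insert b0 (A2 - {f 11, f 7})"
  define v3 where "v3 = v2(b0 := sym_diff (v2 (f 11)) (v2 (f 7)))"
  have f7: "f 7 \<noteq> a0" "f 7 \<noteq> f 11" using notA BA by auto
  have nc: "f 11 \<notin> c ` {..<n}" "f 7 \<notin> c ` {..<n}" "a0 \<notin> c ` {..<n}"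
    using notA(1,3) BA(3) fc(3) by blast+
  have "f 11 \<in> A2" "f 7 \<in> A2" "f 11 \<noteq> f 7" "b0 \<notin> A2"
    using nc BA fc(1)[symmetric] fc(4) notA na ne0 by (auto simp: A2_def A1_def)
  note s3 = sys_add(1)[OF a2 this, folded A3_def]
    sys_add(2)[OF a2 this, where n = N and v = v2, folded A3_def v3_def]
  define BP where "BP = p ` nest_bd n"
  define BQ where "BQ = q ` nest_bd n"
  have bp: "BP = insert a0 (a ` {..<n})" "BQ = insert b0 (b ` {..<n})"
    by (auto simp: BP_def BQ_def nest_bd_def a0_def b0_def a_def b_def)
  have PQ: "BP \<inter> BQ = {}" using pq(3) by (auto simp: BP_def BQ_def)
  have A3: "A3 = (A - B) \<union> BP \<union> BQ"
    using notA na ne0 fc nc f7 BA unfolding A3_def A2_def A1_def bp B by auto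
  have disj: "A \<inter> BP = {}" "A \<inter> BQ = {}" unfolding bp using notA by auto
  have v3v: "v3 e = v e" if "e \<in> A - B" for e
  proof -
    have "e \<in> A1 - c ` {..<n}" "e \<noteq> b0" "e \<notin> set [a0, f 11]"
      using that notA by (auto simp: A1_def B)
    then show ?thesis using v2(2) by (simp add: v3_def v1_def)
  qed
  have v3a: "v3 a0 = v (f 3)" "v3 b0 = sym_diff (v (f 3)) (v (f 7))"
  proof -
    have i: "a0 \<in> A1 - c ` {..<n}" "f 11 \<in> A1 - c ` {..<n}" "f 7 \<in> A1 - c ` {..<n}"
      using nc BA fc(1)[symmetric] by (auto simp: A1_def)
    show "v3 a0 = v (f 3)" using v2(2) i ne0 by (simp add: v3_def v1_def)
    show "v3 b0 = sym_diff (v (f 3)) (v (f 7))" using v2(2) i f7 by (simp add: v3_def v1_def)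
  qed
  have v3j: "v3 (a j) = v (c j)" "v3 (b j) = v (c j)" if "j < n" for j
  proof -
    have "c j \<notin> set [a0, f 11]" using BA that notA by auto
    then have "v1 (c j) = v (c j)" by (simp add: v1_def)
    then show "v3 (a j) = v (c j)" "v3 (b j) = v (c j)" using v2(1) that ne(3,4)[OF that] by (simp_all add: v3_def)
  qed
  have ext: "nest_out (Suc n) j = 4 * j + 2" if "j < n" for j using that by (simp add: nest_io)
  \<comment> \<open>The first copy is unfolded while the second still belongs to the context; its
    gates then join the context of the second. Names in \<open>L1\<close> avoid the boundary
    \<open>BQ\<close> of the second copy because that boundary is open at this point.\<close>
  obtain L1 v4 where 4: "finite L1" "L1 \<inter> (A3 - BP) = {}" "\<forall>e \<in> A3 - BP. v4 e = v3 e"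
    "image_mset v4 (mset_set L1) = cube n (v3 a0) (\<lambda>j. v3 (a j))"
    "admissible (A3 - BP \<union> L1) (T_gates L1 + (?VB + W))"
    "sys N A3 v3 (?VA + (?VB + W)) \<approx> sys N (A3 - BP \<union> L1) v4 (T_gates L1 + (?VB + W))"
    using Suc.IH[OF pq(1) s3(1), of v3] A3 unfolding BP_def[symmetric] a0_def[symmetric] a_def[symmetric] by blast
  have eqB: "T_gates L1 + (?VB + W) = ?VB + (T_gates L1 + W)" by (simp add: ac_simps)
  define A4 where "A4 = A3 - BP \<union> L1"
  have BQ4: "BQ \<subseteq> A4" using A3 PQ by (auto simp: A4_def)
  obtain L2 v5 where 5: "finite L2" "L2 \<inter> (A4 - BQ) = {}" "\<forall>e \<in> A4 - BQ. v5 e = v4 e"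
    "image_mset v5 (mset_set L2) = cube n (v4 b0) (\<lambda>j. v4 (b j))"
    "admissible (A4 - BQ \<union> L2) (T_gates L2 + (T_gates L1 + W))"
    "sys N A4 v4 (?VB + (T_gates L1 + W)) \<approx> sys N (A4 - BQ \<union> L2) v5 (T_gates L2 + (T_gates L1 + W))"
    using Suc.IH[OF pq(2) 4(5)[unfolded eqB], of v4] BQ4
    unfolding A4_def[symmetric] BQ_def[symmetric] b0_def[symmetric] b_def[symmetric] by blast
  have L1BQ: "L1 \<inter> BQ = {}" using 4(2) A3 PQ by auto
  have L1A4: "L1 \<subseteq> A4 - BQ" using L1BQ by (auto simp: A4_def)
  have L12: "L1 \<inter> L2 = {}" using 5(2) L1A4 by auto
  have A5: "A4 - BQ \<union> L2 = (A - B) \<union> (L2 \<union> L1)"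
    using disj L1BQ unfolding A4_def A3 by auto
  have AB4: "A - B \<subseteq> A4 - BQ" "A - B \<subseteq> A3 - BP" using disj by (auto simp: A4_def A3)
  have T: "T_gates L2 + (T_gates L1 + W) = T_gates (L2 \<union> L1) + W"
    using 4(1) 5(1) L12 by (simp add: T_gates_def mset_set_Union Int_commute)
  have v45: "v4 b0 = v3 b0" "j < n \<Longrightarrow> v4 (b j) = v3 (b j)" for j
    using 4(3) A3 PQ bp(2) by auto
  have img: "image_mset v5 (mset_set (L2 \<union> L1)) = cube (Suc n) (v (f 3)) (\<lambda>j. v (f (nest_out (Suc n) j)))"
  proof -
    have "image_mset v5 (mset_set L1) = image_mset v4 (mset_set L1)"
      using 5(3) L1A4 4(1) by (intro image_mset_cong) auto
    also have "\<dots> = cube n (v (f 3)) (\<lambda>j. v (f (nest_out (Suc n) j)))"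
      unfolding 4(4) v3a by (rule cube_cong) (simp add: v3j ext c_def)
    finally have 1: "image_mset v5 (mset_set L1) = cube n (v (f 3)) (\<lambda>j. v (f (nest_out (Suc n) j)))" .
    have 2: "image_mset v5 (mset_set L2) = cube n (sym_diff (v (f 3)) (v (f 7))) (\<lambda>j. v (f (nest_out (Suc n) j)))"
      unfolding 5(4) v45 v3a by (rule cube_cong) (simp add: v45 v3j ext c_def)
    show ?thesis
      using 4(1) 5(1) L12 1 2 by (simp add: mset_set_Union Int_commute nest_io add.commute)
  qed
  have "sys N A v (vmap f (vertices (nest (Suc n))) + W) \<approx> sys N A1 v1 (?M + add_mset (Spider X 0, {#f 11, f 7, b0#}) (?VA + (?VB + W)))"
    using s1(2) unfolding dec comm .
  also note s2
  also note s3(2)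
  also note 4(6)[folded A4_def, unfolded eqB]
  also note 5(6)[unfolded A5 T]
  finally have fin: "sys N A v (vmap f (vertices (nest (Suc n))) + W) \<approx> sys N ((A - B) \<union> (L2 \<union> L1)) v5 (T_gates (L2 \<union> L1) + W)" .
  show ?case
    unfolding B_def[symmetric] nest_io
  proof (intro exI conjI ballI)
    show "finite (L2 \<union> L1)" using 4(1) 5(1) by simp
    show "(L2 \<union> L1) \<inter> (A - B) = {}" using 5(2) 4(2) AB4 by auto
    show "v5 e = v e" if "e \<in> A - B" for e
    proof -
      have "e \<in> A4 - BQ" "e \<in> A3 - BP" using AB4 that by blast+
      then show ?thesis using 5(3) 4(3) v3v[OF that] by simp
    qed
    show "admissible (A - B \<union> (L2 \<union> L1)) (T_gates (L2 \<union> L1) + W)" using 5(5) unfolding A5 T .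
  qed (rule img fin)+
qed

section \<open>Wires of the spider nests\<close>

primrec nest_wires :: "nat \<Rightarrow> nat set"
  where
    "nest_wires 0 = {0}"
  | "nest_wires (Suc n) = (\<lambda>w. 4 * w) ` nest_wires n \<union> (\<lambda>w. 4 * w + 1) ` nest_wires n \<union> (\<lambda>j. 4 * j + 2) ` {..<n} \<union> {3, 7, 11}"

lemma finite_nest_wires [simp]: "finite (nest_wires n)"
  by (induction n) auto

lemma nest_ins_outs: "ins (nest n) = [nest_in n]" "outs (nest n) = map (nest_out n) [0..<n]"
proof -
  show "ins (nest n) = [nest_in n]"
    unfolding nest_in_def by (cases "ins (nest n)") (use length_nest(2)[of n] in auto)
  show "outs (nest n) = map (nest_out n) [0..<n]"
    unfolding nest_out_def by (rule nth_equalityI) auto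
qed

text \<open>The wire sets of the two copies and the new wires lie in different residue classes
  modulo 4. The boundary ends of the copies, counted in their own \<open>wire_ends\<close>, reappear
  as legs of the merging spiders and of the two spiders near the input.\<close>

lemma wire_ends_nest: "wire_ends (nest n) = mset_set (nest_wires n) + mset_set (nest_wires n)"
proof (induction n)
  case 0
  then show ?case by simp
next
  case (Suc n)
  let ?E = "ends (vertices (nest n))" and ?o = "image_mset (nest_out n) (mset_set {..<n})"
  have we: "wire_ends (nest m) = ends (vertices (nest m)) + {#nest_in m#} + image_mset (nest_out m) (mset_set {..<m})" for m
    by (simp add: wire_ends_def nest_ins_outs atLeast0LessThan)
  have o: "image_mset (nest_out (Suc n)) (mset_set {..<Suc n}) = add_mset 7 (image_mset (\<lambda>j. 4 * j + 2) (mset_set {..<n}))"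
  proof -
    have "{..<Suc n} = insert n {..<n}" by auto
    moreover have "image_mset (nest_out (Suc n)) (mset_set {..<n}) = image_mset (\<lambda>j. 4 * j + 2) (mset_set {..<n})"
      by (intro image_mset_cong) (simp add: nest_io)
    ultimately show ?thesis by (simp add: nest_io)
  qed
  have merges: "ends (mset (map (\<lambda>j. (Spider Z 0, {#4 * nest_out n j, 4 * nest_out n j + 1, 4 * j + 2#})) [0..<k])) =
    image_mset (\<lambda>w. 4 * w) (image_mset (nest_out n) (mset_set {..<k})) +
    image_mset (\<lambda>w. 4 * w + 1) (image_mset (nest_out n) (mset_set {..<k})) + image_mset (\<lambda>j. 4 * j + 2) (mset_set {..<k})" for k
    by (induction k) (auto simp: lessThan_Suc)
  have "wire_ends (nest (Suc n)) = image_mset (\<lambda>w. 4 * w) (wire_ends (nest n)) + image_mset (\<lambda>w. 4 * w + 1) (wire_ends (nest n)) +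
    ({#3, 7, 11#} + image_mset (\<lambda>j. 4 * j + 2) (mset_set {..<n})) + ({#3, 7, 11#} + image_mset (\<lambda>j. 4 * j + 2) (mset_set {..<n}))"
    unfolding we o nest_vertices image_mset_union sum_mset.union merges ends_vmap
    by (simp add: nest_io add_mset_commute)
  moreover have "mset_set (nest_wires (Suc n)) = image_mset (\<lambda>w. 4 * w) (mset_set (nest_wires n)) +
    image_mset (\<lambda>w. 4 * w + 1) (mset_set (nest_wires n)) + image_mset (\<lambda>j. 4 * j + 2) (mset_set {..<n}) + {#3, 7, 11#}"
  proof -
    have "4 * x \<noteq> 4 * y + (1::nat)" "4 * x \<noteq> 4 * y + (2::nat)" "4 * x + 1 \<noteq> 4 * y + (2::nat)"
      "4 * x \<notin> {3, 7, 11::nat}" "4 * x + 1 \<notin> {3, 7, 11::nat}" "4 * x + 2 \<notin> {3, 7, 11::nat}" for x y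
      by (auto, presburger+)
    then have d: "(\<lambda>w. 4 * w) ` nest_wires n \<inter> (\<lambda>w. 4 * w + 1) ` nest_wires n = {}"
      "((\<lambda>w. 4 * w) ` nest_wires n \<union> (\<lambda>w. 4 * w + 1) ` nest_wires n) \<inter> (\<lambda>j. 4 * j + 2) ` {..<n} = {}"
      "((\<lambda>w. 4 * w) ` nest_wires n \<union> (\<lambda>w. 4 * w + 1) ` nest_wires n \<union> (\<lambda>j. 4 * j + 2) ` {..<n}) \<inter> {3, 7, 11} = {}"
      by blast+
    have "mset_set {3, 7, 11::nat} = {#3, 7, 11#}" by simp
    then show ?thesis
      unfolding nest_wires.simps using d
      by (simp only: mset_set_Union finite_UnI finite_imageI finite_nest_wires finite_lessThan finite.emptyI finite_insert)
        (simp add: image_mset_mset_set inj_on_def)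
  qed
  ultimately show ?case unfolding Suc.IH by (simp add: ac_simps)
qed

lemma well_formed_nest: "well_formed (nest n)"
proof (rule well_formed_double[OF wire_ends_nest])
  show "count (mset_set (nest_wires n)) w \<le> 1" for w by (simp add: count_mset_set')
  show "(Hadamard, legs) \<notin># vertices (nest n)" for legs
    by (induction n arbitrary: legs) (auto simp: nest_vertices vmap_def)
qed

definition Z_units :: "nat set \<Rightarrow> vertex multiset"
  where "Z_units D = image_mset (\<lambda>e. (Spider Z 0, {#e#})) (mset_set D)"

lemma ends_Z_units: "finite D \<Longrightarrow> ends (Z_units D) = mset_set D"
  unfolding Z_units_def by (induction D rule: finite_induct) auto

text \<open>A one-legged phase-0 Z-spider on a parity wire discards it. Read backwards, this
  introduces new parities with arbitrary vectors.\<close>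

lemma sys_discard:
  assumes "finite D" "D \<inter> A = {}" "admissible (A \<union> D) (Z_units D + W)"
  shows "admissible A W \<and> sys N (A \<union> D) v (Z_units D + W) \<approx> sys N A v W"
  using assms
proof (induction D rule: finite_induct)
  case empty
  then show ?case by (simp add: Z_units_def zx_eq_refl well_formed_sys)
next
  case (insert e D)
  have eq: "Z_units (insert e D) + W = add_mset (Spider Z 0, mset (e # [])) (Z_units D + W)"
    using insert.hyps by (simp add: Z_units_def)
  have 1: "admissible (A \<union> insert e D) (add_mset (Spider Z 0, mset (e # [])) (Z_units D + W))"
    using insert.prems(2) unfolding eq .
  have A: "A \<union> insert e D - {e} \<union> set [] = A \<union> D" using insert.hyps insert.prems by auto
  have p: "e \<in> A \<union> insert e D" "distinct []" "set [] \<inter> (A \<union> insert e D) = {}" by auto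
  have "admissible (A \<union> D) (Z_units D + W)" "sys N (A \<union> insert e D) v (Z_units (insert e D) + W) \<approx> sys N (A \<union> D) v (Z_units D + W)"
    using sys_spread(1)[OF 1 p] sys_spread(2)[OF 1 p, where n = N and v = v] unfolding A eq by simp_all
  then show ?case using insert.IH insert.prems(1) by (auto intro: zx_eq_trans)
qed

lemma nest_io_4: "nest_in 4 = 3" "nest_out 4 0 = 2" "nest_out 4 1 = 6" "nest_out 4 2 = 10" "nest_out 4 3 = 7"
  "{..<4::nat} = {0, 1, 2, 3}" "[0..<4::nat] = [0, 1, 2, 3]"
  using nest_io(2)[of 3] nest_io(3)[of 3] nest_io(4)[of 0 3] nest_io(4)[of 1 3] nest_io(4)[of 2 3]
  by (simp_all add: upt_rec) auto

text \<open>S4 with all five legs bent to one side, in the wire names of \<open>nest 4\<close>: 3 is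
  the input, followed by the four outputs.\<close>

lemma nest_4_trivial: "Diagram (vertices (nest 4)) [] [3, 2, 6, 10, 7] \<approx> Diagram (Z_units {3, 2, 6, 10, 7}) [] [3, 2, 6, 10, 7]"
proof -
  have io: "ins (nest 4) = [3]" "outs (nest 4) = [2, 6, 10, 7]"
    by (simp_all add: nest_ins_outs nest_io_4 nest_io_4(3)[simplified])
  let ?R = "Diagram {#(Spider Z 0, {#0#}), (Spider Z 0, {#1#}), (Spider Z 0, {#2#}), (Spider Z 0, {#3#}), (Spider Z 0, {#4#})#} [0] [1, 2, 3, 4]"
  have N: "nest 4 = Diagram (vertices (nest 4)) [3] [2, 6, 10, 7]"
    by (metis diagram.collapse io)
  have wR: "well_formed ?R"
    by (rule well_formed_double[of _ "{#0, 1, 2, 3, 4#}"]) auto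
  have "nest 4 \<approx> ?R"
    unfolding zx_eq_def
  proof (intro conjI wR well_formed_nest transformable.apply_rule)
    show "sup clifford_rule S4_rule (nest 4) ?R" by (rule sup2I2, rule S4_rule.S4)
  qed
  also have "?R \<approx> rename (id(0 := 3, 1 := 2, 2 := 6, 3 := 10, 4 := 7)) ?R"
    by (rule zx_eq_rename[OF wR]) (auto simp: wires_Diagram inj_on_def)
  also have "rename (id(0 := 3, 1 := 2, 2 := 6, 3 := 10, 4 := 7)) ?R = Diagram (Z_units {3, 2, 6, 10, 7}) [3] [2, 6, 10, 7]"
    by (simp add: Z_units_def)
  finally have eq: "Diagram (vertices (nest 4)) [3] [2, 6, 10, 7] \<approx> Diagram (Z_units {3, 2, 6, 10, 7}) [3] [2, 6, 10, 7]"
    unfolding N[symmetric] .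
  have "transformable (sup clifford_rule S4_rule) (Diagram (vertices (nest 4)) [] ([3] @ [2, 6, 10, 7]))
    (Diagram (Z_units {3, 2, 6, 10, 7}) [] ([3] @ [2, 6, 10, 7]))"
    by (rule transformable_bend) (use eq in \<open>simp_all add: zx_eq_def\<close>)
  moreover have "well_formed (Diagram V [] (a @ b))" if "well_formed (Diagram V a b)" for V a b
    using that by (simp add: well_formed_count add.assoc)
  from this[OF zx_eq_wf(1)[OF eq]] this[OF zx_eq_wf(2)[OF eq]]
  have "well_formed (Diagram (vertices (nest 4)) [] ([3] @ [2, 6, 10, 7]))"
    "well_formed (Diagram (Z_units {3, 2, 6, 10, 7}) [] ([3] @ [2, 6, 10, 7]))" .
  ultimately show ?thesis unfolding zx_eq_def append.simps by blast
qed

lemma sys_cong: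
  assumes "\<And>e. e \<in> A \<Longrightarrow> v e = w e"
  shows "sys n A v W = sys n A w W"
proof -
  have "{e \<in> A. i \<in> v e} = {e \<in> A. i \<in> w e}" for i using assms by auto
  moreover have "(\<Sum>e\<in>A. {#parity (v e \<inter> {..<n}) e#}) = (\<Sum>e\<in>A. {#parity (w e \<inter> {..<n}) e#})"
    by (rule sum.cong) (simp_all add: assms)
  ultimately show ?thesis by (simp add: sys_def)
qed

text \<open>Create five parities \<open>s\<close>, \<open>u 0\<close>, ..., \<open>u 3\<close>
  ending in Z-units, replace the units by a nest with S4, and unfold the nest. Since discarding
  allows any vectors to be created, every cube is reached.\<close>

lemma sys_cube:
  assumes adm: "admissible A W"
  shows "\<exists>L v'. finite L \<and> L \<inter> A = {} \<and> (\<forall>e\<in>A. v' e = v e) \<and> image_mset v' (mset_set L) = cube 4 s u \<and>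
    admissible (A \<union> L) (T_gates L + W) \<and> sys N A v W \<approx> sys N (A \<union> L) v' (T_gates L + W)"
proof -
  have A: "finite A" using adm by (simp add: admissible_def)
  then have "finite (A \<union> set_mset (ends W))" by simp
  then obtain K where K: "\<forall>x \<in> A \<union> set_mset (ends W). x < K"
    using finite_nat_set_iff_bounded by blast
  \<comment> \<open>Shifting beyond all names in use makes the wires of the nest fresh.\<close>
  define f where "f w = K + w" for w
  have inj: "inj f" by (auto simp: inj_def f_def)
  have fr: "f w \<notin> A" "f w \<notin># ends W" for w using K by (auto simp: f_def)
  have bd: "nest_bd 4 = {3, 2, 6, 10, 7}"
    by (auto simp: nest_bd_def nest_io_4 nest_io_4(3)[simplified])
  define D where "D = f ` nest_bd 4"
  have D: "finite D" "D \<inter> A = {}" using fr by (auto simp: D_def bd)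
  have DZ: "vmap f (Z_units (nest_bd 4)) = Z_units D"
    unfolding D_def Z_units_def image_mset_mset_set[OF inj_on_subset[OF inj subset_UNIV], symmetric]
    by (simp add: vmap_def multiset.map_comp comp_def)
  have zW: "count (ends W) (f w) = 0" for w using fr(2) by (simp add: count_eq_zero_iff)
  have adm1: "admissible (A \<union> D) (Z_units D + W)"
    unfolding admissible_def
  proof (intro conjI allI)
    show "finite (A \<union> D)" using A D by simp
    show "(Hadamard, legs) \<notin># Z_units D + W" for legs
      using adm D by (auto simp: admissible_def Z_units_def)
    fix x
    have "count (ends (Z_units D + W)) x = (if x \<in> D then 1 else 0) + count (ends W) x"
      using D by (simp add: ends_Z_units count_mset_set')
    moreover have "count (ends W) x = 0" if "x \<in> D" using that zW by (auto simp: D_def)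
    ultimately show "if x \<in> A \<union> D then count (ends (Z_units D + W)) x = 1
      else count (ends (Z_units D + W)) x = 0 \<or> count (ends (Z_units D + W)) x = 2"
      using admissible_count[OF adm, of x] D(2) by auto
  qed
  have adm2: "admissible (A \<union> D) (vmap f (vertices (nest 4)) + W)"
    unfolding admissible_def
  proof (intro conjI allI)
    show "finite (A \<union> D)" using A D by simp
    have "(Hadamard, legs) \<notin># vertices (nest n)" for legs n
      by (induction n arbitrary: legs) (auto simp: nest_vertices vmap_def)
    then show "(Hadamard, legs) \<notin># vmap f (vertices (nest 4)) + W" for legs
      using adm by (auto simp: admissible_def vmap_def)
    fix x
    \<comment> \<open>A boundary wire has its second end at the input or an output of the nest,
      which is not counted among the vertices.\<close>
    have bdc: "count (ends (vertices (nest 4))) w = (if w \<in> nest_bd 4 then 1 else 0) \<or>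
      count (ends (vertices (nest 4))) w = 2 \<and> w \<notin> nest_bd 4" for w
    proof -
      have "ends (vertices (nest 4)) + mset_set (nest_bd 4) = wire_ends (nest 4)"
        unfolding wire_ends_def nest_ins_outs bd nest_io_4(7) by (simp add: nest_io_4 nest_io_4(3)[simplified])
      from arg_cong[OF this, of "\<lambda>M. count M w"]
      have "count (ends (vertices (nest 4))) w + (if w \<in> nest_bd 4 then 1 else 0) = (if w \<in> nest_wires 4 then 2 else 0)"
      proof -
        have "finite (nest_bd 4)" by (simp add: bd)
        then have "count (mset_set (nest_bd 4)) w = (if w \<in> nest_bd 4 then 1 else 0)"
          "count (mset_set (nest_wires 4)) w = (if w \<in> nest_wires 4 then 1 else 0)"
          by (simp_all add: count_mset_set')
        moreover assume "count (ends (vertices (nest 4)) + mset_set (nest_bd 4)) w = count (wire_ends (nest 4)) w"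
        ultimately show ?thesis unfolding wire_ends_nest count_union by simp
      qed
      then show ?thesis by (auto split: if_splits)
    qed
    show "if x \<in> A \<union> D then count (ends (vmap f (vertices (nest 4)) + W)) x = 1
      else count (ends (vmap f (vertices (nest 4)) + W)) x = 0 \<or> count (ends (vmap f (vertices (nest 4)) + W)) x = 2"
    proof (cases "x \<in> range f")
      case True
      then obtain w where w: "x = f w" by auto
      have "x \<in> D \<longleftrightarrow> w \<in> nest_bd 4" using inj by (auto simp: w D_def inj_def)
      moreover have "count (ends (vmap f (vertices (nest 4)) + W)) x = count (ends (vertices (nest 4))) w"
        unfolding image_mset_union sum_mset.union ends_vmap count_union w by (simp add: count_image_inj[OF inj] zW)
      ultimately show ?thesis using bdc[of w] fr(1)[of w] w by auto
    next
      case False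
      have "count (ends (vmap f (vertices (nest 4)) + W)) x = count (ends W) x"
        unfolding image_mset_union sum_mset.union ends_vmap count_union using False by (simp add: count_image_notin)
      moreover have "x \<notin> D" using False by (auto simp: D_def)
      ultimately show ?thesis
        using admissible_count[OF adm, of x] by auto
    qed
  qed
  \<comment> \<open>The base vector goes to the input wire 3 and the four directions to the output
    wires 2, 6, 10, 7 in this order.\<close>
  define w where "w x = (if x = f 3 then s else if x = f 2 then u 0 else if x = f 6 then u 1 else if x = f 10 then u 2
    else if x = f 7 then u 3 else v x)" for x
  have wA: "w e = v e" if "e \<in> A" for e using fr(1) that by (auto simp: w_def)
  have "sys N A v W = sys N A w W"
    by (rule sys_cong) (simp add: wA)
  also have "sys N A w W \<approx> sys N (A \<union> D) w (Z_units D + W)"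
    by (rule zx_eq_sym[OF conjunct2[OF sys_discard[OF D adm1]]])
  also have "\<dots> \<approx> sys N (A \<union> D) w (vmap f (vertices (nest 4)) + W)"
  proof (rule sys_ext_context)
    have "rename f (Diagram (Z_units {3, 2, 6, 10, 7}) [] [3, 2, 6, 10, 7]) \<approx> rename f (Diagram (vertices (nest 4)) [] [3, 2, 6, 10, 7])"
      by (rule zx_eq_rename_both[OF zx_eq_sym[OF nest_4_trivial]]) (rule inj_on_subset[OF inj subset_UNIV])+
    then show "Diagram (Z_units D) [] (map f [3, 2, 6, 10, 7]) \<approx> Diagram (vmap f (vertices (nest 4))) [] (map f [3, 2, 6, 10, 7])"
      unfolding DZ[symmetric] bd by (simp only: rename_Diagram list.map vmap_def)
    show "distinct (map f [3, 2, 6, 10, 7])" by (simp add: f_def)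
  qed (rule adm1, rule adm2)
  finally have 1: "sys N A v W \<approx> sys N (A \<union> D) w (vmap f (vertices (nest 4)) + W)" .
  have AD: "A \<union> D - f ` nest_bd 4 = A" using D(2) by (auto simp: D_def)
  have sub: "f ` nest_bd 4 \<subseteq> A \<union> D" by (auto simp: D_def)
  have c: "cube 4 (w (f (nest_in 4))) (\<lambda>j. w (f (nest_out 4 j))) = cube 4 s u"
  proof -
    have u: "w (f (nest_out 4 j)) = u j" if "j < 4" for j
    proof -
      have "j = 0 \<or> j = 1 \<or> j = 2 \<or> j = 3" using that by auto
      then show ?thesis by (auto simp: nest_io_4 nest_io_4(3)[simplified] w_def f_def)
    qed
    have "w (f (nest_in 4)) = s" by (simp add: nest_io_4 w_def)
    then show ?thesis by (simp only:) (rule cube_cong, rule u)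
  qed
  obtain L v' where L: "finite L" "L \<inter> A = {}" "\<forall>e\<in>A. v' e = w e" "image_mset v' (mset_set L) = cube 4 s u"
    "admissible (A \<union> L) (T_gates L + W)"
    "sys N (A \<union> D) w (vmap f (vertices (nest 4)) + W) \<approx> sys N (A \<union> L) v' (T_gates L + W)"
    using nest_unfold[OF inj adm2 sub, of w N, unfolded AD c] by (elim exE conjE) (rule that)
  show ?thesis
  proof (intro exI conjI ballI)
    show "v' e = v e" if "e \<in> A" for e using L(3) wA[OF that] that by simp
  qed (rule L zx_eq_trans[OF 1 L(6)])+
qed

section \<open>Phase gadgets modulo cubes\<close>

text \<open>The combinatorial shadow of the calculus on multisets of parity vectors. It separates
  the two halves of the argument: \<open>gadget_diagram_sound\<close> realises it by rewriting, and
  \<open>gadget_complete\<close> shows that it captures equality of phases.\<close>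

inductive gadget_eq :: "nat set multiset \<Rightarrow> nat set multiset \<Rightarrow> bool" (infix \<open>\<simeq>\<close> 50)
  where
    gadget_refl: "S \<simeq> S"
  | gadget_sym: "S \<simeq> T \<Longrightarrow> T \<simeq> S"
  | gadget_trans [trans]: "S \<simeq> T \<Longrightarrow> T \<simeq> U \<Longrightarrow> S \<simeq> U"
  | gadget_zero: "add_mset {} S \<simeq> S"
  | gadget_cube: "cube 4 s u + S \<simeq> S"

lemma gadget_add: "S \<simeq> T \<Longrightarrow> S + U \<simeq> T + U"
proof (induction rule: gadget_eq.induct)
  case (gadget_zero S)
  then show ?case using gadget_eq.gadget_zero[of "S + U"] by simp
next
  case (gadget_cube s u S)
  then show ?case using gadget_eq.gadget_cube[of s u "S + U"] by (simp add: ac_simps)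
qed (auto intro: gadget_eq.intros)

lemma gadget_add2: "S \<simeq> T \<Longrightarrow> S' \<simeq> T' \<Longrightarrow> S + S' \<simeq> T + T'"
  by (metis gadget_add gadget_trans add.commute)

lemma gadget_empty_sets: "(\<And>w. w \<in># S \<Longrightarrow> w = {}) \<Longrightarrow> S \<simeq> {#}"
proof (induction S)
  case (add w S)
  then have "w = {}" "S \<simeq> {#}" by auto
  then show ?case using gadget_zero gadget_trans by blast
qed (rule gadget_refl)

text \<open>Each zero direction adds the same points once more and so doubles all
  multiplicities.\<close>

lemma cube_pad: "cube (d + k) s (\<lambda>j. if j < d then u j else {}) = repeat_mset (2 ^ k) (cube d s u)"
proof (induction k)
  case 0
  show ?case by (simp, rule cube_cong, simp)
next
  case (Suc k)
  then show ?case by (simp add: left_add_mult_distrib_mset mult_2)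
qed

lemma gadget_cube_le: "d \<le> 4 \<Longrightarrow> repeat_mset (2 ^ (4 - d)) (cube d s u) \<simeq> {#}"
  using gadget_cube[of s "\<lambda>j. if j < d then u j else {}" "{#}"] cube_pad[of d "4 - d" s u] by simp

lemma in_repeat_mset: "v \<in># repeat_mset k S \<Longrightarrow> v \<in># S"
  by (induction k) auto

text \<open>The line {0, v} padded by three zero directions consists of eight copies of 0 and eight
  of v. This replaces subtraction: seven copies of a multiset act as its negative.\<close>

lemma gadget_eight: "repeat_mset 8 S \<simeq> {#}"
proof (induction S)
  case empty
  then show ?case by (simp add: gadget_refl)
next
  case (add v S)
  have "repeat_mset 8 (cube 1 {} (\<lambda>j. v)) \<simeq> {#}"
    using gadget_cube_le[of 1 "{}" "\<lambda>j. v"] by simp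
  moreover have "repeat_mset 8 (cube 1 {} (\<lambda>j. v)) = repeat_mset 8 {#{}#} + repeat_mset 8 {#v#}"
    by (rule multiset_eqI) simp
  ultimately have 1: "repeat_mset 8 {#{}#} + repeat_mset 8 {#v#} \<simeq> {#}" by (simp only:)
  have "repeat_mset 8 {#{}#} + repeat_mset 8 {#v#} \<simeq> {#} + repeat_mset 8 {#v#}"
    by (rule gadget_add, rule gadget_empty_sets) (auto dest: in_repeat_mset)
  then have "repeat_mset 8 {#v#} \<simeq> {#}"
    using gadget_trans[OF gadget_sym 1] by simp
  from gadget_add2[OF this add] show ?case by simp
qed

text \<open>The phase, in units of pi/4, that the gadgets \<open>S\<close> give to the basis state
  whose qubits in \<open>x\<close> are 1. Only its residue modulo 8 is visible.\<close>

definition parity_sum :: "nat set multiset \<Rightarrow> nat set \<Rightarrow> int"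
  where "parity_sum S x = (\<Sum>v\<in>#S. of_bool (odd (card (v \<inter> x))))"

lemma parity_sum_simps [simp]: "parity_sum {#} x = 0" "parity_sum (S + T) x = parity_sum S x + parity_sum T x"
  "parity_sum (add_mset v S) x = of_bool (odd (card (v \<inter> x))) + parity_sum S x"
  by (simp_all add: parity_sum_def)

lemma parity_sum_repeat: "parity_sum (repeat_mset k S) x = int k * parity_sum S x"
  by (induction k) (auto simp: algebra_simps)

lemma odd_card_sym_diff:
  assumes "finite x"
  shows "odd (card (sym_diff a b \<inter> x)) \<longleftrightarrow> odd (card (a \<inter> x)) \<noteq> odd (card (b \<inter> x))"
proof -
  let ?a = "a \<inter> x" and ?b = "b \<inter> x"
  have f: "finite ?a" "finite ?b" using assms by auto
  have 1: "card ?a = card (?a - ?b) + card (?a \<inter> ?b)"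
    using f by (metis card_Diff_subset_Int card_Int_Diff add.commute)
  have 2: "card ?b = card (?b - ?a) + card (?a \<inter> ?b)"
    using f by (metis card_Int_Diff add.commute Int_commute)
  have "sym_diff a b \<inter> x = (?a - ?b) \<union> (?b - ?a)" by auto
  then have "card (sym_diff a b \<inter> x) = card (?a - ?b) + card (?b - ?a)"
    using f by (simp only:) (rule card_Un_disjoint, auto)
  then show ?thesis unfolding 1 2 by simp presburger
qed

text \<open>The parity with \<open>x\<close> is a linear functional. If it is nonzero on some
  direction then exactly half of the points are odd; otherwise it is constant on the cube. Doubling
  avoids the exponent \<open>n - 1\<close>.\<close>

lemma parity_sum_cube:
  assumes x: "finite x"
  shows "if \<exists>j<n. odd (card (u j \<inter> x)) then 2 * parity_sum (cube n s u) x = 2 ^ n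
    else parity_sum (cube n s u) x = 2 ^ n * of_bool (odd (card (s \<inter> x)))"
proof (induction n arbitrary: s)
  case 0
  then show ?case by simp
next
  case (Suc n)
  note IH = Suc[of s] Suc[of "sym_diff s (u n)"]
  show ?case
  proof (cases "\<exists>j<n. odd (card (u j \<inter> x))")
    case True
    then have "\<exists>j<Suc n. odd (card (u j \<inter> x))" by (meson less_SucI)
    then show ?thesis using IH True by simp
  next
    case False
    then have eq: "(\<exists>j<Suc n. odd (card (u j \<inter> x))) \<longleftrightarrow> odd (card (u n \<inter> x))"
      by (metis less_Suc_eq)
    show ?thesis
      unfolding eq using IH False by (auto simp: odd_card_sym_diff[OF x] simp del: Int_Un_distrib2 split: if_splits)
  qed
qed

text \<open>By \<open>parity_sum_cube\<close> a cube of dimension 4 contributes 8, 16 or 0. This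
  keeps the phase condition alive after each reduction of the weight.\<close>

lemma gadget_sound:
  assumes "S \<simeq> T" "finite x"
  shows "8 dvd parity_sum S x - parity_sum T x"
  using assms(1)
proof (induction rule: gadget_eq.induct)
  case (gadget_sym S T)
  then show ?case using dvd_diff_commute by blast
next
  case (gadget_trans S T U)
  then show ?case using dvd_add[of 8 "parity_sum S x - parity_sum T x" "parity_sum T x - parity_sum U x"] by simp
next
  case (gadget_cube s u S)
  show ?case using parity_sum_cube[OF assms(2), of 4 u s]
    by (cases "\<exists>j<4. odd (card (u j \<inter> x))") auto
qed auto

text \<open>With disjoint nonempty directions the sums are unions, so omitting any direction
  strictly lowers the weight and only the full union attains the maximum.\<close>

lemma cube_disjoint:
  assumes "finite s" "\<And>j. j < n \<Longrightarrow> finite (u j) \<and> u j \<noteq> {} \<and> u j \<inter> s = {}"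
    and "\<And>i j. i < n \<Longrightarrow> j < n \<Longrightarrow> i \<noteq> j \<Longrightarrow> u i \<inter> u j = {}"
  shows "\<exists>Q. cube n s u = add_mset (s \<union> (\<Union>j<n. u j)) Q \<and>
    (\<forall>w\<in>#Q. finite w \<and> card w < card (s \<union> (\<Union>j<n. u j)))"
  using assms
proof (induction n arbitrary: s)
  case 0
  then show ?case by simp
next
  case (Suc n)
  let ?U = "\<Union>j<n. u j"
  have un: "finite (u n)" "u n \<noteq> {}" "u n \<inter> s = {}" using Suc.prems(2)[of n] by auto
  have "u n \<inter> u j = {}" if "j < n" for j using Suc.prems(3)[of n j] that by simp
  then have dU: "u n \<inter> ?U = {}" by blast
  have fU: "finite ?U" using Suc.prems(2) by auto
  have sd: "sym_diff s (u n) = s \<union> u n" using un by auto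
  obtain Q1 where Q1: "cube n s u = add_mset (s \<union> ?U) Q1" "\<forall>w\<in>#Q1. finite w \<and> card w < card (s \<union> ?U)"
    using Suc.IH[of s] Suc.prems by (metis less_SucI)
  have "\<exists>Q. cube n (s \<union> u n) u = add_mset ((s \<union> u n) \<union> ?U) Q \<and> (\<forall>w\<in>#Q. finite w \<and> card w < card ((s \<union> u n) \<union> ?U))"
  proof (rule Suc.IH)
    show "finite (s \<union> u n)" using Suc.prems(1) un by simp
    show "finite (u j) \<and> u j \<noteq> {} \<and> u j \<inter> (s \<union> u n) = {}" if "j < n" for j
      using Suc.prems(2)[of j] Suc.prems(3)[of j n] that by auto
  qed (use Suc.prems(3) in simp)
  then obtain Q2 where Q2: "cube n (s \<union> u n) u = add_mset ((s \<union> u n) \<union> ?U) Q2"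
    "\<forall>w\<in>#Q2. finite w \<and> card w < card ((s \<union> u n) \<union> ?U)" by blast
  have eq: "s \<union> (\<Union>j<Suc n. u j) = (s \<union> u n) \<union> ?U" by (auto simp: lessThan_Suc)
  have lt: "card (s \<union> ?U) < card ((s \<union> u n) \<union> ?U)"
  proof (rule psubset_card_mono)
    obtain x where "x \<in> u n" using un(2) by auto
    then have "x \<notin> s \<union> ?U" "x \<in> (s \<union> u n) \<union> ?U" using un(3) dU by blast+
    then show "s \<union> ?U \<subset> (s \<union> u n) \<union> ?U" by blast
  qed (use Suc.prems(1) un(1) fU in simp)
  show ?case
    unfolding eq cube.simps sd Q1(1) Q2(1)
    by (rule exI[of _ "add_mset (s \<union> ?U) (Q1 + Q2)"])
      (use Q1(2) Q2(2) lt fU Suc.prems(1) in \<open>auto dest: less_trans\<close>)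
qed

text \<open>Cut \<open>v\<close> into \<open>min d 4\<close> disjoint blocks. The cube they span
  from the origin has \<open>v\<close> as its only heaviest point, so the required multiple of
  \<open>v\<close> is the negative of the same multiple of the lighter points.\<close>

lemma gadget_reduce:
  assumes v: "finite v" "card v = d" "d \<ge> 1"
  shows "\<exists>S. repeat_mset (2 ^ (4 - d)) {#v#} \<simeq> S \<and> (\<forall>w\<in>#S. finite w \<and> card w < d)"
proof -
  obtain xs where xs: "set xs = v" "distinct xs" using v(1) finite_distinct_list by blast
  then have len: "length xs = d" using v(2) distinct_card by metis
  \<comment> \<open>Truncated subtraction makes \<open>4 - d\<close> and \<open>4 - e\<close> agree
    also for \<open>d > 4\<close>.\<close>
  define e where "e = min d 4"
  define m :: nat where "m = 2 ^ (4 - d)"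
  have m: "m = 2 ^ (4 - e)" by (auto simp: m_def e_def min_def)
  \<comment> \<open>Singletons, except that the fourth block takes all elements that are
    left.\<close>
  define u where "u j = (if j = 3 then set (drop 3 xs) else {xs ! j})" for j
  have dr: "set (drop 3 xs) = (!) xs ` {3..<d}"
    using len by (auto simp: set_conv_nth image_iff) (metis le_add_diff_inverse less_diff_conv add.commute atLeastLessThan_iff le_add1)+
  have U: "(\<Union>j<e. u j) = v"
  proof -
    have "v = (!) xs ` {..<d}" using xs(1) len by (auto simp: set_conv_nth)
    moreover have "(\<Union>j<e. u j) = (!) xs ` {..<d}"
    proof (cases "d \<ge> 4")
      case True
      then have e: "e = 4" by (simp add: e_def)
      have "{..<d} = {0, 1, 2} \<union> {3..<d}" using True by auto
      moreover have "{..<e} = {0, 1, 2, 3}" using e by auto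
      ultimately show ?thesis by (auto simp: u_def dr)
    next
      case False
      then show ?thesis by (auto simp: e_def u_def)
    qed
    ultimately show ?thesis by simp
  qed
  have "\<exists>Q. cube e {} u = add_mset ({} \<union> (\<Union>j<e. u j)) Q \<and> (\<forall>w\<in>#Q. finite w \<and> card w < card ({} \<union> (\<Union>j<e. u j)))"
  proof (rule cube_disjoint)
    show "finite (u j) \<and> u j \<noteq> {} \<and> u j \<inter> {} = {}" if "j < e" for j
      using that len by (auto simp: u_def e_def)
    show "u i \<inter> u j = {}" if "i < e" "j < e" "i \<noteq> j" for i j
    proof -
      have n: "xs ! a \<noteq> xs ! b" if "a < d" "b < d" "a \<noteq> b" for a b
        using that xs(2) len by (simp add: nth_eq_iff_index_eq)
      show ?thesis
        using that unfolding u_def dr e_def by (auto dest: n)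
    qed
  qed simp
  then obtain Q where Q: "cube e {} u = add_mset v Q" "\<forall>w\<in>#Q. finite w \<and> card w < d"
    unfolding U using v(2) by auto
  have "repeat_mset m (add_mset v Q) \<simeq> {#}"
    using gadget_cube_le[of e "{}" u] unfolding Q(1) m by (simp add: e_def)
  \<comment> \<open>Adding seven copies of the lighter points completes the one copy in the cube to
    eight, which vanish.\<close>
  from gadget_add[OF this, of "repeat_mset (7 * m) Q"]
  have 1: "repeat_mset m (add_mset v Q) + repeat_mset (7 * m) Q \<simeq> repeat_mset (7 * m) Q" by simp
  have 2: "repeat_mset m (add_mset v Q) + repeat_mset (7 * m) Q = repeat_mset m {#v#} + repeat_mset 8 (repeat_mset m Q)"
    by (rule multiset_eqI) (simp add: algebra_simps)
  have "repeat_mset m {#v#} + repeat_mset 8 (repeat_mset m Q) \<simeq> repeat_mset m {#v#}"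
    using gadget_add2[OF gadget_refl[of "repeat_mset m {#v#}"] gadget_eight[of "repeat_mset m Q"]] by simp
  from gadget_trans[OF gadget_sym[OF this] 1[unfolded 2]]
  have "repeat_mset m {#v#} \<simeq> repeat_mset (7 * m) Q" .
  moreover have "finite w \<and> card w < d" if "w \<in># repeat_mset (7 * m) Q" for w
    using Q(2) in_repeat_mset[OF that] by blast
  ultimately show ?thesis unfolding m_def by blast
qed

text \<open>Each round trades one packet of \<open>2 ^ (4 - d)\<close> equal heaviest vectors, which
  preserves the divisibility of the remaining multiplicities.\<close>

lemma gadget_reduce_top:
  assumes "\<And>v. v \<in># S \<Longrightarrow> finite v \<and> card v \<le> d" "d \<ge> 1"
    and "\<And>v. v \<in># S \<Longrightarrow> card v = d \<Longrightarrow> 2 ^ (4 - d) dvd count S v"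
  shows "\<exists>T. S \<simeq> T \<and> (\<forall>w\<in>#T. finite w \<and> card w < d)"
  using assms
proof (induction "size S" arbitrary: S rule: less_induct)
  case less
  define m :: nat where "m = 2 ^ (4 - d)"
  show ?case
  proof (cases "\<exists>v\<in>#S. card v = d")
    case False
    then show ?thesis using less.prems(1) gadget_refl[of S] by (intro exI[of _ S]) (auto simp: le_less)
  next
    case True
    then obtain v where v: "v \<in># S" "card v = d" by blast
    have mc: "m dvd count S v" using less.prems(3)[OF v] by (simp add: m_def)
    have "count S v > 0" using v by simp
    then have le: "m \<le> count S v" using mc by (simp add: dvd_imp_le)
    have m0: "m > 0" by (simp add: m_def)
    define S' where "S' = S - repeat_mset m {#v#}"
    have "repeat_mset m {#v#} \<subseteq># S" using le by (simp add: subseteq_mset_def)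
    then have S: "S = repeat_mset m {#v#} + S'" by (simp add: S'_def)
    have "\<exists>T. S' \<simeq> T \<and> (\<forall>w\<in>#T. finite w \<and> card w < d)"
    proof (rule less.hyps)
      have "size S = m + size S'" by (subst S) simp
      then show "size S' < size S" using m0 by simp
      show "finite w \<and> card w \<le> d" if "w \<in># S'" for w
        using less.prems(1)[of w] that S by (metis union_iff)
      show "2 ^ (4 - d) dvd count S' w" if "w \<in># S'" "card w = d" for w
      proof -
        have "w \<in># S" using that S by (metis union_iff)
        then have "m dvd count S w" using less.prems(3) that by (simp add: m_def)
        then show ?thesis using mc unfolding m_def[symmetric] by (cases "w = v") (auto simp: S'_def)
      qed
    qed (rule less.prems)
    then obtain T where T: "S' \<simeq> T" "\<forall>w\<in>#T. finite w \<and> card w < d" by blast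
    obtain R where R: "repeat_mset m {#v#} \<simeq> R" "\<forall>w\<in>#R. finite w \<and> card w < d"
      using gadget_reduce[OF _ v(2) less.prems(2)] less.prems(1)[OF v(1)] unfolding m_def by blast
    have "S \<simeq> R + T" by (subst S) (rule gadget_add2[OF R(1) T(1)])
    then show ?thesis using R(2) T(2) by (intro exI[of _ "R + T"]) auto
  qed
qed

section \<open>Inclusion-exclusion over inputs\<close>

lemma sum_Pow_insert:
  fixes f :: "nat set \<Rightarrow> int"
  assumes "finite v" "e \<notin> v"
  shows "(\<Sum>x\<in>Pow (insert e v). f x) = (\<Sum>x\<in>Pow v. f x) + (\<Sum>x\<in>Pow v. f (insert e x))"
proof -
  have "inj_on (insert e) (Pow v)" using assms(2) by (auto simp: inj_on_def)
  then have "sum f (insert e ` Pow v) = (\<Sum>x\<in>Pow v. f (insert e x))" by (simp add: sum.reindex)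
  moreover have "Pow v \<inter> insert e ` Pow v = {}" using assms(2) by auto
  ultimately show ?thesis
    using assms(1) by (simp add: Pow_insert sum.union_disjoint)
qed

text \<open>Twice the indicator of odd t is 1 - (-1)^t, so twice the sum is a difference of two
  character sums over subsets of \<open>v\<close>. The first is 0 for nonempty \<open>v\<close>; the
  second factors over the elements of \<open>v\<close>, with factor 2 for those in \<open>w\<close>
  and 0 for the others.\<close>

lemma signed_sum_parity:
  fixes v w :: "nat set"
  assumes "finite v" "v \<noteq> {}"
  shows "(\<Sum>x\<in>Pow v. (- 1) ^ card x * of_bool (odd (card (w \<inter> x)))) = (if v \<subseteq> w then - (2 ^ (card v - 1)) else 0 :: int)"
proof -
  have a: "(\<Sum>x\<in>Pow v. (- 1) ^ card x) = (if v = {} then 1 else 0 :: int)" if "finite v" for v :: "nat set"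
    using that
  proof (induction v rule: finite_induct)
    case (insert e v)
    have "(\<Sum>x\<in>Pow v. (- 1) ^ card (insert e x)) = (\<Sum>x\<in>Pow v. - ((- 1) ^ card x :: int))"
      by (rule sum.cong) (use insert.hyps in \<open>auto simp: finite_subset subset_iff card_insert_if\<close>)
    then show ?case using insert by (simp add: sum_Pow_insert sum_negf)
  qed simp
  have b: "(\<Sum>x\<in>Pow v. (- 1) ^ (card x + card (w \<inter> x))) = (if v \<subseteq> w then 2 ^ card v else 0 :: int)"
    if "finite v" for v :: "nat set"
    using that
  proof (induction v rule: finite_induct)
    case (insert e v)
    have "(\<Sum>x\<in>Pow v. (- 1) ^ (card (insert e x) + card (w \<inter> insert e x))) =
      (\<Sum>x\<in>Pow v. (if e \<in> w then 1 else - 1) * ((- 1) ^ (card x + card (w \<inter> x)) :: int))"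
    proof (rule sum.cong)
      fix x assume "x \<in> Pow v"
      then have "e \<notin> x" "finite x" using insert.hyps finite_subset by auto
      then show "(- 1) ^ (card (insert e x) + card (w \<inter> insert e x)) =
        (if e \<in> w then 1 else - 1) * ((- 1) ^ (card x + card (w \<inter> x)) :: int)"
        by (auto simp: Int_insert_right card_insert_if)
    qed simp
    then show ?case using insert by (auto simp: sum_Pow_insert sum_negf simp flip: sum_distrib_left)
  qed simp
  have "2 * (\<Sum>x\<in>Pow v. (- 1) ^ card x * of_bool (odd (card (w \<inter> x)))) =
    (\<Sum>x\<in>Pow v. (- 1) ^ card x) - (\<Sum>x\<in>Pow v. (- 1) ^ (card x + card (w \<inter> x)) :: int)"
    unfolding sum_distrib_left sum_subtractf[symmetric]
    by (rule sum.cong) (auto simp: power_add)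
  also have "\<dots> = (if v \<subseteq> w then - (2 ^ card v) else 0)"
    using assms a b by simp
  finally show ?thesis
    using assms by (cases "card v") (auto split: if_splits)
qed

text \<open>Among vectors of weight at most \<open>d\<close> only \<open>v\<close> itself contains
  \<open>v\<close>, so the signed sum isolates its multiplicity and 8 divides
  \<open>2 ^ (d - 1)\<close> times it. For \<open>d \<ge> 4\<close> the claimed divisor is
  1.\<close>

lemma parity_sum_dvd_count:
  assumes S: "\<And>w. w \<in># S \<Longrightarrow> finite w \<and> card w \<le> d"
    and z: "\<And>x. finite x \<Longrightarrow> 8 dvd parity_sum S x"
    and v: "finite v" "card v = d" "d \<ge> 1"
  shows "2 ^ (4 - d) dvd count S v"
proof (cases "d \<ge> 4")
  case False
  have "v \<noteq> {}" using v by auto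
  have sub: "v \<subseteq> w \<longleftrightarrow> w = v" if "w \<in># S" for w
    using S[OF that] v by (metis card_seteq order_refl)
  have "(\<Sum>x\<in>Pow v. (- 1) ^ card x * parity_sum S x) =
    (\<Sum>w\<in>#S. \<Sum>x\<in>Pow v. (- 1) ^ card x * of_bool (odd (card (w \<inter> x))))"
  proof -
    have "(\<Sum>x\<in>Pow v. (- 1) ^ card x * parity_sum T x) =
      (\<Sum>w\<in>#T. \<Sum>x\<in>Pow v. (- 1) ^ card x * of_bool (odd (card (w \<inter> x))))" for T
      by (induction T) (auto simp: algebra_simps sum.distrib)
    then show ?thesis .
  qed
  also have "\<dots> = (\<Sum>w\<in>#S. if w = v then - (2 ^ (d - 1)) else 0)"
    by (rule arg_cong[of _ _ sum_mset], rule image_mset_cong)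
      (use sub signed_sum_parity[OF v(1) \<open>v \<noteq> {}\<close>] v(2) in auto)
  also have "\<dots> = - (2 ^ (d - 1)) * int (count S v)"
  proof -
    have "(\<Sum>w\<in>#T. if w = v then c else 0) = c * int (count T v)" for T and c :: int
      by (induction T) (auto simp: algebra_simps)
    then show ?thesis .
  qed
  finally have "8 dvd - (2 ^ (d - 1)) * int (count S v)"
    using z v(1) by (metis (no_types, lifting) dvd_mult dvd_sum finite_subset PowD)
  then have "8 dvd 2 ^ (d - 1) * int (count S v)" by simp
  moreover have "(8::int) = 2 ^ (d - 1) * 2 ^ (4 - d)"
  proof -
    have "d = 1 \<or> d = 2 \<or> d = 3" using v(3) False by auto
    then show ?thesis by auto
  qed
  ultimately have "(2::int) ^ (4 - d) dvd int (count S v)" by simp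
  then show ?thesis by (metis int_dvd_int_iff of_nat_numeral of_nat_power)
qed simp

lemma gadget_eq_empty:
  assumes "\<And>v. v \<in># S \<Longrightarrow> finite v \<and> card v \<le> d"
    and "\<And>x. finite x \<Longrightarrow> 8 dvd parity_sum S x"
  shows "S \<simeq> {#}"
  using assms
proof (induction d arbitrary: S)
  case 0
  show ?case
  proof (rule gadget_empty_sets)
    show "w = {}" if "w \<in># S" for w using 0(1)[OF that] by (metis card_0_eq le_zero_eq)
  qed
next
  case (Suc d)
  obtain T where T: "S \<simeq> T" "\<forall>w\<in>#T. finite w \<and> card w < Suc d"
    using gadget_reduce_top[of S "Suc d"] Suc.prems(1) parity_sum_dvd_count[OF Suc.prems] by auto
  have "T \<simeq> {#}"
  proof (rule Suc.IH)
    show "finite v \<and> card v \<le> d" if "v \<in># T" for v using T(2) that by auto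
    show "8 dvd parity_sum T x" if "finite x" for x
      using dvd_diff[OF Suc.prems(2)[OF that] gadget_sound[OF T(1) that]] by simp
  qed
  with T(1) show ?case by (rule gadget_trans)
qed

text \<open>\<open>S + 7 T\<close> represents the difference and has phase 0 modulo 8, so it
  vanishes; adding \<open>T\<close> gives \<open>S + 8 T\<close> on one side and \<open>T\<close> on
  the other.\<close>

lemma gadget_complete:
  assumes f: "\<And>v. v \<in># S + T \<Longrightarrow> finite v"
    and eq: "\<And>x. finite x \<Longrightarrow> 8 dvd parity_sum S x - parity_sum T x"
  shows "S \<simeq> T"
proof -
  let ?U = "S + repeat_mset 7 T"
  have "?U \<simeq> {#}"
  proof (rule gadget_eq_empty)
    have "finite (card ` set_mset ?U)" by simp
    then show "finite v \<and> card v \<le> Max (card ` set_mset ?U)" if "v \<in># ?U" for v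
      using f that in_repeat_mset[of v 7 T] by auto
    show "8 dvd parity_sum ?U x" if "finite x" for x
    proof -
      have "parity_sum ?U x = (parity_sum S x - parity_sum T x) + 8 * parity_sum T x"
        by (simp add: parity_sum_repeat)
      then show ?thesis using eq[OF that] by (simp only:) (rule dvd_add, auto)
    qed
  qed
  from gadget_add[OF this, of T] have 1: "?U + T \<simeq> T" by simp
  have 2: "?U + T = S + repeat_mset 8 T"
    by (rule multiset_eqI) simp
  have "S + repeat_mset 8 T \<simeq> S"
    using gadget_add2[OF gadget_refl[of S] gadget_eight[of T]] by simp
  from gadget_trans[OF gadget_sym[OF this] 1[unfolded 2]] show ?thesis .
qed

section \<open>Diagrams of phase gadgets\<close>

definition gadget_diagram :: "nat \<Rightarrow> nat set list \<Rightarrow> diagram"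
  where "gadget_diagram n vs = sys n {..<length vs} ((!) vs) (T_gates {..<length vs})"

lemma ends_T_gates: "finite L \<Longrightarrow> ends (T_gates L) = mset_set L"
  unfolding T_gates_def by (induction L rule: finite_induct) auto

lemma admissible_T_gates: "finite L \<Longrightarrow> admissible L (T_gates L)"
  unfolding admissible_def by (simp add: ends_T_gates count_mset_set') (auto simp: T_gates_def)

lemma vmap_T_gates: "inj_on f L \<Longrightarrow> vmap f (T_gates L) = T_gates (f ` L)"
  unfolding T_gates_def image_mset_mset_set[symmetric]
  by (simp add: vmap_def multiset.map_comp comp_def)

lemma sys_rename_T_gates:
  assumes "finite A" "inj_on f A" "\<And>e. e \<in> A \<Longrightarrow> v' (f e) = v e"
  shows "sys n A v (T_gates A) \<approx> sys n (f ` A) v' (T_gates (f ` A))"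
  using sys_rename[OF admissible_T_gates[OF assms(1)], of f v' v n] assms
  by (simp add: ends_T_gates vmap_T_gates[unfolded vmap_def])

text \<open>The names of the gadgets are immaterial: any bijection matching the vectors induces a
  renaming of wires.\<close>

lemma sys_eq_gadget_diagram:
  assumes A: "finite A" and v: "image_mset v (mset_set A) = mset vs"
  shows "sys n A v (T_gates A) \<approx> gadget_diagram n vs"
proof -
  obtain xs where xs: "set xs = A" "distinct xs" using A finite_distinct_list by blast
  then have mA: "mset_set A = mset xs" using mset_set_set by blast
  have "mset (map v xs) = mset vs" using v by (simp add: mA)
  from permutation_Ex_bij[OF this] obtain g where g: "bij_betw g {..<length xs} {..<length vs}"
    "\<And>i. i < length xs \<Longrightarrow> v (xs ! i) = vs ! g i"
    by (metis (no_types, lifting) length_map nth_map)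
  have im: "(!) xs ` {..<length xs} = A" using xs(1) by (auto simp: set_conv_nth)
  have "sys n {..<length xs} (\<lambda>i. v (xs ! i)) (T_gates {..<length xs}) \<approx> sys n A v (T_gates A)"
    using sys_rename_T_gates[of "{..<length xs}" "(!) xs" v "\<lambda>i. v (xs ! i)" n] xs(2)
    by (simp add: im inj_on_nth)
  moreover have "sys n {..<length xs} (\<lambda>i. v (xs ! i)) (T_gates {..<length xs}) \<approx> gadget_diagram n vs"
    using sys_rename_T_gates[of "{..<length xs}" g "(!) vs" "\<lambda>i. v (xs ! i)" n] g
    by (simp add: gadget_diagram_def bij_betw_def)
  ultimately show ?thesis using zx_eq_sym zx_eq_trans by blast
qed

lemma image_nth_mset: "image_mset ((!) vs) (mset_set {..<length vs}) = mset vs"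
proof -
  have "mset (map ((!) vs) [0..<length vs]) = mset vs" by (simp only: map_nth)
  then show ?thesis by (simp add: atLeast0LessThan)
qed

lemma gadget_diagram_mset: "mset vs = mset us \<Longrightarrow> gadget_diagram n vs \<approx> gadget_diagram n us"
  unfolding gadget_diagram_def[of n vs]
  by (rule sys_eq_gadget_diagram) (simp_all add: image_nth_mset)

text \<open>Stated for all lists that enumerate the multisets, since transitivity passes through an
  arbitrary enumeration of the middle one.\<close>

lemma gadget_diagram_sound:
  "S \<simeq> T \<Longrightarrow> mset vs = S \<Longrightarrow> mset us = T \<Longrightarrow> gadget_diagram n vs \<approx> gadget_diagram n us"
proof (induction arbitrary: vs us rule: gadget_eq.induct)
  case (gadget_refl S)
  then show ?case by (simp add: gadget_diagram_mset)
next
  case (gadget_sym S T)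
  then show ?case using zx_eq_sym by blast
next
  case (gadget_trans S T U)
  obtain ts where "mset ts = T" using ex_mset by blast
  then show ?case using gadget_trans zx_eq_trans by blast
next
  case (gadget_zero S)
  let ?A = "{..<length ({} # us)} - {0}" and ?v = "(!) ({} # us)"
  have T: "T_gates {..<length ({} # us)} = add_mset (Spider Z (angle (pi / 4)), {#0#}) (T_gates ?A)"
    by (simp add: T_gates_def mset_set.remove[of "{..<Suc (length us)}" 0])
  have adm: "admissible {..<length ({} # us)} (add_mset (Spider Z (angle (pi / 4)), {#0#}) (T_gates ?A))"
    using admissible_T_gates[of "{..<length ({} # us)}"] unfolding T by simp
  have "gadget_diagram n vs \<approx> gadget_diagram n ({} # us)"
    using gadget_zero by (intro gadget_diagram_mset) simp
  also have "gadget_diagram n ({} # us) \<approx> sys n ?A ?v (T_gates ?A)"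
    unfolding gadget_diagram_def T by (rule sys_drop_zero(2)[OF adm]) simp_all
  also have "\<dots> \<approx> gadget_diagram n us"
  proof (rule sys_eq_gadget_diagram)
    have "add_mset (?v 0) (image_mset ?v (mset_set ?A)) = image_mset ?v (mset_set {..<length ({} # us)})"
      by (subst (2) mset_set.remove[of _ 0]) simp_all
    also have "\<dots> = add_mset {} (mset us)" using image_nth_mset[of "{} # us"] by simp
    finally show "image_mset ?v (mset_set ?A) = mset us" by simp
  qed simp
  finally show ?case .
next
  case (gadget_cube s u S)
  let ?A = "{..<length us}"
  obtain L v' where L: "finite L" "L \<inter> ?A = {}" "\<forall>e\<in>?A. v' e = us ! e" "image_mset v' (mset_set L) = cube 4 s u"
    "sys n ?A ((!) us) (T_gates ?A) \<approx> sys n (?A \<union> L) v' (T_gates L + T_gates ?A)"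
    using sys_cube[OF admissible_T_gates[of ?A], of "(!) us" s u n] by auto
  have "T_gates L + T_gates ?A = T_gates (?A \<union> L)"
    using L(1,2) by (simp add: T_gates_def mset_set_Union Int_commute add.commute)
  then have "gadget_diagram n us \<approx> sys n (?A \<union> L) v' (T_gates (?A \<union> L))"
    using L(5) by (simp add: gadget_diagram_def)
  also have "\<dots> \<approx> gadget_diagram n vs"
  proof (rule sys_eq_gadget_diagram)
    have "image_mset v' (mset_set ?A) = image_mset ((!) us) (mset_set ?A)"
      using L(3) by (intro image_mset_cong) simp
    then show "image_mset v' (mset_set (?A \<union> L)) = mset vs"
      using L(1,2,4) gadget_cube image_nth_mset[of us] by (simp add: mset_set_Union Int_commute add.commute)
  qed (use L(1) in simp)
  finally show ?case by (rule zx_eq_sym)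
qed

section \<open>Matrix diagrams as diagrams of phase gadgets\<close>

definition row_diagram :: "nat \<Rightarrow> nat \<Rightarrow> (nat \<Rightarrow> nat \<Rightarrow> bit) \<Rightarrow> diagram"
  where "row_diagram k n m = Diagram
       (mset (map (\<lambda>i. (Spider Z 0,
            mset (i # (n + i) # map (\<lambda>l. 2 * n + k + l * n + i) (filter (\<lambda>l. m l i = 1) [0..<k])))) [0..<n]) +
        mset (map (\<lambda>l. (Spider X 0,
            mset ((2 * n + l) # map (\<lambda>i. 2 * n + k + l * n + i) (filter (\<lambda>i. m l i = 1) [0..<n])))) [0..<k]) +
        mset (map (\<lambda>l. (Spider Z (angle (pi / 4)), {#2 * n + l#})) [0..<k]))
       [0..<n] [n..<2 * n]"

definition rows :: "nat \<Rightarrow> nat \<Rightarrow> (nat \<Rightarrow> nat \<Rightarrow> bit) \<Rightarrow> nat set list"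
  where "rows k n m = map (\<lambda>l. {i. i < n \<and> m l i = 1}) [0..<k]"

text \<open>The numbering used by \<open>matrix_diagram\<close>. On the wires that occur the four
  kinds have disjoint ranges, and \<open>i < n\<close> makes the qubit of an edge the remainder
  modulo \<open>n\<close>.\<close>

fun wire_number :: "nat \<Rightarrow> nat \<Rightarrow> wire \<Rightarrow> nat"
  where
    "wire_number k n (In i) = i"
  | "wire_number k n (Out i) = n + i"
  | "wire_number k n (Ext l) = 2 * n + l"
  | "wire_number k n (Edge i l) = 2 * n + k + l * n + i"

lemma mset_filter_upt: "mset (filter P [0..<n]) = mset_set {i. i < n \<and> P i}"
proof -
  have "filter_mset P (mset_set {..<n}) = mset_set {i \<in> {..<n}. P i}" by (rule filter_mset_mset_set) simp
  then show ?thesis by (simp add: atLeast0LessThan)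
qed

lemma mset_map_upt: "mset (map F [0..<n]) = (\<Sum>i<n. {#F i#})"
  by (induction n) (auto simp: lessThan_Suc add.commute)

lemma gadget_diagram_rows: "gadget_diagram n (rows k n m) \<approx> row_diagram k n m"
proof -
  let ?vs = "rows k n m" and ?f = "\<lambda>w. wire_number k n (from_nat w)"
  have len: "length ?vs = k" by (simp add: rows_def)
  have D: "gadget_diagram n ?vs = sys n {..<k} ((!) ?vs) (T_gates {..<k})"
    by (simp add: gadget_diagram_def len)
  have nth: "?vs ! l = {i. i < n \<and> m l i = 1}" if "l < k" for l using that by (simp add: rows_def)
  let ?R = "In ` {..<n} \<union> Out ` {..<n} \<union> (\<lambda>(i, e). Edge i e) ` ({..<n} \<times> {..<k}) \<union> Ext ` {..<k}"
  have "wires (gadget_diagram n ?vs) \<subseteq> wn ` ?R"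
    unfolding D by (rule order_trans[OF wires_sys[OF finite_lessThan]], rule image_mono)
      (auto simp: ends_T_gates)
  moreover have "inj_on ?f (wn ` ?R)"
  proof (rule inj_on_imageI, rule inj_onI)
    have E: "i = j \<and> l = l'" if "i < n" "j < n" "l * n + i = l' * n + j" for i j l l'
    proof -
      have "(l * n + i) mod n = i" "(l' * n + j) mod n = j" using that(1,2) by simp_all
      then have "i = j" using that(3) by metis
      then show ?thesis using that by simp
    qed
    fix a b assume ab: "a \<in> ?R" "b \<in> ?R" "(?f \<circ> wn) a = (?f \<circ> wn) b"
    show "a = b"
    proof (cases "\<exists>i l j l'. a = Edge i l \<and> b = Edge j l'")
      case True
      then obtain i l j l' where e: "a = Edge i l" "b = Edge j l'" by blast
      then have "i < n" "j < n" "l * n + i = l' * n + j" using ab by auto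
      then show ?thesis using E e by blast
    next
      case False
      then show ?thesis using ab by (cases a; cases b) auto
    qed
  qed
  ultimately have "inj_on ?f (wires (gadget_diagram n ?vs))" using inj_on_subset by blast
  then have "gadget_diagram n ?vs \<approx> rename ?f (gadget_diagram n ?vs)"
    unfolding D by (intro zx_eq_rename well_formed_sys admissible_T_gates) simp_all
  also have "rename ?f (gadget_diagram n ?vs) = row_diagram k n m"
  proof -
    have H: "map_prod id (image_mset ?f) (hub {e \<in> {..<k}. i \<in> ?vs ! e} i) =
      (Spider Z 0, mset (i # (n + i) # map (\<lambda>l. 2 * n + k + l * n + i) (filter (\<lambda>l. m l i = 1) [0..<k])))" if "i < n" for i
    proof -
      have "{e \<in> {..<k}. i \<in> ?vs ! e} = {l. l < k \<and> m l i = 1}" using that nth by auto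
      then show ?thesis
        by (simp add: hub_def edges_def multiset.map_comp comp_def mset_filter_upt del: mset_filter)
    qed
    have P: "map_prod id (image_mset ?f) (parity (?vs ! l \<inter> {..<n}) l) =
      (Spider X 0, mset ((2 * n + l) # map (\<lambda>i. 2 * n + k + l * n + i) (filter (\<lambda>i. m l i = 1) [0..<n])))" if "l < k" for l
    proof -
      have "?vs ! l \<inter> {..<n} = {i. i < n \<and> m l i = 1}" using that nth by auto
      then show ?thesis
        by (simp add: parity_def redges_def multiset.map_comp comp_def mset_filter_upt del: mset_filter)
    qed
    have "image_mset (map_prod id (image_mset ?f)) (\<Sum>i<n. {#hub {e \<in> {..<k}. i \<in> ?vs ! e} i#}) =
      mset (map (\<lambda>i. (Spider Z 0, mset (i # (n + i) # map (\<lambda>l. 2 * n + k + l * n + i) (filter (\<lambda>l. m l i = 1) [0..<k])))) [0..<n])"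
      unfolding image_mset_sum mset_map_upt
      by (rule sum.cong[OF refl]) (simp only: image_mset_add_mset image_mset_empty H[OF iffD1[OF lessThan_iff]])
    moreover have "image_mset (map_prod id (image_mset ?f)) (\<Sum>l<k. {#parity (?vs ! l \<inter> {..<n}) l#}) =
      mset (map (\<lambda>l. (Spider X 0, mset ((2 * n + l) # map (\<lambda>i. 2 * n + k + l * n + i) (filter (\<lambda>i. m l i = 1) [0..<n])))) [0..<k])"
      unfolding image_mset_sum mset_map_upt
      by (rule sum.cong[OF refl]) (simp only: image_mset_add_mset image_mset_empty P[OF iffD1[OF lessThan_iff]])
    moreover have "image_mset (map_prod id (image_mset ?f)) (ext (T_gates {..<k})) =
      mset (map (\<lambda>l. (Spider Z (angle (pi / 4)), {#2 * n + l#})) [0..<k])"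
      by (simp add: ext_def T_gates_def multiset.map_comp comp_def atLeast0LessThan)
    moreover have "map ?f (map (\<lambda>i. wn (In i)) [0..<n]) = [0..<n]" by (simp add: comp_def)
    moreover have "map ?f (map (\<lambda>i. wn (Out i)) [0..<n]) = [n..<2 * n]"
      by (rule nth_equalityI) auto
    ultimately show ?thesis
      unfolding D sys_def row_diagram_def rename_Diagram image_mset_union by (simp only:)
  qed
  finally show ?thesis .
qed

section \<open>Semantics of phase gadgets\<close>

lemma expi_angle: "expi (angle t) = cis t"
  by (simp add: angle_def expi.abs_eq)

lemma expi_0: "expi 0 = 1"
  by (simp add: zero_phase_def expi.abs_eq)

lemma bit_neq_0 [simp]: "(b :: bit) \<noteq> 0 \<longleftrightarrow> b = 1"
  by (cases b) auto

lemma prod_indicator: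
  "(\<Prod>b\<in>#B. if P b then 1 else 0 :: complex) = (if \<forall>b\<in>#B. P b then 1 else 0)"
  by (induction B) auto

text \<open>Without legs both summands would be 1 and the value 2, so the indicator form requires at
  least one leg.\<close>

lemma Z_tensor_0: "B \<noteq> {#} \<Longrightarrow> label_tensor (Spider Z 0) B = (if \<exists>c. \<forall>b\<in>#B. b = c then 1 else 0)"
proof -
  assume "B \<noteq> {#}"
  then obtain b0 where b0: "b0 \<in># B" by blast
  have e: "(if b = 0 then 0 else 1 :: complex) = (if b = 1 then 1 else 0)" for b :: bit by (cases b) auto
  have "label_tensor (Spider Z 0) B = (if \<forall>b\<in>#B. b = 0 then 1 else 0) + (if \<forall>b\<in>#B. b = 1 then 1 else 0)"
    by (simp add: prod_indicator e expi_0)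
  also have "\<dots> = (if \<exists>c. \<forall>b\<in>#B. b = c then 1 else 0)"
  proof (cases "\<exists>c. \<forall>b\<in>#B. b = c")
    case True
    then obtain c where "\<forall>b\<in>#B. b = c" by blast
    then show ?thesis using b0 by (cases c) auto
  next
    case False
    then obtain b1 b2 where "b1 \<in># B" "b1 \<noteq> 0" "b2 \<in># B" "b2 \<noteq> 1" by blast
    then show ?thesis using False by auto
  qed
  finally show ?thesis .
qed

lemma X_tensor_0: "label_tensor (Spider X 0) B =
    (1 / complex_of_real (sqrt 2)) ^ size B * (if even (size (filter_mset (\<lambda>b. b = 1) B)) then 2 else 0)"
proof -
  have 1: "(\<Prod>b\<in>#B. 1 / sqrt 2) = (1 / sqrt 2) ^ size B"
    by (induction B) auto
  have 2: "(\<Prod>b\<in>#B. if b = 0 then 1 / sqrt 2 else - 1 / sqrt 2) =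
    (1 / sqrt 2) ^ size B * (- 1) ^ size (filter_mset (\<lambda>b. b = 1) B)"
  proof (induction B)
    case (add b B)
    then show ?case by (cases b) auto
  qed simp
  show ?thesis
    unfolding label_tensor.simps 1 2 expi_0 by simp
qed

lemma T_tensor: "label_tensor (Spider Z \<alpha>) {#b#} = (if b = 1 then expi \<alpha> else 1)"
  by (cases b) auto

definition parity_bit :: "nat \<Rightarrow> (nat \<Rightarrow> nat \<Rightarrow> bit) \<Rightarrow> bit list \<Rightarrow> nat \<Rightarrow> bit"
  where "parity_bit n m x l = of_bool (odd (card {i. i < n \<and> m l i = 1 \<and> x ! i = 1}))"

text \<open>Diagonal entries are enough to read off the phases. For fixed \<open>x\<close> the hubs
  force each edge to carry the bit of its qubit and the X-spiders force each gadget wire to carry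
  its parity, so a single assignment contributes to the sum.\<close>

lemma denote_row_diagram:
  "\<exists>c. c \<noteq> 0 \<and> (\<forall>x. length x = n \<longrightarrow>
    denote (row_diagram k n m) x x = c * (\<Prod>l<k. if parity_bit n m x l = 1 then cis (pi / 4) else 1))"
proof -
  define g where "g l i = 2 * n + k + l * n + i" for l i
  define H where "H i = mset (i # (n + i) # map (\<lambda>l. g l i) (filter (\<lambda>l. m l i = 1) [0..<k]))" for i
  define P where "P l = mset ((2 * n + l) # map (\<lambda>i. g l i) (filter (\<lambda>i. m l i = 1) [0..<n]))" for l
  let ?D = "row_diagram k n m"
  have D: "?D = Diagram (mset (map (\<lambda>i. (Spider Z 0, H i)) [0..<n]) + mset (map (\<lambda>l. (Spider X 0, P l)) [0..<k]) +
      mset (map (\<lambda>l. (Spider Z (angle (pi / 4)), {#2 * n + l#})) [0..<k])) [0..<n] [n..<2 * n]"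
    by (simp only: row_diagram_def H_def P_def g_def)
  have io: "ins ?D = [0..<n]" "outs ?D = [n..<2 * n]" by (simp_all add: row_diagram_def)
  define f where "f v = (\<Prod>(a, legs)\<in>#vertices ?D. label_tensor a (image_mset v legs))" for v :: "nat \<Rightarrow> bit"
  have pm: "(\<Prod>x\<in>#mset (map F [0..<j]). h x) = (\<Prod>i<j. h (F i) :: complex)" for h j and F :: "nat \<Rightarrow> vertex"
    by (induction j) (auto simp: lessThan_Suc)
  have f: "f v = (\<Prod>i<n. label_tensor (Spider Z 0) (image_mset v (H i))) *
      (\<Prod>l<k. label_tensor (Spider X 0) (image_mset v (P l))) *
      (\<Prod>l<k. label_tensor (Spider Z (angle (pi / 4))) {#v (2 * n + l)#})" for v
    unfolding f_def D diagram.sel image_mset_union prod_mset.union pm by simp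
  have Hn: "image_mset v (H i) \<noteq> {#}" for v :: "nat \<Rightarrow> bit" and i by (simp add: H_def)
  have Hs: "set_mset (H i) = {i, n + i} \<union> {g l i |l. l < k \<and> m l i = 1}" for i by (auto simp: H_def)
  have ones: "size (filter_mset (\<lambda>b. b = 1) (image_mset v (P l))) =
      (if v (2 * n + l) = 1 then 1 else 0) + card {i. i < n \<and> m l i = 1 \<and> v (g l i) = 1}" for v l
  proof -
    have 1: "filter_mset (\<lambda>b. b = 1) (image_mset v (mset (map (g l) xs))) = mset (map (\<lambda>i. v (g l i)) (filter (\<lambda>i. v (g l i) = 1) xs))" for xs
      by (induction xs) auto
    have "length (filter (\<lambda>i. v (g l i) = 1) (filter (\<lambda>i. m l i = 1) [0..<n])) =
        size (mset_set {i. i < n \<and> m l i = 1 \<and> v (g l i) = 1})"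
      unfolding filter_filter size_mset[symmetric] mset_filter_upt ..
    then show ?thesis by (simp add: P_def 1 del: mset_map)
  qed
  \<comment> \<open>In the contributing assignment every hub has value 1 and every X-spider sees an
    even number of ones, so these factors do not depend on \<open>x\<close>.\<close>
  define c where "c = (\<Prod>l<k. (1 / complex_of_real (sqrt 2)) ^ size (P l) * 2)"
  have c: "c \<noteq> 0" by (simp add: c_def)
  have "denote ?D x x = c * (\<Prod>l<k. if parity_bit n m x l = 1 then cis (pi / 4) else 1)" if x: "length x = n" for x
  proof -
    define S where "S = {v \<in> wires ?D \<rightarrow>\<^sub>E (UNIV :: bit set). map v (ins ?D) = x \<and> map v (outs ?D) = x}"
    have fb: "finite (UNIV :: bit set)" unfolding UNIV_bit by simp
    have fin: "finite S"
      unfolding S_def by (rule finite_subset[OF _ finite_PiE[of "wires ?D" "\<lambda>_. UNIV"]]) (auto simp: wires_def fb)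
    \<comment> \<open>The forced values, by ranges of the wire numbering; in the last range
      \<open>mod n\<close> recovers the qubit of an edge.\<close>
    define u where "u w = (if w < n then x ! w else if w < 2 * n then x ! (w - n)
      else if w < 2 * n + k then parity_bit n m x (w - 2 * n) else x ! ((w - (2 * n + k)) mod n))" for w
    have ug: "u (g l i) = x ! i" if "i < n" for l i using that by (auto simp: u_def g_def)
    have ui: "u i = x ! i" "u (n + i) = x ! i" if "i < n" for i using that by (auto simp: u_def)
    have ul: "u (2 * n + l) = parity_bit n m x l" if "l < k" for l using that by (simp add: u_def)
    define v0 where "v0 = restrict u (wires ?D)"
    have W: "wires ?D = {..<2 * n} \<union> {2 * n + l |l. l < k} \<union> {g l i |l i. l < k \<and> i < n \<and> m l i = 1}"
    proof -
      have Ps: "set_mset (P l) = insert (2 * n + l) {g l i |i. i < n \<and> m l i = 1}" for l by (auto simp: P_def)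
      have "wires ?D = (\<Union>i<n. set_mset (H i)) \<union> (\<Union>l<k. set_mset (P l)) \<union> (\<lambda>l. 2 * n + l) ` {..<k} \<union> {..<n} \<union> {n..<2 * n}"
        unfolding D wires_Diagram set_mset_union UN_Un set_mset_mset by (auto simp: atLeast0LessThan)
      then show ?thesis unfolding Hs Ps by (auto simp: not_less)
    qed
    have v0i: "v0 i = x ! i" "v0 (n + i) = x ! i" if "i < n" for i using that ui[OF that] by (auto simp: v0_def W)
    have v0l: "v0 (2 * n + l) = parity_bit n m x l" if "l < k" for l using that ul[OF that] by (auto simp: v0_def W)
    have v0g: "v0 (g l i) = x ! i" if "i < n" "l < k" "m l i = 1" for l i
    proof -
      have "g l i \<in> wires ?D" using that by (auto simp: W)
      then show ?thesis using ug[OF that(1)] by (simp add: v0_def)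
    qed
    have v0S: "v0 \<in> S"
    proof -
      have "map v0 [0..<n] = x" using x v0i(1) by (intro nth_equalityI) auto
      moreover have "map v0 [n..<2 * n] = x"
        using x v0i(2) by (intro nth_equalityI) (auto simp: mult_2)
      moreover have "v0 \<in> wires ?D \<rightarrow>\<^sub>E UNIV" by (simp add: v0_def)
      ultimately show ?thesis by (simp add: S_def io)
    qed
    have uniq: "v = v0" if v: "v \<in> S" "f v \<noteq> 0" for v
    proof -
      have vi: "v i = x ! i" "v (n + i) = x ! i" if "i < n" for i
      proof -
        have "map v [0..<n] = x" "map v [n..<2 * n] = x" using v(1) by (simp_all add: S_def io)
        then show "v i = x ! i" "v (n + i) = x ! i"
          using that nth_map[of i "[0..<n]" v] nth_map[of i "[n..<2 * n]" v] by (auto simp: mult_2)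
      qed
      have vg: "v (g l i) = x ! i" if "i < n" "l < k" "m l i = 1" for l i
      proof -
        have "label_tensor (Spider Z 0) (image_mset v (H i)) \<noteq> 0"
          using v(2) that(1) unfolding f by (auto simp: prod_zero_iff simp del: label_tensor.simps)
        then obtain c where "\<forall>b\<in>#image_mset v (H i). b = c"
          unfolding Z_tensor_0[OF Hn] by (auto split: if_splits)
        then have "v (g l i) = v i" using Hs[of i] that by auto
        then show ?thesis using vi(1)[OF that(1)] by simp
      qed
      have vl: "v (2 * n + l) = parity_bit n m x l" if "l < k" for l
      proof -
        have "label_tensor (Spider X 0) (image_mset v (P l)) \<noteq> 0"
          using v(2) that unfolding f by (auto simp: prod_zero_iff simp del: label_tensor.simps)
        then have "even (size (filter_mset (\<lambda>b. b = 1) (image_mset v (P l))))"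
          unfolding X_tensor_0 by (auto split: if_splits)
        moreover have "{i. i < n \<and> m l i = 1 \<and> v (g l i) = 1} = {i. i < n \<and> m l i = 1 \<and> x ! i = 1}"
          using vg that by auto
        ultimately show ?thesis
          unfolding ones parity_bit_def by (cases "v (2 * n + l)") (auto split: if_splits)
      qed
      show ?thesis
      proof (rule PiE_ext)
        show "v \<in> wires ?D \<rightarrow>\<^sub>E UNIV" "v0 \<in> wires ?D \<rightarrow>\<^sub>E UNIV"
          using v(1) v0S by (auto simp: S_def)
        fix w assume "w \<in> wires ?D"
        then consider "w < 2 * n" | l where "l < k" "w = 2 * n + l" | l i where "l < k" "i < n" "m l i = 1" "w = g l i"
          unfolding W by blast
        then show "v w = v0 w"
        proof cases
          case 1
          show ?thesis
          proof (cases "w < n")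
            case False
            then have "w = n + (w - n)" "w - n < n" using 1 by auto
            then show ?thesis using vi(2) v0i(2) by metis
          qed (simp add: vi v0i)
        qed (simp_all add: vg vl v0l v0g)
      qed
    qed
    have "denote ?D x x = (\<Sum>v\<in>S. f v)" by (simp only: denote_def S_def f_def)
    also have "\<dots> = f v0"
    proof -
      have "sum f S = sum f {v0}"
        by (rule sum.mono_neutral_right[OF fin]) (use v0S uniq in blast)+
      then show ?thesis by simp
    qed
    also have "f v0 = c * (\<Prod>l<k. if parity_bit n m x l = 1 then cis (pi / 4) else 1)"
    proof -
      have 1: "label_tensor (Spider Z 0) (image_mset v0 (H i)) = 1" if "i < n" for i
      proof -
        have "\<forall>b\<in>#image_mset v0 (H i). b = x ! i" using that v0i v0g Hs[of i] by auto
        then show ?thesis unfolding Z_tensor_0[OF Hn] by auto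
      qed
      have 2: "label_tensor (Spider X 0) (image_mset v0 (P l)) = (1 / complex_of_real (sqrt 2)) ^ size (P l) * 2" if "l < k" for l
      proof -
        have "{i. i < n \<and> m l i = 1 \<and> v0 (g l i) = 1} = {i. i < n \<and> m l i = 1 \<and> x ! i = 1}"
          using v0g that by auto
        then have "even (size (filter_mset (\<lambda>b. b = 1) (image_mset v0 (P l))))"
          unfolding ones v0l[OF that] parity_bit_def by auto
        then show ?thesis unfolding X_tensor_0 by simp
      qed
      have 3: "label_tensor (Spider Z (angle (pi / 4))) {#v0 (2 * n + l)#} = (if parity_bit n m x l = 1 then cis (pi / 4) else 1)" if "l < k" for l
        unfolding T_tensor v0l[OF that] expi_angle ..
      have "(\<Prod>i<n. label_tensor (Spider Z 0) (image_mset v0 (H i))) = 1"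
        by (rule prod.neutral) (use 1 in blast)
      moreover have "(\<Prod>l<k. label_tensor (Spider X 0) (image_mset v0 (P l))) = c"
        unfolding c_def by (rule prod.cong[OF refl], rule 2) simp
      moreover have "(\<Prod>l<k. label_tensor (Spider Z (angle (pi / 4))) {#v0 (2 * n + l)#}) =
          (\<Prod>l<k. if parity_bit n m x l = 1 then cis (pi / 4) else 1)"
        by (rule prod.cong[OF refl], rule 3) simp
      ultimately show ?thesis unfolding f by (simp only: mult_1_left)
    qed
    finally show ?thesis .
  qed
  with c show ?thesis by blast
qed

lemma phase_product:
  "(\<Prod>l<k. if parity_bit n m x l = 1 then cis (pi / 4) else 1) =
    cis (pi / 4 * real_of_int (parity_sum (mset (rows k n m)) {i. i < n \<and> x ! i = 1}))"
proof (induction k)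
  case 0
  then show ?case by (simp add: rows_def)
next
  case (Suc k)
  let ?y = "{i. i < n \<and> x ! i = 1}"
  have "{i. i < n \<and> m k i = 1} \<inter> ?y = {i. i < n \<and> m k i = 1 \<and> x ! i = 1}" by auto
  then have "parity_sum (mset (rows (Suc k) n m)) ?y = parity_sum (mset (rows k n m)) ?y + of_bool (parity_bit n m x k = 1)"
    by (simp add: rows_def parity_bit_def)
  then show ?case
    using Suc by (simp add: lessThan_Suc cis_mult algebra_simps)
qed

lemma cis_eighth_eq:
  assumes "cis (pi / 4 * real_of_int a) = cis (pi / 4 * real_of_int b)"
  shows "8 dvd a - b"
proof -
  have "cis (pi / 4 * real_of_int (a - b)) = 1"
    using assms by (simp add: right_diff_distrib cis_divide[symmetric])
  then have "cos (pi / 4 * real_of_int (a - b)) = 1"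
    by (metis cis.simps(1) one_complex.simps(1))
  then obtain j :: int where "pi / 4 * real_of_int (a - b) = real_of_int j * 2 * pi"
    unfolding cos_one_2pi_int by blast
  then have "pi * real_of_int (a - b) = pi * real_of_int (8 * j)" by (simp add: field_simps)
  then have "real_of_int (a - b) = real_of_int (8 * j)" by (simp only: mult_cancel_left pi_neq_zero simp_thms)
  then have "a - b = 8 * j" by (simp only: of_int_eq_iff)
  then show ?thesis by simp
qed

lemma row_diagram_complete:
  assumes "denote_same_map (row_diagram k n m) (row_diagram l n m')"
  shows "row_diagram k n m \<approx> row_diagram l n m'"
proof -
  let ?S = "mset (rows k n m)" and ?T = "mset (rows l n m')"
  let ?e = "\<lambda>S (x :: bit list). cis (pi / 4 * real_of_int (parity_sum S {i. i < n \<and> x ! i = 1}))"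
  obtain c where c: "c \<noteq> 0" "\<And>x y. denote (row_diagram k n m) x y = c * denote (row_diagram l n m') x y"
    using assms by (auto simp: denote_same_map_def)
  obtain c1 where c1: "c1 \<noteq> 0" "\<And>x. length x = n \<Longrightarrow> denote (row_diagram k n m) x x = c1 * ?e ?S x"
    using denote_row_diagram[of n k m] unfolding phase_product by blast
  obtain c2 where c2: "c2 \<noteq> 0" "\<And>x. length x = n \<Longrightarrow> denote (row_diagram l n m') x x = c2 * ?e ?T x"
    using denote_row_diagram[of n l m'] unfolding phase_product by blast
  have e: "c1 * ?e ?S x = c * (c2 * ?e ?T x)" if "length x = n" for x
    using c(2)[of x x] c1(2)[OF that] c2(2)[OF that] by simp
  \<comment> \<open>At the all-zero input both phases are trivial, so the entries there compare the
    scalars alone and these cancel everywhere else.\<close>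
  have "?e S (replicate n 0) = 1" for S :: "nat set multiset"
  proof -
    have 1: "{i. i < n \<and> replicate n (0 :: bit) ! i = 1} = {}" by auto
    have 2: "parity_sum S {} = 0" by (induction S) auto
    show ?thesis unfolding 1 2 by simp
  qed
  then have "c1 = c * c2" using e[of "replicate n 0"] by simp
  then have eq: "?e ?S x = ?e ?T x" if "length x = n" for x
    using e[OF that] c1(1) by simp
  have rows: "v \<in># mset (rows k n m) \<Longrightarrow> v \<subseteq> {..<n}" for v k m by (auto simp: rows_def)
  have "?S \<simeq> ?T"
  proof (rule gadget_complete)
    show "finite v" if "v \<in># ?S + ?T" for v
    proof -
      have "v \<subseteq> {..<n}" using that rows by auto
      then show ?thesis by (rule finite_subset) simp
    qed
    fix y :: "nat set" assume "finite y"
    \<comment> \<open>Inputs only reach subsets of the \<open>n\<close> qubits, while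
      \<open>gadget_complete\<close> asks about every finite set. As the rows lie within
      \<open>{..<n}\<close>, cutting \<open>y\<close> down to the qubits leaves the parities
      unchanged.\<close>
    let ?x = "map (\<lambda>i. if i \<in> y then 1 else 0 :: bit) [0..<n]"
    have y: "{i. i < n \<and> ?x ! i = 1} = y \<inter> {..<n}" by (auto split: if_splits)
    have cut: "parity_sum S (y \<inter> {..<n}) = parity_sum S y" if "\<And>v. v \<in># S \<Longrightarrow> v \<subseteq> {..<n}" for S
      unfolding parity_sum_def
    proof (rule arg_cong[of _ _ sum_mset], rule image_mset_cong)
      fix v assume "v \<in># S"
      then have "v \<inter> (y \<inter> {..<n}) = v \<inter> y" using that by blast
      then show "of_bool (odd (card (v \<inter> (y \<inter> {..<n})))) = (of_bool (odd (card (v \<inter> y))) :: int)" by simp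
    qed
    have "8 dvd parity_sum ?S (y \<inter> {..<n}) - parity_sum ?T (y \<inter> {..<n})"
      using cis_eighth_eq[OF eq[of ?x, unfolded y]] by simp
    then show "8 dvd parity_sum ?S y - parity_sum ?T y"
      using cut[of ?S, OF rows] cut[of ?T, OF rows] by simp
  qed
  then have "gadget_diagram n (rows k n m) \<approx> gadget_diagram n (rows l n m')"
    by (rule gadget_diagram_sound) simp_all
  then show ?thesis
    using gadget_diagram_rows zx_eq_sym zx_eq_trans by blast
qed

theorem theorem3p4:
  fixes M N :: "bit mat" and n k l :: nat
  assumes "M \<in> carrier_mat k n" and "N \<in> carrier_mat l n"
    and "denote_same_map (matrix_diagram M) (matrix_diagram N)"
  shows "transformable (sup clifford_rule S4_rule) (matrix_diagram M) (matrix_diagram N)"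
proof -
  have "matrix_diagram M = row_diagram k n (\<lambda>l i. M $$ (l, i))"
    "matrix_diagram N = row_diagram l n (\<lambda>l i. N $$ (l, i))"
    using assms(1,2) by (auto simp: matrix_diagram_def row_diagram_def Let_def)
  then show ?thesis
    using row_diagram_complete assms(3) by (simp add: zx_eq_def)
qed

end
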